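(* Let $\Gamma$ be the free group of rank $r$ and $J>0$. For the uniform permutation model, the typical local limit of the (ferromagnetic) Ising model with interaction strength $J$ is $(\mu^++\mu^-)/2$: there are sets $S_n\subset\mathrm{Hom}(\Gamma,\mathrm{Sym}(n))$ with $\mathbb{P}(\sigma_n\in S_n)\to1$, where $\sigma_n$ is uniformly distributed on $\mathrm{Hom}(\Gamma,\mathrm{Sym}(n))$, such that whenever $\tau_n\in S_n$ for each $n$, $\{\tau_n\}$ is a sofic approximation to $\Gamma$ over which the finitary Gibbs states $\xi_n$ of the Ising model have local limit $(\mu^++\mu^-)/2$.
   Context: $\Gamma$ has free generators $s_1,\dots,s_r$, identity $e$, and is identified with its left Cayley graph (the $2r$-regular tree with edges $(g,s_ig)$); $\sim$ is adjacency. $\mathtt{A}=\{-1,+1\}$. For $\tau\in\mathrm{Hom}(\Gamma,\mathrm{Sym}(V))$ and $x\in\mathtt{A}^V$, $(\Pi_v^\tau x)(h)=x(\tau^hv)$. Sofic approximation: for every finite $F\subset\Gamma$ and $\delta>0$, for all large $n$ the fraction of $v\in\{1,\dots,n\}$ with $\tau_n(\gamma_1)v\ne\tau_n(\gamma_2)v$ for all distinct $\gamma_1,\gamma_2\in F$ exceeds $1-\delta$. Ising energy function: $u(x)=-\frac J2\sum_{\gamma\sim e}x(e)x(\gamma)$. The finitary Gibbs state $\xi_n\in\mathrm{Prob}(\mathtt{A}^{\{1,\dots,n\}})$ over $\tau_n$ is $\xi_n\{x\}\propto\exp(-\sum_{v}u(\Pi_v^{\tau_n}x))$. A measure on $\mathtt{A}^\Gamma$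 is Gibbs if for each finite $\Lambda\subset\Gamma$ the conditional law of $x|_\Lambda$ given $x|_{\Gamma\setminus\Lambda}$ is a.s. proportional to $\exp(J\sum x(g)x(g'))$, the sum over tree edges $\{g,g'\}$ meeting $\Lambda$. $\mu^+$ (resp. $\mu^-$) is the plus- (resp. minus-) boundary state: the weak limit as $R\to\infty$ of the Gibbs distributions on the ball of radius $R$ about $e$ with all spins outside the ball fixed to $+1$ (resp. $-1$). (If there is a unique Gibbs measure then $\mu^+=\mu^-$ is that measure.) The local limit of $\xi_n$ over $\{\tau_n\}$ is $\mu$ if for every weak-open neighborhood $\mathcal O$ of $\mu$ in $\mathrm{Prob}(\mathtt{A}^\Gamma)$, $\frac1n|\{v\in\{1,\dots,n\}:(\Pi_v^{\tau_n})_*\xi_n\in\mathcal O\}|\to1$. *)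

theory Defs
  imports "HOL-Probability.Probability" "HOL-Algebra.Sym_Groups"
begin

section \<open>The free group and its left Cayley graph\<close>

text \<open>
  The free group of rank \<open>r\<close> is realised on reduced words. The letter \<open>(i, True)\<close> stands for
  the generator \<open>s\<^sub>i\<close> and \<open>(i, False)\<close> for its inverse, \<open>1 \<le> i \<le> r\<close>.
\<close>

type_synonym word = "(nat \<times> bool) list"

definition inv_letter :: "nat \<times> bool \<Rightarrow> nat \<times> bool" where
  "inv_letter a = (fst a, \<not> snd a)"

definition reduced :: "word \<Rightarrow> bool" where
  "reduced w \<longleftrightarrow> successively (\<lambda>a b. b \<noteq> inv_letter a) w"

text \<open>For reduced \<open>w\<close>, this is the reduced form of the word \<open>a # w\<close>.\<close>

fun letter_mult :: "nat \<times> bool \<Rightarrow> word \<Rightarrow> word" where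
  "letter_mult a [] = [a]"
| "letter_mult a (b # w) = (if b = inv_letter a then w else a # b # w)"

definition free_group :: "nat \<Rightarrow> word monoid" where
  "free_group r =
     \<lparr>carrier = {w. set w \<subseteq> {1..r} \<times> UNIV \<and> reduced w},
      monoid.mult = (\<lambda>u v. foldr letter_mult u v),
      one = []\<rparr>"

definition gen :: "nat \<Rightarrow> word" where
  "gen i = [(i, True)]"

definition adj :: "nat \<Rightarrow> word \<Rightarrow> word \<Rightarrow> bool" where
  "adj r g g' \<longleftrightarrow> g \<in> carrier (free_group r) \<and> g' \<in> carrier (free_group r) \<and>
     (\<exists>i\<in>{1..r}. g' = gen i \<otimes>\<^bsub>free_group r\<^esub> g \<or> g = gen i \<otimes>\<^bsub>free_group r\<^esub> g')"

definition tree_edges :: "nat \<Rightarrow> word set set" where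
  "tree_edges r = {{g, g'} | g g'. adj r g g'}"

definition tree_ball :: "nat \<Rightarrow> nat \<Rightarrow> word set" where
  "tree_ball r R =
     {g \<in> carrier (free_group r). \<exists>k\<le>R. (adj r ^^ k) \<one>\<^bsub>free_group r\<^esub> g}"

section \<open>Actions on finite sets and sofic approximations\<close>

text \<open>
  The library's \<open>hom\<close> does not constrain values outside the carrier; extensionality makes
  each homomorphism a single element of a finite set.
\<close>

definition perm_homs :: "nat \<Rightarrow> nat \<Rightarrow> (word \<Rightarrow> nat \<Rightarrow> nat) set" where
  "perm_homs r n =
     hom (free_group r) (sym_group n) \<inter> extensional (carrier (free_group r))"

definition sofic_approximation :: "nat \<Rightarrow> (nat \<Rightarrow> word \<Rightarrow> nat \<Rightarrow> nat) \<Rightarrow> bool" where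
  "sofic_approximation r \<tau> \<longleftrightarrow>
     (\<forall>n. \<tau> n \<in> perm_homs r n) \<and>
     (\<forall>F \<delta>. finite F \<and> F \<subseteq> carrier (free_group r) \<and> (\<delta>::real) > 0 \<longrightarrow>
        (\<forall>\<^sub>F n in sequentially.
           real (card {v \<in> {1..n}. \<forall>\<gamma>\<^sub>1\<in>F. \<forall>\<gamma>\<^sub>2\<in>F. \<gamma>\<^sub>1 \<noteq> \<gamma>\<^sub>2 \<longrightarrow> \<tau> n \<gamma>\<^sub>1 v \<noteq> \<tau> n \<gamma>\<^sub>2 v})
             / real n > 1 - \<delta>))"

section \<open>Spin configurations and the weak topology\<close>

definition spins :: "real set" where
  "spins = {-1, 1}"

definition config_space :: "nat \<Rightarrow> (word \<Rightarrow> real) measure" where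
  "config_space r = (\<Pi>\<^sub>M g\<in>carrier (free_group r). count_space spins)"

definition config_topology :: "nat \<Rightarrow> (word \<Rightarrow> real) topology" where
  "config_topology r = product_topology (\<lambda>_. discrete_topology spins) (carrier (free_group r))"

definition config_probs :: "nat \<Rightarrow> (word \<Rightarrow> real) measure set" where
  "config_probs r = {\<mu>. prob_space \<mu> \<and> sets \<mu> = sets (config_space r)}"

text \<open>
  The configuration space is compact, so continuous test functions are automatically bounded.
\<close>

definition weak_topology :: "nat \<Rightarrow> (word \<Rightarrow> real) measure topology" where
  "weak_topology r = topology_generated_by
     {{\<mu> \<in> config_probs r. (\<integral>x. f x \<partial>\<mu>) \<in> U} | f U.
        continuous_map (config_topology r) euclideanreal f \<and> open (U :: real set)}"

text \<open>The probability measure on the finite set \<open>C\<close> whose point masses are proportional to \<open>w\<close>.\<close>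

definition normalized_measure :: "'a set \<Rightarrow> ('a \<Rightarrow> real) \<Rightarrow> 'a measure" where
  "normalized_measure C w = point_measure C (\<lambda>x. ennreal (w x / (\<Sum>y\<in>C. w y)))"

section \<open>The Ising model\<close>

definition ising_energy :: "nat \<Rightarrow> real \<Rightarrow> (word \<Rightarrow> real) \<Rightarrow> real" where
  "ising_energy r J x =
     - (J / 2) * (\<Sum>\<gamma> | adj r \<gamma> \<one>\<^bsub>free_group r\<^esub>. x \<one>\<^bsub>free_group r\<^esub> * x \<gamma>)"

text \<open>The pulled-back configuration \<open>\<Pi>\<^sub>v\<^sup>\<tau> x\<close>.\<close>

definition pullback :: "nat \<Rightarrow> (word \<Rightarrow> nat \<Rightarrow> nat) \<Rightarrow> nat \<Rightarrow> (nat \<Rightarrow> real) \<Rightarrow> word \<Rightarrow> real" where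
  "pullback r \<tau> v x = (\<lambda>h\<in>carrier (free_group r). x (\<tau> h v))"

definition finitary_gibbs ::
  "nat \<Rightarrow> real \<Rightarrow> nat \<Rightarrow> (word \<Rightarrow> nat \<Rightarrow> nat) \<Rightarrow> (nat \<Rightarrow> real) measure" where
  "finitary_gibbs r J n \<tau> =
     normalized_measure ({1..n} \<rightarrow>\<^sub>E spins)
       (\<lambda>x. exp (- (\<Sum>v\<in>{1..n}. ising_energy r J (pullback r \<tau> v x))))"

text \<open>
  An edge \<open>e = {g, g'}\<close> has two distinct endpoints, so \<open>\<Prod>g\<in>e. x g\<close> is \<open>x g * x g'\<close>.
  The sum over edges meeting \<open>\<Lambda>\<close> includes those joining \<open>\<Lambda>\<close> to its complement.
\<close>

definition gibbs_weight :: "nat \<Rightarrow> real \<Rightarrow> word set \<Rightarrow> (word \<Rightarrow> real) \<Rightarrow> real" where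
  "gibbs_weight r J \<Lambda> x = exp (J * (\<Sum>e | e \<in> tree_edges r \<and> e \<inter> \<Lambda> \<noteq> {}. \<Prod>g\<in>e. x g))"

definition ball_gibbs :: "nat \<Rightarrow> real \<Rightarrow> real \<Rightarrow> nat \<Rightarrow> (word \<Rightarrow> real) measure" where
  "ball_gibbs r J b R =
     distr
       (normalized_measure
          {x \<in> carrier (free_group r) \<rightarrow>\<^sub>E spins.
             \<forall>g \<in> carrier (free_group r) - tree_ball r R. x g = b}
          (gibbs_weight r J (tree_ball r R)))
       (config_space r) (\<lambda>x. x)"

definition boundary_state :: "nat \<Rightarrow> real \<Rightarrow> real \<Rightarrow> (word \<Rightarrow> real) measure" where
  "boundary_state r J b =
     (THE \<mu>. limitin (weak_topology r) (ball_gibbs r J b) \<mu> sequentially)"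

abbreviation plus_state :: "nat \<Rightarrow> real \<Rightarrow> (word \<Rightarrow> real) measure" where
  "plus_state r J \<equiv> boundary_state r J 1"

abbreviation minus_state :: "nat \<Rightarrow> real \<Rightarrow> (word \<Rightarrow> real) measure" where
  "minus_state r J \<equiv> boundary_state r J (-1)"

definition average_measure :: "'a measure \<Rightarrow> 'a measure \<Rightarrow> 'a measure" where
  "average_measure \<mu> \<nu> =
     measure_of (space \<mu>) (sets \<mu>) (\<lambda>A. (emeasure \<mu> A + emeasure \<nu> A) / 2)"

definition has_local_limit ::
  "nat \<Rightarrow> (nat \<Rightarrow> word \<Rightarrow> nat \<Rightarrow> nat) \<Rightarrow> (nat \<Rightarrow> (nat \<Rightarrow> real) measure) \<Rightarrow>
     (word \<Rightarrow> real) measure \<Rightarrow> bool" where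
  "has_local_limit r \<tau> \<xi> \<mu> \<longleftrightarrow>
     \<mu> \<in> config_probs r \<and>
     (\<forall>\<O>. openin (weak_topology r) \<O> \<and> \<mu> \<in> \<O> \<longrightarrow>
        (\<lambda>n. real (card {v \<in> {1..n}. distr (\<xi> n) (config_space r) (pullback r (\<tau> n) v) \<in> \<O>})
               / real n) \<longlonglongrightarrow> 1)"

end

theory Submission
  imports Defs
begin

text \<open>
  Write \<open>h\<^sup>+\<close> for the largest fixed point of the recursion for boundary fields on the tree.
  Conditionally on the spins far away, the spins near a vertex \<open>v\<close> with a tree-like neighbourhood
  follow an Ising model on a ball whose boundary fields lie, up to a small error, in
  \<open>[-h\<^sup>+, h\<^sup>+]\<close>. Among these models only the two with all fields \<open>h\<^sup>+\<close> or all fields \<open>-h\<^sup>+\<close>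
  maximise the nearest-neighbour correlation at the root, and they give the plus and minus state.
  The mean energy per vertex attains this maximum: by convexity of the free energy in \<open>\<beta>\<close>
  the energy at \<open>\<beta>\<close> exceeds, up to \<open>O(B)\<close>, the energy at some \<open>\<beta>' < \<beta>\<close> with a small field \<open>B\<close>,
  and Griffiths' inequality bounds the latter from below by that of a ball with boundary field \<open>B\<close>,
  which the recursion drives up to (almost) \<open>h\<^sup>+\<close>. Hence the view from most vertices is close to a
  mixture of the two states, and spin-flip symmetry makes the weights equal. Uniformly random
  permutations have few short cycles, so most neighbourhoods are tree-like.
\<close>

section \<open>Spin sums and Griffiths' inequalities\<close>

text \<open>Why a field is needed at all: with zero boundary fields the recursion starts at 0 and
  stays there, so Griffiths' inequality at \<beta> alone only yields the free correlation, not that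
  of the plus phase. Any \<open>B > 0\<close> is amplified by the recursion, but it changes the
  model; comparing with a smaller \<beta>' turns this change into an error of order
  \<open>B / (\<beta> - \<beta>')\<close> per vertex. Hence \<beta>' has to be fixed before
  \<open>B\<close>.

  The view from a vertex is never decomposed into its two phases. Only even observables are tested.
  On these the phases agree, and the deviation from the common value is at most a small constant
  plus a multiple of the energy deficit. Such a bound is a pair of affine inequalities in the
  conditional law and therefore survives averaging over the far spins.

  The random model enters through a single property: for every radius, almost all vertices have a
  ball that embeds injectively. One diagonal choice of radii turns this into a condition on
  \<open>S n\<close>.\<close>

definition ssum :: "'a set \<Rightarrow> (('a \<Rightarrow> real) \<Rightarrow> real) \<Rightarrow> real" where
  "ssum V F = (\<Sum>x\<in>V \<rightarrow>\<^sub>E spins. F x)"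

lemma finite_spins [simp]: "finite spins"
  by (simp add: spins_def)

lemma finite_confs [simp]: "finite V \<Longrightarrow> finite (V \<rightarrow>\<^sub>E spins)"
  by (simp add: finite_PiE)

lemma confs_nonempty [simp]: "V \<rightarrow>\<^sub>E spins \<noteq> {}"
  by (simp add: PiE_eq_empty_iff spins_def)

lemma conf_spin: "x \<in> V \<rightarrow>\<^sub>E spins \<Longrightarrow> i \<in> V \<Longrightarrow> x i = 1 \<or> x i = -1"
  by (auto simp: spins_def dest: PiE_mem)

lemma conf_sq: "x \<in> V \<rightarrow>\<^sub>E spins \<Longrightarrow> i \<in> V \<Longrightarrow> x i * x i = 1"
  using conf_spin[of x V i] by auto

lemma conf_abs: "x \<in> V \<rightarrow>\<^sub>E spins \<Longrightarrow> i \<in> V \<Longrightarrow> \<bar>x i\<bar> = 1"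
  using conf_spin[of x V i] by auto

lemma sum_spins: "(\<Sum>s\<in>spins. f s) = f 1 + f (-1)"
  by (simp add: spins_def add.commute)

lemma ssum_cong: "(\<And>x. x \<in> V \<rightarrow>\<^sub>E spins \<Longrightarrow> F x = G x) \<Longrightarrow> ssum V F = ssum V G"
  by (simp add: ssum_def cong: sum.cong)

lemma ssum_mono: "(\<And>x. x \<in> V \<rightarrow>\<^sub>E spins \<Longrightarrow> F x \<le> G x) \<Longrightarrow> ssum V F \<le> ssum V G"
  by (simp add: ssum_def sum_mono)

lemma ssum_nonneg: "(\<And>x. x \<in> V \<rightarrow>\<^sub>E spins \<Longrightarrow> 0 \<le> F x) \<Longrightarrow> 0 \<le> ssum V F"
  by (simp add: ssum_def sum_nonneg)

lemma ssum_pos: "finite V \<Longrightarrow> (\<And>x. x \<in> V \<rightarrow>\<^sub>E spins \<Longrightarrow> 0 < F x) \<Longrightarrow> 0 < ssum V F"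
  unfolding ssum_def by (intro sum_pos) auto

lemma ssum_add: "ssum V (\<lambda>x. F x + G x) = ssum V F + ssum V G"
  by (simp add: ssum_def sum.distrib)

lemma ssum_diff: "ssum V (\<lambda>x. F x - G x) = ssum V F - ssum V G"
  by (simp add: ssum_def sum_subtractf)

lemma ssum_mult_left: "ssum V (\<lambda>x. c * F x) = c * ssum V F"
  by (simp add: ssum_def sum_distrib_left)

lemma ssum_mult_right: "ssum V (\<lambda>x. F x * c) = ssum V F * c"
  by (simp add: ssum_def sum_distrib_right)

lemma ssum_sum: "ssum V (\<lambda>x. \<Sum>k\<in>K. F k x) = (\<Sum>k\<in>K. ssum V (F k))"
  unfolding ssum_def by (rule sum.swap)

lemma ssum_prod:
  assumes "finite V"
  shows "ssum V (\<lambda>x. \<Prod>i\<in>V. f i (x i)) = (\<Prod>i\<in>V. f i 1 + f i (-1))"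
  unfolding ssum_def using assms by (subst prod_sum_PiE[symmetric]) (auto simp: sum_spins)

lemma ssum_Un:
  assumes "A \<inter> B = {}"
  shows "ssum (A \<union> B) F = ssum A (\<lambda>y. ssum B (\<lambda>z. F (\<lambda>i. if i \<in> A then y i else z i)))"
proof -
  have "ssum (A \<union> B) F =
      (\<Sum>p\<in>(A \<rightarrow>\<^sub>E spins) \<times> (B \<rightarrow>\<^sub>E spins). F (\<lambda>i. if i \<in> A then fst p i else snd p i))"
    unfolding ssum_def
  proof (rule sum.reindex_bij_witness[where
        i = "\<lambda>p i. if i \<in> A then fst p i else snd p i" and j = "\<lambda>x. (restrict x A, restrict x B)"], goal_cases)
    case (1 x)
    then show ?case by (auto simp: fun_eq_iff PiE_def extensional_def)
  next
    case (2 x)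
    then show ?case by (auto simp: PiE_def Pi_def extensional_def)
  next
    case (3 p)
    then show ?case using assms by (auto simp: fun_eq_iff PiE_def extensional_def prod_eq_iff)
  next
    case (4 p)
    then show ?case by (auto simp: PiE_def Pi_def extensional_def)
  next
    case (5 x)
    have "(\<lambda>i. if i \<in> A then fst (restrict x A, restrict x B) i else snd (restrict x A, restrict x B) i) = x"
      using 5 by (auto simp: fun_eq_iff PiE_def extensional_def)
    then show ?case by (rule arg_cong[where f = F])
  qed
  then show ?thesis by (simp add: ssum_def sum.cartesian_product case_prod_unfold)
qed

lemma ssum_reindex:
  assumes T: "inj_on T B"
  shows "ssum (T ` B) F = ssum B (\<lambda>z. F (\<lambda>u\<in>T ` B. z (inv_into B T u)))"
  unfolding ssum_def
proof (rule sum.reindex_bij_witness[where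
        i = "\<lambda>z. \<lambda>u\<in>T ` B. z (inv_into B T u)" and j = "\<lambda>x. \<lambda>w\<in>B. x (T w)"], goal_cases)
  case (1 x)
  then show ?case using T by (auto simp: fun_eq_iff PiE_def extensional_def f_inv_into_f inv_into_into)
next
  case (2 x)
  then show ?case using T by auto
next
  case (3 z)
  then show ?case using T by (auto simp: fun_eq_iff PiE_def extensional_def)
next
  case (4 z)
  then show ?case using T by (auto simp: PiE_def Pi_def)
next
  case (5 x)
  have "(\<lambda>u\<in>T ` B. (\<lambda>w\<in>B. x (T w)) (inv_into B T u)) = x"
    using 5 T by (auto simp: fun_eq_iff PiE_def extensional_def)
  then show ?case by simp
qed

lemma ssum_flip: "ssum V F = ssum V (\<lambda>x. F (\<lambda>i\<in>V. - x i))"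
  unfolding ssum_def
  by (rule sum.reindex_bij_witness[where i = "\<lambda>x. \<lambda>i\<in>V. - x i" and j = "\<lambda>x. \<lambda>i\<in>V. - x i"])
    (auto simp: spins_def fun_eq_iff PiE_def Pi_def extensional_def
      intro!: arg_cong[where f = F])

text \<open>Pointwise multiplication by a fixed configuration is an involution of the
  configurations; it is the change of variables behind the second Griffiths inequality.\<close>

lemma ssum_mult_conf:
  assumes "x \<in> V \<rightarrow>\<^sub>E spins"
  shows "ssum V F = ssum V (\<lambda>t. F (\<lambda>i\<in>V. x i * t i))"
proof -
  have *: "x i * (x i * y) = y" if "i \<in> V" for i y
    using conf_sq[OF assms that] by (simp flip: mult.assoc)
  have **: "(\<lambda>i\<in>V. x i * t i) \<in> V \<rightarrow>\<^sub>E spins" if "t \<in> V \<rightarrow>\<^sub>E spins" for t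
    using conf_spin[OF assms] conf_spin[OF that] by (force simp: spins_def)
  show ?thesis
    unfolding ssum_def
    by (rule sum.reindex_bij_witness[where i = "\<lambda>t. \<lambda>i\<in>V. x i * t i" and j = "\<lambda>t. \<lambda>i\<in>V. x i * t i"])
      (use ** in \<open>auto simp: * fun_eq_iff PiE_def extensional_def intro!: arg_cong[where f = F]\<close>)
qed

section \<open>Characters of the group of spin configurations and correlation inequalities\<close>

definition chi :: "'a set \<Rightarrow> ('a \<Rightarrow> real) \<Rightarrow> real" where
  "chi C x = (\<Prod>i\<in>C. x i)"

lemma chi_spin:
  assumes "x \<in> V \<rightarrow>\<^sub>E spins" "C \<subseteq> V"
  shows "chi C x = 1 \<or> chi C x = -1"
proof (cases "finite C")
  case True
  then show ?thesis using assms(2)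
  proof (induction C rule: finite_induct)
    case (insert i C)
    then have "x i = 1 \<or> x i = -1" "chi C x = 1 \<or> chi C x = -1"
      using conf_spin[OF assms(1)] by auto
    then show ?case using insert.hyps by (auto simp: chi_def)
  qed (simp add: chi_def)
qed (simp add: chi_def)

lemma chi_mult:
  assumes "finite V" "x \<in> V \<rightarrow>\<^sub>E spins" "A \<subseteq> V" "B \<subseteq> V"
  shows "chi A x * chi B x = chi (sym_diff A B) x"
proof -
  have fin: "finite A" "finite B" using assms by (auto intro: finite_subset)
  have 1: "chi A x = chi (A - B) x * chi (A \<inter> B) x"
    unfolding chi_def using prod.Int_Diff[OF fin(1), of x B] by (simp add: mult.commute)
  have 2: "chi B x = chi (B - A) x * chi (A \<inter> B) x"
    unfolding chi_def using prod.Int_Diff[OF fin(2), of x A] by (simp add: mult.commute Int_commute)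
  have 3: "chi (sym_diff A B) x = chi (A - B) x * chi (B - A) x"
    unfolding chi_def by (rule prod.union_disjoint) (use fin in auto)
  have 4: "chi (A \<inter> B) x * chi (A \<inter> B) x = 1"
    using chi_spin[OF assms(2) le_infI1[OF assms(3), of B]] by auto
  show ?thesis
    unfolding 1 2 3 using 4 by (metis (no_types, opaque_lifting) mult.assoc mult.commute mult.right_neutral)
qed

text \<open>The sum factorises over the sites: a site of \<open>A\<close> contributes
  \<open>1 + (-1)\<close>, every other site contributes 2.\<close>

lemma ssum_chi_nonneg:
  assumes "finite V" "A \<subseteq> V"
  shows "0 \<le> ssum V (chi A)"
proof -
  have "chi A x = (\<Prod>i\<in>V. if i \<in> A then x i else 1)" for x
    using assms by (simp add: chi_def prod.If_cases Int_absorb1)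
  then have "ssum V (chi A) = ssum V (\<lambda>x. \<Prod>i\<in>V. (\<lambda>i s. if i \<in> A then s else 1) i (x i))"
    by (intro ssum_cong) simp
  also have "\<dots> \<ge> 0"
    by (subst ssum_prod[OF assms(1)]) (intro prod_nonneg, auto)
  finally show ?thesis .
qed

lemma exp_spin: "s = 1 \<or> s = -1 \<Longrightarrow> exp (J * s) = cosh J + s * sinh (J::real)"
  by (auto simp: cosh_def sinh_def field_simps)

text \<open>By \<open>exp_spin\<close> each factor of the weight becomes
  \<open>cosh (J k) + chi (C k) x * sinh (J k)\<close> with non-negative coefficients, and a product
  of characters is a character again. Hence the set \<open>A\<close> varies in the
  induction.\<close>

lemma griffiths_first:
  assumes "finite V" "finite K"
    and "A \<subseteq> V" "\<And>k. k \<in> K \<Longrightarrow> C k \<subseteq> V" "\<And>k. k \<in> K \<Longrightarrow> 0 \<le> J k"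
  shows "0 \<le> ssum V (\<lambda>x. chi A x * exp (\<Sum>k\<in>K. J k * chi (C k) x))"
  using assms(2-)
proof (induction K arbitrary: A rule: finite_induct)
  case empty
  then show ?case using ssum_chi_nonneg[OF assms(1)] by simp
next
  case (insert k K)
  let ?w = "\<lambda>x. exp (\<Sum>k\<in>K. J k * chi (C k) x)"
  have C: "C k \<subseteq> V" "0 \<le> J k" using insert.prems by auto
  have eq: "chi A x * exp (\<Sum>k\<in>insert k K. J k * chi (C k) x) =
      cosh (J k) * (chi A x * ?w x) + sinh (J k) * (chi (sym_diff A (C k)) x * ?w x)"
    if x: "x \<in> V \<rightarrow>\<^sub>E spins" for x
    using insert.hyps
    by (simp add: exp_add exp_spin[OF chi_spin[OF x C(1)]] chi_mult[OF assms(1) x insert.prems(1) C(1), symmetric]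
        algebra_simps)
  have "ssum V (\<lambda>x. chi A x * exp (\<Sum>k\<in>insert k K. J k * chi (C k) x)) =
      cosh (J k) * ssum V (\<lambda>x. chi A x * ?w x) +
      sinh (J k) * ssum V (\<lambda>x. chi (sym_diff A (C k)) x * ?w x)"
    by (simp add: eq ssum_add ssum_mult_left cong: ssum_cong)
  also have "\<dots> \<ge> 0"
    using insert.prems C
    by (intro add_nonneg_nonneg mult_nonneg_nonneg insert.IH) auto
  finally show ?case .
qed

text \<open>Ginibre's argument: in the duplicated system substitute \<open>y = x t\<close>; for every fixed \<open>t\<close> the
  remaining sum over \<open>x\<close> has couplings \<open>J (1 + t) \<ge> 0\<close>.\<close>

lemma griffiths_second:
  assumes "finite V" "finite K"
    and "A \<subseteq> V" "B \<subseteq> V" "\<And>k. k \<in> K \<Longrightarrow> C k \<subseteq> V" "\<And>k. k \<in> K \<Longrightarrow> 0 \<le> J k"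
  defines "w \<equiv> \<lambda>x. exp (\<Sum>k\<in>K. J k * chi (C k) x)"
  shows "ssum V (\<lambda>x. chi A x * w x) * ssum V (\<lambda>x. chi B x * w x)
    \<le> ssum V (\<lambda>x. chi A x * chi B x * w x) * ssum V w"
proof -
  have chi_res: "chi C (\<lambda>i\<in>V. x i * t i) = chi C x * chi C t" if "C \<subseteq> V" for C x t
    unfolding chi_def prod.distrib[symmetric] using that by (intro prod.cong) auto
  \<comment> \<open>Summed over \<open>x\<close> and \<open>y\<close>, \<open>?G\<close> gives the
    right side minus the left side of the claim.\<close>
  let ?G = "\<lambda>x y. chi A x * (chi B x - chi B y) * w x * w y"
  have inner: "0 \<le> ssum V (\<lambda>x. ?G x (\<lambda>i\<in>V. x i * t i))" if t: "t \<in> V \<rightarrow>\<^sub>E spins" for t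
  proof -
    have "ssum V (\<lambda>x. ?G x (\<lambda>i\<in>V. x i * t i)) =
        ssum V (\<lambda>x. (1 - chi B t) *
          (chi (sym_diff A B) x * exp (\<Sum>k\<in>K. (J k * (1 + chi (C k) t)) * chi (C k) x)))"
    proof (rule ssum_cong)
      fix x assume x: "x \<in> V \<rightarrow>\<^sub>E spins"
      have "w (\<lambda>i\<in>V. x i * t i) = exp (\<Sum>k\<in>K. J k * (chi (C k) x * chi (C k) t))"
        unfolding w_def using assms(5) by (intro arg_cong[where f = exp] sum.cong) (auto simp: chi_res)
      then have "w x * w (\<lambda>i\<in>V. x i * t i) = exp (\<Sum>k\<in>K. (J k * (1 + chi (C k) t)) * chi (C k) x)"
        unfolding w_def by (simp add: exp_add[symmetric] sum.distrib[symmetric] algebra_simps)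
      then show "?G x (\<lambda>i\<in>V. x i * t i) = (1 - chi B t) *
          (chi (sym_diff A B) x * exp (\<Sum>k\<in>K. (J k * (1 + chi (C k) t)) * chi (C k) x))"
        using chi_mult[OF assms(1) x assms(3,4)]
        by (simp add: chi_res[OF assms(4)] mult.assoc) (simp add: algebra_simps)
    qed
    also have "\<dots> = (1 - chi B t) * ssum V (\<lambda>x.
          chi (sym_diff A B) x * exp (\<Sum>k\<in>K. (J k * (1 + chi (C k) t)) * chi (C k) x))"
      by (rule ssum_mult_left)
    also have "\<dots> \<ge> 0"
    proof (intro mult_nonneg_nonneg griffiths_first assms)
      show "0 \<le> 1 - chi B t" using chi_spin[OF t assms(4)] by auto
      show "sym_diff A B \<subseteq> V" using assms by auto
      show "0 \<le> 1 + chi (C k) t" if "k \<in> K" for k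
        using chi_spin[OF t assms(5)[OF that]] by auto
    qed auto
    finally show ?thesis .
  qed
  have "ssum V (\<lambda>x. ssum V (\<lambda>y. ?G x y)) = ssum V (\<lambda>x. ssum V (\<lambda>t. ?G x (\<lambda>i\<in>V. x i * t i)))"
    by (intro ssum_cong ssum_mult_conf)
  also have "\<dots> = ssum V (\<lambda>t. ssum V (\<lambda>x. ?G x (\<lambda>i\<in>V. x i * t i)))"
    unfolding ssum_def by (rule sum.swap)
  also have "\<dots> \<ge> 0" by (intro ssum_nonneg inner)
  finally have "0 \<le> ssum V (\<lambda>x. ssum V (\<lambda>y. ?G x y))" .
  also have "ssum V (\<lambda>x. ssum V (\<lambda>y. ?G x y)) =
      ssum V (\<lambda>x. chi A x * chi B x * w x) * ssum V w -
      ssum V (\<lambda>x. chi A x * w x) * ssum V (\<lambda>x. chi B x * w x)"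
  proof -
    have "?G x y = (chi A x * chi B x * w x) * w y - (chi A x * w x) * (chi B y * w y)" for x y
      by (simp add: algebra_simps)
    then show ?thesis
      by (simp add: ssum_diff ssum_mult_left ssum_mult_right del: mult.assoc)
  qed
  finally show ?thesis by simp
qed

text \<open>It suffices to add one coupling. Numerator and denominator then split into a
  \<open>cosh\<close> and a \<open>sinh\<close> part; in the cross product the \<open>cosh\<close>
  parts cancel, and the \<open>sinh\<close> parts are compared by the second inequality.\<close>

lemma griffiths_mono:
  assumes "finite V" "finite K" "finite K'" "K \<inter> K' = {}" "A \<subseteq> V"
    and "\<And>k. k \<in> K \<union> K' \<Longrightarrow> C k \<subseteq> V" "\<And>k. k \<in> K \<union> K' \<Longrightarrow> 0 \<le> J k"
  defines "w \<equiv> \<lambda>K x. exp (\<Sum>k\<in>K. J k * chi (C k) x)"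
  shows "ssum V (\<lambda>x. chi A x * w K x) / ssum V (w K)
    \<le> ssum V (\<lambda>x. chi A x * w (K \<union> K') x) / ssum V (w (K \<union> K'))"
  using assms(3,4,6,7)
proof (induction K' rule: finite_induct)
  case (insert k K')
  define L where "L = K \<union> K'"
  have L: "finite L" "k \<notin> L" using insert.hyps insert.prems assms(2) by (auto simp: L_def)
  have C: "C k \<subseteq> V" "0 \<le> J k" using insert.prems by auto
  have pos: "0 < ssum V (w L)" "0 < ssum V (w (insert k L))"
    using assms(1) by (auto intro!: ssum_pos simp: w_def)
  have w: "w (insert k L) x = cosh (J k) * w L x + sinh (J k) * (chi (C k) x * w L x)"
    if "x \<in> V \<rightarrow>\<^sub>E spins" for x
    using L by (simp add: w_def exp_add exp_spin[OF chi_spin[OF that C(1)]] algebra_simps)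
  have "chi A x * w (insert k L) x =
      cosh (J k) * (chi A x * w L x) + sinh (J k) * (chi A x * chi (C k) x * w L x)"
    if "x \<in> V \<rightarrow>\<^sub>E spins" for x
    using w[OF that] by (simp add: algebra_simps)
  then have s1: "ssum V (\<lambda>x. chi A x * w (insert k L) x) = cosh (J k) * ssum V (\<lambda>x. chi A x * w L x)
      + sinh (J k) * ssum V (\<lambda>x. chi A x * chi (C k) x * w L x)"
    by (simp add: ssum_add ssum_mult_left cong: ssum_cong)
  have s2: "ssum V (w (insert k L)) = cosh (J k) * ssum V (w L) + sinh (J k) * ssum V (\<lambda>x. chi (C k) x * w L x)"
  proof -
    have "ssum V (w (insert k L)) = ssum V (\<lambda>x. cosh (J k) * w L x + sinh (J k) * (chi (C k) x * w L x))"
      by (rule ssum_cong) (rule w)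
    then show ?thesis by (simp add: ssum_add ssum_mult_left)
  qed
  have gr: "ssum V (\<lambda>x. chi A x * w L x) * ssum V (\<lambda>x. chi (C k) x * w L x)
      \<le> ssum V (\<lambda>x. chi A x * chi (C k) x * w L x) * ssum V (w L)"
    unfolding w_def
    using insert.prems by (intro griffiths_second assms(1) L(1) assms(5)) (auto simp: L_def)
  have "ssum V (\<lambda>x. chi A x * w K x) / ssum V (w K) \<le> ssum V (\<lambda>x. chi A x * w L x) / ssum V (w L)"
    unfolding L_def using insert.prems by (intro insert.IH) auto
  also have "\<dots> \<le> ssum V (\<lambda>x. chi A x * w (insert k L) x) / ssum V (w (insert k L))"
  proof -
    have "ssum V (\<lambda>x. chi A x * w L x) * ssum V (w (insert k L))
        \<le> ssum V (\<lambda>x. chi A x * w (insert k L) x) * ssum V (w L)"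
      unfolding s1 s2 using mult_left_mono[OF gr, of "sinh (J k)"] C(2)
      by (simp add: algebra_simps)
    then show ?thesis using pos by (simp add: frac_le_eq divide_simps mult.commute)
  qed
  finally show ?case by (simp add: L_def)
qed simp

section \<open>Reduced words and permutation representations\<close>

abbreviation words :: "nat \<Rightarrow> word set" where
  "words r \<equiv> carrier (free_group r)"

definition letters :: "nat \<Rightarrow> (nat \<times> bool) set" where
  "letters r = {1..r} \<times> UNIV"

definition word_ball :: "nat \<Rightarrow> nat \<Rightarrow> word set" where
  "word_ball r k = {w \<in> words r. length w \<le> k}"

definition word_sphere :: "nat \<Rightarrow> nat \<Rightarrow> word set" where
  "word_sphere r k = {w \<in> words r. length w = k}"

text \<open>Left multiplication acts at the head of a word, so the path from \<open>[]\<close> to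
  \<open>w\<close> runs through the suffixes of \<open>w\<close>, and \<open>tl w\<close> is the
  parent of \<open>w\<close>.\<close>

definition children :: "nat \<Rightarrow> word \<Rightarrow> word set" where
  "children r p = {w \<in> words r. w \<noteq> [] \<and> tl w = p}"

lemma inv_letter_inv [simp]: "inv_letter (inv_letter a) = a"
  by (simp add: inv_letter_def)

lemma inv_letter_eq_iff [simp]: "inv_letter a = inv_letter b \<longleftrightarrow> a = b"
  by (metis inv_letter_inv)

lemma inv_letter_swap: "b = inv_letter a \<longleftrightarrow> a = inv_letter b"
  by (metis inv_letter_inv)

lemma inv_letter_neq [simp]: "inv_letter a \<noteq> a" "a \<noteq> inv_letter a"
  by (auto simp: inv_letter_def prod_eq_iff)

lemma inv_letter_in [simp]: "inv_letter a \<in> letters r \<longleftrightarrow> a \<in> letters r"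
  by (auto simp: inv_letter_def letters_def mem_Times_iff)

lemma finite_letters [simp]: "finite (letters r)"
  by (simp add: letters_def)

lemma card_letters: "card (letters r) = 2 * r"
  by (simp add: letters_def card_cartesian_product mult.commute)

lemma Nil_in_words [simp]: "[] \<in> words r"
  by (simp add: free_group_def reduced_def)

lemma one_free_group [simp]: "\<one>\<^bsub>free_group r\<^esub> = []"
  by (simp add: free_group_def)

lemma mult_free_group: "u \<otimes>\<^bsub>free_group r\<^esub> v = foldr letter_mult u v"
  by (simp add: free_group_def)

lemma Cons_in_words:
  "a # w \<in> words r \<longleftrightarrow> a \<in> letters r \<and> w \<in> words r \<and> (w = [] \<or> hd w \<noteq> inv_letter a)"
  by (auto simp: free_group_def reduced_def letters_def successively_Cons)

lemma singleton_in_words [simp]: "[a] \<in> words r \<longleftrightarrow> a \<in> letters r"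
  by (simp add: Cons_in_words)

lemma tl_in_words: "w \<in> words r \<Longrightarrow> tl w \<in> words r"
  by (cases w) (auto simp: Cons_in_words)

lemma hd_in_letters: "w \<in> words r \<Longrightarrow> w \<noteq> [] \<Longrightarrow> hd w \<in> letters r"
  by (cases w) (auto simp: Cons_in_words)

lemma words_set: "w \<in> words r \<Longrightarrow> set w \<subseteq> letters r"
  by (auto simp: free_group_def letters_def)

lemma letter_mult_in: "a \<in> letters r \<Longrightarrow> w \<in> words r \<Longrightarrow> letter_mult a w \<in> words r"
  by (cases w) (auto simp: Cons_in_words)

lemma letter_mult_inv:
  assumes "w \<in> words r"
  shows "letter_mult (inv_letter a) (letter_mult a w) = w"
proof (cases w)
  case (Cons b u)
  then show ?thesis using assms
    by (cases u) (auto simp: Cons_in_words)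
qed simp

lemma letter_mult_inv': "w \<in> words r \<Longrightarrow> letter_mult a (letter_mult (inv_letter a) w) = w"
  using letter_mult_inv[of w r "inv_letter a"] by simp

lemma letter_mult_Cons: "a # w \<in> words r \<Longrightarrow> letter_mult a w = a # w"
  by (cases w) (auto simp: Cons_in_words)

lemma letter_mult_cases:
  assumes "w \<in> words r" "a \<in> letters r"
  obtains "letter_mult a w = a # w" "a # w \<in> words r"
  | "w \<noteq> []" "a = inv_letter (hd w)" "letter_mult a w = tl w"
proof (cases "w \<noteq> [] \<and> hd w = inv_letter a")
  case True
  then obtain b u where w: "w = b # u" "b = inv_letter a" by (metis list.collapse)
  then have "letter_mult a w = tl w" "a = inv_letter (hd w)" "w \<noteq> []" by simp_all
  then show ?thesis using that(2) by blast
next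
  case False
  then have "a # w \<in> words r" using assms by (simp add: Cons_in_words)
  then show ?thesis using letter_mult_Cons that(1) by blast
qed

lemma length_letter_mult: "length (letter_mult a w) \<le> Suc (length w)"
  by (cases w) auto

lemma foldr_letter_mult_in:
  "set u \<subseteq> letters r \<Longrightarrow> w \<in> words r \<Longrightarrow> foldr letter_mult u w \<in> words r"
  by (induction u) (auto intro: letter_mult_in)

lemma word_ball_in: "w \<in> word_ball r k \<Longrightarrow> w \<in> words r"
  by (simp add: word_ball_def)

lemma Nil_in_ball [simp]: "[] \<in> word_ball r k"
  by (simp add: word_ball_def)

lemma finite_word_ball [simp]: "finite (word_ball r k)"
proof (rule finite_subset)
  show "word_ball r k \<subseteq> {w. set w \<subseteq> letters r \<and> length w \<le> k}"
    using words_set by (auto simp: word_ball_def)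
qed (simp add: finite_lists_length_le)

lemma sphere_subset_ball: "word_sphere r k \<subseteq> word_ball r k"
  by (auto simp: word_sphere_def word_ball_def)

lemma finite_word_sphere [simp]: "finite (word_sphere r k)"
  using finite_subset[OF sphere_subset_ball] by simp

lemma word_ball_mono: "k \<le> l \<Longrightarrow> word_ball r k \<subseteq> word_ball r l"
  by (auto simp: word_ball_def)

lemma word_ball_Suc: "word_ball r (Suc k) = word_ball r k \<union> word_sphere r (Suc k)"
  by (auto simp: word_ball_def word_sphere_def)

lemma ball_sphere_disjoint: "word_ball r k \<inter> word_sphere r (Suc k) = {}"
  by (auto simp: word_ball_def word_sphere_def)

lemma word_ball_0 [simp]: "word_ball r 0 = {[]}"
  by (auto simp: word_ball_def)

lemma tl_in_ball: "w \<in> word_ball r k \<Longrightarrow> tl w \<in> word_ball r k"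
  by (auto simp: word_ball_def tl_in_words)

lemma tl_in_sphere: "w \<in> word_sphere r (Suc k) \<Longrightarrow> tl w \<in> word_sphere r k"
  by (auto simp: word_sphere_def tl_in_words)

lemma finite_children [simp]: "finite (children r p)"
proof (rule finite_subset)
  show "children r p \<subseteq> word_ball r (Suc (length p))"
    by (auto simp: children_def word_ball_def)
qed simp

lemma children_sphere: "p \<in> word_sphere r k \<Longrightarrow> children r p \<subseteq> word_sphere r (Suc k)"
  by (auto simp: children_def word_sphere_def)

lemma children_eq:
  assumes "p \<in> words r"
  shows "children r p = (\<lambda>a. a # p) ` {a \<in> letters r. p = [] \<or> a \<noteq> inv_letter (hd p)}"
proof -
  have 1: "a # p \<in> words r \<longleftrightarrow> a \<in> letters r \<and> (p = [] \<or> a \<noteq> inv_letter (hd p))" for a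
    unfolding Cons_in_words inv_letter_swap[of "hd p"] using assms by simp
  have 2: "w \<in> children r p \<longleftrightarrow> (\<exists>a. w = a # p \<and> a # p \<in> words r)" for w
    by (cases w) (auto simp: children_def)
  show ?thesis unfolding set_eq_iff 2 1 by blast
qed

lemma card_children:
  assumes "p \<in> words r" "p \<noteq> []"
  shows "card (children r p) = 2 * r - 1"
proof -
  have "{a \<in> letters r. p = [] \<or> a \<noteq> inv_letter (hd p)} = letters r - {inv_letter (hd p)}"
    using assms by auto
  then show ?thesis
    using hd_in_letters[OF assms]
    by (simp add: children_eq[OF assms(1)] card_image inj_on_def card_letters del: singleton_conv)
qed

lemma children_Nil: "children r [] = word_sphere r 1"
proof -
  have "w \<noteq> [] \<and> tl w = [] \<longleftrightarrow> length w = 1" for w :: word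
    by (cases w) simp_all
  then show ?thesis unfolding children_def word_sphere_def by blast
qed

lemma sphere_1: "word_sphere r 1 = (\<lambda>a. [a]) ` letters r"
  using children_eq[OF Nil_in_words] by (simp only: children_Nil) simp

lemma adj_iff: "adj r g g' \<longleftrightarrow> g \<in> words r \<and> (\<exists>a\<in>letters r. g' = letter_mult a g)"
proof
  assume "adj r g g'"
  then obtain i where i: "g \<in> words r" "g' \<in> words r" "i \<in> {1..r}"
    and "g' = letter_mult (i, True) g \<or> g = letter_mult (i, True) g'"
    by (auto simp: adj_def mult_free_group gen_def)
  moreover have "letter_mult (i, False) (letter_mult (i, True) g') = g'"
    using letter_mult_inv[OF i(2), of "(i, True)"] by (simp add: inv_letter_def)
  ultimately have "g' = letter_mult (i, True) g \<or> g' = letter_mult (i, False) g"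
    by (elim disjE) simp_all
  moreover have "(i, b) \<in> letters r" for b using i(3) by (simp add: letters_def)
  ultimately show "g \<in> words r \<and> (\<exists>a\<in>letters r. g' = letter_mult a g)"
    using i(1) by blast
next
  assume "g \<in> words r \<and> (\<exists>a\<in>letters r. g' = letter_mult a g)"
  then obtain a where a: "g \<in> words r" "a \<in> letters r" "g' = letter_mult a g" by blast
  obtain i b where ib: "a = (i, b)" by (cases a)
  have "g = letter_mult (i, True) g'" if "\<not> b"
    using letter_mult_inv'[OF a(1), of "(i, True)"] that a(3) ib by (simp add: inv_letter_def)
  then have "g' = letter_mult (i, True) g \<or> g = letter_mult (i, True) g'"
    using a(3) ib by (cases b) simp_all
  moreover have "g' \<in> words r" "i \<in> {1..r}"
    using letter_mult_in[OF a(2,1)] a ib by (simp_all add: letters_def)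
  ultimately show "adj r g g'"
    unfolding adj_def using a(1) by (auto simp: mult_free_group gen_def)
qed

lemma adj_Nil: "{\<gamma>. adj r \<gamma> []} = (\<lambda>a. [a]) ` letters r"
proof -
  have "adj r \<gamma> [] \<longleftrightarrow> \<gamma> \<in> (\<lambda>a. [a]) ` letters r" for \<gamma>
  proof
    assume "adj r \<gamma> []"
    then obtain a where a: "\<gamma> \<in> words r" "a \<in> letters r" "[] = letter_mult a \<gamma>" by (auto simp: adj_iff)
    then have "\<gamma> = [inv_letter a]"
      using letter_mult_inv[OF a(1), of a] by simp
    then show "\<gamma> \<in> (\<lambda>a. [a]) ` letters r" using a by auto
  next
    assume "\<gamma> \<in> (\<lambda>a. [a]) ` letters r"
    then obtain a where "\<gamma> = [a]" "a \<in> letters r" by auto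
    then show "adj r \<gamma> []"
      by (auto simp: adj_iff intro!: bexI[of _ "inv_letter a"])
  qed
  then show ?thesis by blast
qed

text \<open>A step of the walk lengthens a word by at most one letter, and building a word up from
  its last letter attains this bound.\<close>

lemma tree_ball_eq: "tree_ball r k = word_ball r k"
proof -
  have 1: "length g \<le> j" if "(adj r ^^ j) [] g" for j g
    using that
  proof (induction j arbitrary: g)
    case (Suc j)
    then obtain g' where g': "(adj r ^^ j) [] g'" "adj r g' g" by auto
    then obtain a where "g = letter_mult a g'" unfolding adj_iff by blast
    then show ?case using Suc.IH[OF g'(1)] length_letter_mult[of a g'] by simp
  qed auto
  have 2: "(adj r ^^ length g) [] g" if "g \<in> words r" for g
    using that
  proof (induction g)
    case (Cons a g)
    then have "g \<in> words r" "a \<in> letters r" by (auto simp: Cons_in_words)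
    then have "adj r g (a # g)"
      unfolding adj_iff using letter_mult_Cons[OF Cons.prems] by metis
    then show ?case using Cons.IH[OF \<open>g \<in> words r\<close>] by auto
  qed auto
  show ?thesis
    unfolding tree_ball_def word_ball_def one_free_group
    using 1 2 le_trans by blast
qed

text \<open>Each edge is indexed by its endpoint farther from \<open>[]\<close>, which turns sums
  over edges into sums over non-empty words.\<close>

lemma tree_edges_eq: "tree_edges r = (\<lambda>w. {w, tl w}) ` (words r - {[]})"
proof (intro equalityI subsetI)
  fix e assume "e \<in> tree_edges r"
  then obtain g a where e: "e = {g, letter_mult a g}" "g \<in> words r" "a \<in> letters r"
    unfolding tree_edges_def adj_iff by blast
  from e(2,3) show "e \<in> (\<lambda>w. {w, tl w}) ` (words r - {[]})"
  proof (cases rule: letter_mult_cases)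
    case 1
    then show ?thesis using e by (auto intro!: image_eqI[of _ _ "a # g"])
  next
    case 2
    then show ?thesis using e by (auto intro!: image_eqI[of _ _ g])
  qed
next
  fix e assume "e \<in> (\<lambda>w. {w, tl w}) ` (words r - {[]})"
  then obtain w where w: "w \<in> words r" "w \<noteq> []" "e = {tl w, w}" by auto
  have "w = letter_mult (hd w) (tl w)"
    using letter_mult_Cons[of "hd w" "tl w" r] w(1,2) by simp
  then have "adj r (tl w) w"
    unfolding adj_iff using tl_in_words[OF w(1)] hd_in_letters[OF w(1,2)] by blast
  then show "e \<in> tree_edges r" unfolding tree_edges_def w(3) by blast
qed

lemma edge_inj: "inj_on (\<lambda>w. {w, tl w}) (words r - {[]})"
proof (rule inj_onI)
  fix u w :: word
  assume uw: "u \<in> words r - {[]}" "w \<in> words r - {[]}" "{u, tl u} = {w, tl w}"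
  show "u = w"
  proof (rule ccontr)
    assume "u \<noteq> w"
    then have *: "u = tl w \<and> tl u = w" using uw(3) unfolding doubleton_eq_iff by blast
    have "length u = length w - 1" by (subst conjunct1[OF *]) (rule length_tl)
    moreover have "length w = length u - 1" by (subst conjunct2[OF *, symmetric]) (rule length_tl)
    moreover have "length u > 0" using uw(1) by simp
    ultimately show False by linarith
  qed
qed

text \<open>Every edge of the ball arises from its upper and from its lower endpoint.\<close>

lemma sum_oriented_edges:
  fixes X :: "word \<Rightarrow> real"
  shows "(\<Sum>(p, a) | p \<in> word_ball r k \<and> a \<in> letters r \<and> letter_mult a p \<in> word_ball r k.
      X p * X (letter_mult a p)) = 2 * (\<Sum>w\<in>word_ball r k - {[]}. X w * X (tl w))"
proof -
  let ?B = "word_ball r k - {[]}"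
  define D where "D = {(p, a). p \<in> word_ball r k \<and> a \<in> letters r \<and> letter_mult a p \<in> word_ball r k}"
  \<comment> \<open>\<open>D1\<close> lists the pairs in which the letter lengthens the word,
    \<open>D2\<close> those in which it cancels the head; reducedness keeps the two apart.\<close>
  define D1 where "D1 = (\<lambda>w. (tl w, hd w)) ` ?B"
  define D2 where "D2 = (\<lambda>w. (w, inv_letter (hd w))) ` ?B"
  have lm1: "letter_mult (hd w) (tl w) = w" if "w \<in> ?B" for w
    using that letter_mult_Cons[of "hd w" "tl w" r] by (simp add: word_ball_def)
  have lm2: "letter_mult (inv_letter (hd w)) w = tl w" if "w \<in> ?B" for w
    using that by (cases w) auto
  have "D = D1 \<union> D2"
  proof (intro equalityI subsetI)
    fix x assume "x \<in> D"
    then obtain p a where x: "x = (p, a)" "p \<in> word_ball r k" "a \<in> letters r" "letter_mult a p \<in> word_ball r k"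
      by (auto simp: D_def)
    then have "p \<in> words r" by (simp add: word_ball_def)
    then show "x \<in> D1 \<union> D2" using x(3)
    proof (cases rule: letter_mult_cases)
      case 1
      then have "x \<in> D1" unfolding D1_def using x by (intro image_eqI[of _ _ "a # p"]) auto
      then show ?thesis ..
    next
      case 2
      then have "x \<in> D2" unfolding D2_def using x by (intro image_eqI[of _ _ p]) auto
      then show ?thesis ..
    qed
  next
    fix x assume "x \<in> D1 \<union> D2"
    then obtain w where w: "w \<in> ?B" "x = (tl w, hd w) \<or> x = (w, inv_letter (hd w))"
      unfolding D1_def D2_def by blast
    moreover have "hd w \<in> letters r" "tl w \<in> word_ball r k"
      using w(1) hd_in_letters tl_in_ball by (auto dest: word_ball_in)
    ultimately show "x \<in> D"
      unfolding D_def using lm1[OF w(1)] lm2[OF w(1)] by (elim disjE) simp_all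
  qed
  moreover have "D1 \<inter> D2 = {}"
  proof -
    have False if "w \<in> ?B" "w' \<in> ?B" "tl w = w'" "hd w = inv_letter (hd w')" for w w'
    proof -
      have "hd w # w' \<in> words r" unfolding that(3)[symmetric] using that(1) by (simp add: word_ball_def)
      then have "w' = [] \<or> hd w' \<noteq> inv_letter (hd w)" unfolding Cons_in_words by blast
      then show False using that(2,4) by simp
    qed
    then show ?thesis unfolding D1_def D2_def by blast
  qed
  moreover have "finite D1" "finite D2" by (auto simp: D1_def D2_def)
  ultimately have split: "(\<Sum>(p, a)\<in>D. X p * X (letter_mult a p)) =
      (\<Sum>(p, a)\<in>D1. X p * X (letter_mult a p)) + (\<Sum>(p, a)\<in>D2. X p * X (letter_mult a p))"
    by (simp add: sum.union_disjoint)
  have s1: "(\<Sum>(p, a)\<in>D1. X p * X (letter_mult a p)) = (\<Sum>w\<in>?B. X w * X (tl w))"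
  proof -
    have "inj_on (\<lambda>w. (tl w, hd w)) ?B"
      by (rule inj_onI) (simp add: list.expand)
    then show ?thesis
      by (simp add: D1_def sum.reindex lm1 mult.commute)
  qed
  have s2: "(\<Sum>(p, a)\<in>D2. X p * X (letter_mult a p)) = (\<Sum>w\<in>?B. X w * X (tl w))"
    by (simp add: D2_def sum.reindex inj_on_def lm2)
  show ?thesis using split unfolding s1 s2 unfolding D_def by simp
qed

lemma sum_ball_Suc:
  "(\<Sum>w\<in>word_ball r (Suc k) - {[]}. f w) =
    (\<Sum>w\<in>word_ball r k - {[]}. f w) + (\<Sum>w\<in>word_sphere r (Suc k). f w :: real)"
proof -
  have "word_ball r (Suc k) - {[]} = (word_ball r k - {[]}) \<union> word_sphere r (Suc k)"
    "(word_ball r k - {[]}) \<inter> word_sphere r (Suc k) = {}"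
    using ball_sphere_disjoint[of r k] by (auto simp: word_ball_Suc word_sphere_def)
  then show ?thesis by (simp add: sum.union_disjoint)
qed

lemma sum_sphere_Suc:
  "(\<Sum>w\<in>word_sphere r (Suc k). f w) = (\<Sum>p\<in>word_sphere r k. \<Sum>w\<in>children r p. f w :: real)"
proof -
  have "(\<Sum>w\<in>word_sphere r (Suc k). f w) =
      (\<Sum>p\<in>word_sphere r k. \<Sum>w\<in>{w \<in> word_sphere r (Suc k). tl w = p}. f w)"
    by (rule sum.group[symmetric]) (auto intro: tl_in_sphere)
  also have "\<dots> = (\<Sum>p\<in>word_sphere r k. \<Sum>w\<in>children r p. f w)"
  proof (intro sum.cong refl)
    fix p assume p: "p \<in> word_sphere r k"
    show "{w \<in> word_sphere r (Suc k). tl w = p} = children r p"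
      using children_sphere[OF p] by (auto simp: children_def word_sphere_def)
  qed
  finally show ?thesis .
qed

section \<open>Homomorphisms to permutations, evaluated along words\<close>

lemma perm_hom_permutes: "\<tau> \<in> perm_homs r n \<Longrightarrow> w \<in> words r \<Longrightarrow> \<tau> w permutes {1..n}"
  by (auto simp: perm_homs_def hom_def sym_group_carrier)

lemma perm_hom_in: "\<tau> \<in> perm_homs r n \<Longrightarrow> w \<in> words r \<Longrightarrow> v \<in> {1..n} \<Longrightarrow> \<tau> w v \<in> {1..n}"
  using permutes_in_image[OF perm_hom_permutes] by blast

lemma perm_hom_mult:
  "\<tau> \<in> perm_homs r n \<Longrightarrow> u \<in> words r \<Longrightarrow> w \<in> words r \<Longrightarrow> \<tau> (foldr letter_mult u w) = \<tau> u \<circ> \<tau> w"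
  by (simp add: perm_homs_def hom_def sym_group_mult mult_free_group)

lemma perm_hom_Nil:
  assumes "\<tau> \<in> perm_homs r n"
  shows "\<tau> [] = id"
proof -
  have "\<tau> [] = \<tau> [] \<circ> \<tau> []" using perm_hom_mult[OF assms, of "[]" "[]"] by simp
  moreover have "bij (\<tau> [])" using perm_hom_permutes[OF assms Nil_in_words] by (rule permutes_bij)
  ultimately have "\<tau> [] x = x" for x
    using fun_cong[of "\<tau> []" "\<tau> [] \<circ> \<tau> []" x] by (metis bij_is_inj comp_def inj_eq)
  then show ?thesis by (simp add: fun_eq_iff)
qed

lemma perm_hom_letter:
  "\<tau> \<in> perm_homs r n \<Longrightarrow> a \<in> letters r \<Longrightarrow> w \<in> words r \<Longrightarrow>
    \<tau> (letter_mult a w) = \<tau> [a] \<circ> \<tau> w"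
  using perm_hom_mult[of \<tau> r n "[a]" w] by simp

lemma perm_hom_Cons:
  "\<tau> \<in> perm_homs r n \<Longrightarrow> a # w \<in> words r \<Longrightarrow> \<tau> (a # w) = \<tau> [a] \<circ> \<tau> w"
  using perm_hom_letter[of \<tau> r n a w] letter_mult_Cons[of a w r] by (auto simp: Cons_in_words)

lemma perm_hom_inv_letter:
  assumes "\<tau> \<in> perm_homs r n" "a \<in> letters r"
  shows "\<tau> [inv_letter a] (\<tau> [a] v) = v"
proof -
  have "\<tau> [inv_letter a] \<circ> \<tau> [a] = id"
    using perm_hom_letter[OF assms(1), of "inv_letter a" "[a]"] perm_hom_Nil[OF assms(1)] assms(2) by simp
  then show ?thesis by (simp add: fun_eq_iff)
qed

section \<open>The tree recursion\<close>

text \<open>A spin with field \<open>h\<close> that is coupled to \<open>s\<close> with strength \<open>\<beta>\<close> and summed out leaves the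
  field \<open>field_map \<beta> h\<close> on \<open>s\<close>; in the usual notation this is \<open>artanh (tanh \<beta> * tanh h)\<close>.\<close>

definition field_map :: "real \<Rightarrow> real \<Rightarrow> real" where
  "field_map \<beta> h = (ln (cosh (\<beta> + h)) - ln (cosh (\<beta> - h))) / 2"

text \<open>One step of the recursion at a vertex other than the root whose \<open>2 * r - 1\<close>
  children all carry the same field. For \<open>r = 0\<close> the subtraction of naturals makes this
  the zero map.\<close>

definition tree_map :: "nat \<Rightarrow> real \<Rightarrow> real \<Rightarrow> real" where
  "tree_map r \<beta> h = real (2 * r - 1) * field_map \<beta> h"

lemma field_map_minus [simp]: "field_map \<beta> (- h) = - field_map \<beta> h"
  unfolding field_map_def minus_divide_left by simp

lemma field_map_0 [simp]: "field_map \<beta> 0 = 0"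
  by (simp add: field_map_def)

text \<open>Every positive function of a spin has the form \<open>c * exp (f * s)\<close>, where
  \<open>ln c\<close> is the mean and \<open>f\<close> half the difference of the logarithms of its
  two values. The left side is the sum over the spin with field \<open>h\<close>.\<close>

lemma cosh_field_map:
  assumes "s = 1 \<or> s = -1"
  shows "2 * cosh (\<beta> * s + h) =
    2 * exp ((ln (cosh (\<beta> + h)) + ln (cosh (\<beta> - h))) / 2) * exp (field_map \<beta> h * s)"
proof -
  have "cosh (h - \<beta>) = cosh (\<beta> - h)" using cosh_minus[of "\<beta> - h"] by simp
  moreover have "(ln (cosh (\<beta> + h)) + ln (cosh (\<beta> - h))) / 2 + field_map \<beta> h = ln (cosh (\<beta> + h))"
    "(ln (cosh (\<beta> + h)) + ln (cosh (\<beta> - h))) / 2 - field_map \<beta> h = ln (cosh (\<beta> - h))"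
    by (simp_all add: field_map_def field_simps)
  ultimately show ?thesis
    using assms by (auto simp: mult.assoc exp_add[symmetric])
qed

lemma two_cosh_mult: "2 * (cosh a * cosh b) = cosh (a + b) + cosh (a - b :: real)"
  by (simp add: cosh_add cosh_diff)

lemma cosh_less_abs: "\<bar>a\<bar> < \<bar>b\<bar> \<Longrightarrow> cosh a < cosh (b :: real)"
  using cosh_real_strict_mono[of "\<bar>a\<bar>" "\<bar>b\<bar>"] by simp

text \<open>Once the logarithms are cleared, \<open>two_cosh_mult\<close> leaves a comparison of
  \<open>cosh\<close> at \<open>2 * \<beta> - d\<close> and at \<open>2 * \<beta> + d\<close>, with
  \<open>d = h' - h\<close>.\<close>

lemma field_map_less_iff:
  assumes "\<beta> > 0"
  shows "field_map \<beta> h < field_map \<beta> h' \<longleftrightarrow> h < h'"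
proof -
  have *: "field_map \<beta> h < field_map \<beta> h'" if "h < h'" for h h'
  proof -
    have "cosh (2 * \<beta> - (h' - h)) < cosh (2 * \<beta> + (h' - h))"
      by (rule cosh_less_abs) (use assms that in linarith)
    then have "cosh (\<beta> + h) * cosh (\<beta> - h') < cosh (\<beta> + h') * cosh (\<beta> - h)"
      using two_cosh_mult[of "\<beta> + h" "\<beta> - h'"] two_cosh_mult[of "\<beta> + h'" "\<beta> - h"]
      by (simp add: algebra_simps)
    then have "ln (cosh (\<beta> + h) * cosh (\<beta> - h')) < ln (cosh (\<beta> + h') * cosh (\<beta> - h))"
      by (simp add: ln_less_cancel_iff)
    then show ?thesis
      by (simp add: field_map_def ln_mult)
  qed
  show ?thesis
    using *[of h h'] *[of h' h] by (cases h h' rule: linorder_cases) auto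
qed

lemma field_map_le_iff: "\<beta> > 0 \<Longrightarrow> field_map \<beta> h \<le> field_map \<beta> h' \<longleftrightarrow> h \<le> h'"
  using field_map_less_iff[of \<beta> h' h] by (simp add: not_less[symmetric])

lemma field_map_eq_iff: "\<beta> > 0 \<Longrightarrow> field_map \<beta> h = field_map \<beta> h' \<longleftrightarrow> h = h'"
  using field_map_le_iff[of \<beta> h h'] field_map_le_iff[of \<beta> h' h] by (simp add: order_eq_iff)

lemma field_map_abs: "\<beta> > 0 \<Longrightarrow> \<bar>h\<bar> \<le> c \<Longrightarrow> \<bar>field_map \<beta> h\<bar> \<le> field_map \<beta> c"
  using field_map_le_iff[of \<beta> h c] field_map_le_iff[of \<beta> "- h" c] by (simp add: abs_le_iff)

text \<open>A neighbour exerts at most the field of a frozen spin. This is what makes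
  \<open>field_bound\<close> decrease in its first step.\<close>

lemma field_map_le:
  assumes "\<beta> > 0"
  shows "field_map \<beta> h \<le> \<beta>"
proof -
  have e: "exp (2 * \<beta>) * exp (h - \<beta>) = exp (\<beta> + h)" "exp (2 * \<beta>) * exp (\<beta> - h) = exp (3 * \<beta> - h)"
    by (simp_all add: exp_add[symmetric])
  have "exp (- (\<beta> + h)) \<le> exp (3 * \<beta> - h)" using assms by simp
  then have "cosh (\<beta> + h) \<le> exp (2 * \<beta>) * cosh (\<beta> - h)"
    using e by (simp add: cosh_def field_simps)
  then have "ln (cosh (\<beta> + h)) \<le> ln (exp (2 * \<beta>) * cosh (\<beta> - h))"
    by (subst ln_le_cancel_iff) auto
  then show ?thesis by (simp add: field_map_def ln_mult)
qed

text \<open>The denominator is brought into the form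
  \<open>cosh (2 * \<beta>) + cosh (2 * h)\<close> so that the derivative visibly decreases for
  \<open>h > 0\<close>.\<close>

lemma field_map_has_derivative:
  "(field_map \<beta> has_real_derivative sinh (2 * \<beta>) / (cosh (2 * \<beta>) + cosh (2 * h))) (at h)"
proof -
  have pos: "0 < cosh (\<beta> + h)" "0 < cosh (\<beta> - h)" by simp_all
  have 1: "2 * (cosh (\<beta> + h) * cosh (\<beta> - h)) = cosh (2 * \<beta>) + cosh (2 * h)"
    using two_cosh_mult[of "\<beta> + h" "\<beta> - h"] by (simp add: algebra_simps)
  have 2: "sinh (\<beta> + h) * cosh (\<beta> - h) + cosh (\<beta> + h) * sinh (\<beta> - h) = sinh (2 * \<beta>)"
    using sinh_add[of "\<beta> + h" "\<beta> - h"] by simp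
  have "((\<lambda>h. ln (cosh (\<beta> + h))) has_real_derivative sinh (\<beta> + h) / cosh (\<beta> + h)) (at h)"
    by (rule derivative_eq_intros refl | simp)+
  moreover have "((\<lambda>h. ln (cosh (\<beta> - h))) has_real_derivative - (sinh (\<beta> - h) / cosh (\<beta> - h))) (at h)"
    by (rule derivative_eq_intros refl | simp)+
  ultimately have "((\<lambda>h. (ln (cosh (\<beta> + h)) - ln (cosh (\<beta> - h))) / 2) has_real_derivative
      (sinh (\<beta> + h) / cosh (\<beta> + h) - - (sinh (\<beta> - h) / cosh (\<beta> - h))) / 2) (at h)"
    by (intro DERIV_cdivide DERIV_diff)
  moreover have "(a / p + b / q) / 2 = (a * q + p * b) / (2 * (p * q))"
    if "p > 0" "q > 0" for a b p q :: real
    using that by (simp add: field_simps)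
  from this[OF pos, of "sinh (\<beta> + h)" "sinh (\<beta> - h)"] have "(sinh (\<beta> + h) / cosh (\<beta> + h) + sinh (\<beta> - h) / cosh (\<beta> - h)) / 2
      = sinh (2 * \<beta>) / (cosh (2 * \<beta>) + cosh (2 * h))"
    unfolding 1 2 .
  ultimately show ?thesis unfolding field_map_def[abs_def] by (simp only: diff_minus_eq_add)
qed

text \<open>The slope of the chord from the origin decreases: the mean values of the derivative on
  \<open>(0, a)\<close> and on \<open>(a, b)\<close> are taken at points
  \<open>x < y\<close>.\<close>

lemma field_map_strictly_concave:
  assumes "\<beta> > 0" "0 < a" "a < b"
  shows "a * field_map \<beta> b < b * field_map \<beta> a"
proof -
  let ?D = "\<lambda>h. sinh (2 * \<beta>) / (cosh (2 * \<beta>) + cosh (2 * h))"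
  obtain x where x: "0 < x" "x < a" "field_map \<beta> a - field_map \<beta> 0 = (a - 0) * ?D x"
    using MVT2[OF assms(2) field_map_has_derivative] by blast
  obtain y where y: "a < y" "y < b" "field_map \<beta> b - field_map \<beta> a = (b - a) * ?D y"
    using MVT2[OF assms(3) field_map_has_derivative] by blast
  have "cosh (2 * x) < cosh (2 * y)" by (rule cosh_less_abs) (use x y in linarith)
  moreover have "0 < cosh (2 * \<beta>)" "0 < cosh (2 * x)" by simp_all
  ultimately have "?D y < ?D x"
    using assms(1) by (intro divide_strict_left_mono mult_pos_pos add_pos_pos) auto
  then have "(b - a) * a * ?D y < (b - a) * a * ?D x"
    using assms by (intro mult_strict_left_mono mult_pos_pos) auto
  moreover have "field_map \<beta> a = a * ?D x" using x(3) by simp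
  moreover have "field_map \<beta> b = a * ?D x + (b - a) * ?D y" using x(3) y(3) by simp
  moreover have "a * (a * X + (b - a) * Y) < b * (a * X)" if "(b - a) * a * Y < (b - a) * a * X" for X Y
    using that by (simp add: algebra_simps)
  ultimately show ?thesis by metis
qed

lemma continuous_field_map [continuous_intros]:
  "continuous_on S f \<Longrightarrow> continuous_on S g \<Longrightarrow> continuous_on S (\<lambda>x. field_map (f x) (g x))"
  unfolding field_map_def by (intro continuous_intros) auto

lemma tree_map_mono: "\<beta> > 0 \<Longrightarrow> h \<le> h' \<Longrightarrow> tree_map r \<beta> h \<le> tree_map r \<beta> h'"
  by (auto simp: tree_map_def field_map_le_iff intro!: mult_left_mono)

section \<open>The Ising model on a ball of the tree with fields on the sphere\<close>

definition ball_weight :: "nat \<Rightarrow> real \<Rightarrow> nat \<Rightarrow> (word \<Rightarrow> real) \<Rightarrow> (word \<Rightarrow> real) \<Rightarrow> real" where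
  "ball_weight r \<beta> k h z = exp (\<beta> * (\<Sum>w\<in>word_ball r k - {[]}. z w * z (tl w)) +
     (\<Sum>w\<in>word_sphere r k. h w * z w))"

definition ball_exp :: "nat \<Rightarrow> real \<Rightarrow> nat \<Rightarrow> (word \<Rightarrow> real) \<Rightarrow> ((word \<Rightarrow> real) \<Rightarrow> real) \<Rightarrow> real" where
  "ball_exp r \<beta> k h F = ssum (word_ball r k) (\<lambda>z. F z * ball_weight r \<beta> k h z) /
     ssum (word_ball r k) (ball_weight r \<beta> k h)"

text \<open>Observables take assignments on the whole type; locality lets one and the same
  \<open>F\<close> be evaluated on balls of every radius and on the view from a vertex of a finite
  graph.\<close>

definition local_on :: "'a set \<Rightarrow> (('a \<Rightarrow> real) \<Rightarrow> 'b) \<Rightarrow> bool" where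
  "local_on B F \<longleftrightarrow> (\<forall>z z'. (\<forall>w\<in>B. z w = z' w) \<longrightarrow> F z = F z')"

definition push_fields :: "nat \<Rightarrow> real \<Rightarrow> (word \<Rightarrow> real) \<Rightarrow> word \<Rightarrow> real" where
  "push_fields r \<beta> h p = (\<Sum>w\<in>children r p. field_map \<beta> (h w))"

lemma local_onD: "local_on B F \<Longrightarrow> (\<And>w. w \<in> B \<Longrightarrow> z w = z' w) \<Longrightarrow> F z = F z'"
  by (auto simp: local_on_def)

lemma ball_weight_pos [simp]: "0 < ball_weight r \<beta> k h z"
  by (simp add: ball_weight_def)

lemma ball_Z_pos [simp]: "0 < ssum (word_ball r k) (ball_weight r \<beta> k h)"
  by (intro ssum_pos) auto

lemma ball_Z_neq_0 [simp]: "ssum (word_ball r k) (ball_weight r \<beta> k h) \<noteq> 0"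
  using ball_Z_pos[of r k \<beta> h] by linarith

lemma ball_exp_const [simp]: "ball_exp r \<beta> k h (\<lambda>_. c) = c"
  by (simp add: ball_exp_def ssum_mult_left)

lemma ball_exp_add: "ball_exp r \<beta> k h (\<lambda>z. F z + G z) = ball_exp r \<beta> k h F + ball_exp r \<beta> k h G"
  by (simp add: ball_exp_def ssum_add distrib_right add_divide_distrib)

lemma ball_exp_cmult: "ball_exp r \<beta> k h (\<lambda>z. c * F z) = c * ball_exp r \<beta> k h F"
  by (simp add: ball_exp_def ssum_mult_left mult.assoc)

lemma ball_exp_sum: "ball_exp r \<beta> k h (\<lambda>z. \<Sum>i\<in>I. F i z) = (\<Sum>i\<in>I. ball_exp r \<beta> k h (F i))"
  by (simp add: ball_exp_def ssum_sum sum_distrib_right sum_divide_distrib)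

lemma ball_exp_cong:
  assumes "\<And>w. w \<in> word_sphere r k \<Longrightarrow> h w = h' w"
    and "\<And>z. z \<in> word_ball r k \<rightarrow>\<^sub>E spins \<Longrightarrow> F z = F' z"
  shows "ball_exp r \<beta> k h F = ball_exp r \<beta> k h' F'"
proof -
  have "ball_weight r \<beta> k h = ball_weight r \<beta> k h'"
    using assms(1) by (simp add: ball_weight_def fun_eq_iff)
  then show ?thesis
    unfolding ball_exp_def using assms(2) by (simp cong: ssum_cong)
qed

lemma ball_exp_mono:
  "(\<And>z. z \<in> word_ball r k \<rightarrow>\<^sub>E spins \<Longrightarrow> F z \<le> G z) \<Longrightarrow> ball_exp r \<beta> k h F \<le> ball_exp r \<beta> k h G"
  unfolding ball_exp_def by (intro divide_right_mono ssum_mono mult_right_mono) (auto intro: less_imp_le)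

lemma ball_exp_abs_le:
  assumes "\<And>z. z \<in> word_ball r k \<rightarrow>\<^sub>E spins \<Longrightarrow> \<bar>F z\<bar> \<le> c"
  shows "\<bar>ball_exp r \<beta> k h F\<bar> \<le> c"
proof -
  have "ball_exp r \<beta> k h F \<le> ball_exp r \<beta> k h (\<lambda>_. c)"
    by (rule ball_exp_mono) (use assms in \<open>auto simp: abs_le_iff\<close>)
  moreover have "ball_exp r \<beta> k h (\<lambda>_. - c) \<le> ball_exp r \<beta> k h F"
    by (rule ball_exp_mono) (use assms in \<open>force simp: abs_le_iff\<close>)
  ultimately show ?thesis by simp
qed

lemma ball_exp_flip:
  "ball_exp r \<beta> k (\<lambda>w. - h w) F = ball_exp r \<beta> k h (\<lambda>z. F (\<lambda>w\<in>word_ball r k. - z w))"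
proof -
  have "ball_weight r \<beta> k (\<lambda>w. - h w) (\<lambda>w\<in>word_ball r k. - z w) = ball_weight r \<beta> k h z" for z
  proof -
    have "(\<Sum>w\<in>word_ball r k - {[]}. (\<lambda>w\<in>word_ball r k. - z w) w * (\<lambda>w\<in>word_ball r k. - z w) (tl w))
        = (\<Sum>w\<in>word_ball r k - {[]}. z w * z (tl w))"
      by (intro sum.cong) (auto simp: tl_in_ball)
    moreover have "(\<Sum>w\<in>word_sphere r k. - h w * (\<lambda>w\<in>word_ball r k. - z w) w) = (\<Sum>w\<in>word_sphere r k. h w * z w)"
      using sphere_subset_ball by (intro sum.cong) auto
    ultimately show ?thesis by (simp add: ball_weight_def)
  qed
  then have "ssum (word_ball r k) (\<lambda>z. G z * ball_weight r \<beta> k (\<lambda>w. - h w) z) =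
      ssum (word_ball r k) (\<lambda>z. G (\<lambda>w\<in>word_ball r k. - z w) * ball_weight r \<beta> k h z)" for G
    using ssum_flip[of "word_ball r k" "\<lambda>z. G z * ball_weight r \<beta> k (\<lambda>w. - h w) z"] by simp
  from this[of F] this[of "\<lambda>_. 1"] show ?thesis
    unfolding ball_exp_def by simp
qed

lemma ssum_exp_linear:
  assumes "finite B"
  shows "ssum B (\<lambda>z. exp (\<Sum>w\<in>B. t w * z w)) = (\<Prod>w\<in>B. 2 * cosh (t w))"
proof -
  have "ssum B (\<lambda>z. exp (\<Sum>w\<in>B. t w * z w)) = ssum B (\<lambda>z. \<Prod>w\<in>B. (\<lambda>w s. exp (t w * s)) w (z w))"
    by (simp add: exp_sum assms)
  also have "\<dots> = (\<Prod>w\<in>B. 2 * cosh (t w))"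
    by (subst ssum_prod[OF assms]) (intro prod.cong refl, simp add: cosh_field_def)
  finally show ?thesis .
qed

lemma prod_cosh_field_map:
  assumes "\<And>w. w \<in> B \<Longrightarrow> s w = 1 \<or> s w = -1"
  shows "(\<Prod>w\<in>B. 2 * cosh (\<beta> * s w + h w)) =
    (\<Prod>w\<in>B. 2 * exp ((ln (cosh (\<beta> + h w)) + ln (cosh (\<beta> - h w))) / 2)) *
      exp (\<Sum>w\<in>B. field_map \<beta> (h w) * s w)"
proof (cases "finite B")
  case True
  then show ?thesis
    by (simp add: exp_sum prod.distrib[symmetric] cosh_field_map[OF assms] cong: prod.cong)
qed simp

text \<open>Given the inner spins, those of the outer sphere are independent, and
  \<open>cosh_field_map\<close> turns each of them into a field on its parent. The constant does not
  depend on \<open>F\<close>, so it cancels in \<open>ball_exp\<close>.\<close>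

lemma ball_sum_decimate:
  "\<exists>c>0. \<forall>F. local_on (word_ball r k) F \<longrightarrow>
    ssum (word_ball r (Suc k)) (\<lambda>z. F z * ball_weight r \<beta> (Suc k) h z) =
      c * ssum (word_ball r k) (\<lambda>z. F z * ball_weight r \<beta> k (push_fields r \<beta> h) z)"
proof -
  let ?S = "word_sphere r (Suc k)" and ?B = "word_ball r k"
  define c where "c = (\<Prod>w\<in>?S. 2 * exp ((ln (cosh (\<beta> + h w)) + ln (cosh (\<beta> - h w))) / 2))"
  have "c > 0" by (auto simp: c_def intro!: prod_pos)
  moreover have "ssum (word_ball r (Suc k)) (\<lambda>z. F z * ball_weight r \<beta> (Suc k) h z) =
      c * ssum ?B (\<lambda>z. F z * ball_weight r \<beta> k (push_fields r \<beta> h) z)"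
    if F: "local_on ?B F" for F
  proof -
  have inner: "ssum ?S (\<lambda>z. F (\<lambda>i. if i \<in> ?B then y i else z i) *
      ball_weight r \<beta> (Suc k) h (\<lambda>i. if i \<in> ?B then y i else z i)) =
      c * (F y * ball_weight r \<beta> k (push_fields r \<beta> h) y)"
    if y: "y \<in> ?B \<rightarrow>\<^sub>E spins" for y
  proof -
    have weight: "ball_weight r \<beta> (Suc k) h (\<lambda>i. if i \<in> ?B then y i else z i) =
        exp (\<beta> * (\<Sum>w\<in>?B - {[]}. y w * y (tl w))) * exp (\<Sum>w\<in>?S. (\<beta> * y (tl w) + h w) * z w)" for z
    proof -
      let ?x = "\<lambda>i. if i \<in> ?B then y i else z i"
      have "(\<Sum>w\<in>word_ball r (Suc k) - {[]}. ?x w * ?x (tl w)) =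
          (\<Sum>w\<in>?B - {[]}. ?x w * ?x (tl w)) + (\<Sum>w\<in>?S. ?x w * ?x (tl w))"
        by (rule sum_ball_Suc)
      also have "(\<Sum>w\<in>?B - {[]}. ?x w * ?x (tl w)) = (\<Sum>w\<in>?B - {[]}. y w * y (tl w))"
        by (intro sum.cong) (auto simp: tl_in_ball)
      also have "(\<Sum>w\<in>?S. ?x w * ?x (tl w)) = (\<Sum>w\<in>?S. z w * y (tl w))"
      proof (rule sum.cong)
        fix w assume w: "w \<in> ?S"
        then have "w \<notin> ?B" using ball_sphere_disjoint[of r k] by blast
        moreover have "tl w \<in> ?B" using tl_in_sphere[OF w] sphere_subset_ball by blast
        ultimately show "?x w * ?x (tl w) = z w * y (tl w)" by simp
      qed simp
      finally have 1: "(\<Sum>w\<in>word_ball r (Suc k) - {[]}. ?x w * ?x (tl w)) =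
        (\<Sum>w\<in>?B - {[]}. y w * y (tl w)) + (\<Sum>w\<in>?S. z w * y (tl w))" .
      have 2: "(\<Sum>w\<in>?S. h w * ?x w) = (\<Sum>w\<in>?S. h w * z w)"
        using ball_sphere_disjoint[of r k] by (intro sum.cong) auto
      show ?thesis
        unfolding ball_weight_def 1 2
        by (simp add: exp_add[symmetric] distrib_left distrib_right sum.distrib sum_distrib_left mult_ac)
    qed
    have tl: "y (tl w) = 1 \<or> y (tl w) = -1" if "w \<in> ?S" for w
      using conf_spin[OF y] tl_in_sphere[OF that] sphere_subset_ball by blast
    have fib: "(\<Sum>w\<in>?S. field_map \<beta> (h w) * y (tl w)) =
        (\<Sum>p\<in>word_sphere r k. push_fields r \<beta> h p * y p)"
    proof -
      have "(\<Sum>w\<in>?S. field_map \<beta> (h w) * y (tl w)) =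
          (\<Sum>p\<in>word_sphere r k. \<Sum>w\<in>children r p. field_map \<beta> (h w) * y p)"
        unfolding sum_sphere_Suc by (intro sum.cong refl) (simp add: children_def)
      then show ?thesis by (simp add: push_fields_def sum_distrib_right)
    qed
    have "F (\<lambda>i. if i \<in> ?B then y i else z i) = F y" for z
      by (rule local_onD[OF F]) simp
    then have "ssum ?S (\<lambda>z. F (\<lambda>i. if i \<in> ?B then y i else z i) *
        ball_weight r \<beta> (Suc k) h (\<lambda>i. if i \<in> ?B then y i else z i)) =
      F y * exp (\<beta> * (\<Sum>w\<in>?B - {[]}. y w * y (tl w))) *
        ssum ?S (\<lambda>z. exp (\<Sum>w\<in>?S. (\<beta> * y (tl w) + h w) * z w))"
      by (simp add: weight ssum_mult_left mult.assoc)
    also have "\<dots> = F y * exp (\<beta> * (\<Sum>w\<in>?B - {[]}. y w * y (tl w))) *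
        (c * exp (\<Sum>p\<in>word_sphere r k. push_fields r \<beta> h p * y p))"
      by (simp add: ssum_exp_linear prod_cosh_field_map[OF tl] c_def fib)
    also have "\<dots> = c * (F y * ball_weight r \<beta> k (push_fields r \<beta> h) y)"
      by (simp add: ball_weight_def exp_add)
    finally show ?thesis .
  qed
  show ?thesis
    unfolding word_ball_Suc ssum_Un[OF ball_sphere_disjoint] ssum_mult_left[symmetric]
    by (rule ssum_cong) (simp add: inner)
  qed
  ultimately show ?thesis by (intro exI[of _ c] conjI allI impI)
qed

lemma ball_exp_decimate:
  assumes "local_on (word_ball r k) F"
  shows "ball_exp r \<beta> (Suc k) h F = ball_exp r \<beta> k (push_fields r \<beta> h) F"
proof -
  obtain c where c: "c > 0 \<and> (\<forall>F. local_on (word_ball r k) F \<longrightarrow>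
    ssum (word_ball r (Suc k)) (\<lambda>z. F z * ball_weight r \<beta> (Suc k) h z) =
      c * ssum (word_ball r k) (\<lambda>z. F z * ball_weight r \<beta> k (push_fields r \<beta> h) z))"
    using ball_sum_decimate[of r k \<beta> h] by (elim exE)
  have "local_on (word_ball r k) (\<lambda>_. 1 :: real)" by (simp add: local_on_def)
  note 1 = conjunct2[OF c, rule_format, OF this, unfolded mult_1]
    and 2 = conjunct2[OF c, rule_format, OF assms]
  show ?thesis unfolding ball_exp_def 1 2 using conjunct1[OF c] by simp
qed

text \<open>\<open>k \<ge> 1\<close> excludes the root, which has \<open>2 * r\<close>
  children.\<close>

lemma push_fields_abs:
  assumes "\<beta> > 0" "p \<in> word_sphere r k" "k \<ge> 1" "\<And>w. w \<in> word_sphere r (Suc k) \<Longrightarrow> \<bar>h w\<bar> \<le> c"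
  shows "\<bar>push_fields r \<beta> h p\<bar> \<le> tree_map r \<beta> c"
proof -
  have p: "p \<in> words r" "p \<noteq> []" using assms(2,3) by (auto simp: word_sphere_def)
  have "\<bar>push_fields r \<beta> h p\<bar> \<le> (\<Sum>w\<in>children r p. \<bar>field_map \<beta> (h w)\<bar>)"
    unfolding push_fields_def by (rule sum_abs)
  also have "\<dots> \<le> (\<Sum>w\<in>children r p. field_map \<beta> c)"
    using children_sphere[OF assms(2)] assms(1,4) by (intro sum_mono field_map_abs) auto
  finally show ?thesis by (simp add: tree_map_def card_children[OF p])
qed

lemma push_fields_const:
  assumes "p \<in> word_sphere r k" "k \<ge> 1" "\<And>w. w \<in> word_sphere r (Suc k) \<Longrightarrow> h w = c"
  shows "push_fields r \<beta> h p = tree_map r \<beta> c"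
proof -
  have p: "p \<in> words r" "p \<noteq> []" using assms(1,2) by (auto simp: word_sphere_def)
  have "push_fields r \<beta> h p = (\<Sum>w\<in>children r p. field_map \<beta> c)"
    unfolding push_fields_def using children_sphere[OF assms(1)] assms(3) by (intro sum.cong) auto
  then show ?thesis by (simp add: tree_map_def card_children[OF p])
qed

lemma local_on_mono: "local_on A F \<Longrightarrow> A \<subseteq> B \<Longrightarrow> local_on B F"
  unfolding local_on_def by blast

text \<open>Each decimation applies \<open>tree_map\<close> to the bound on the fields. The new
  fields depend on \<open>h\<close> alone, not on the observable.\<close>

lemma ball_exp_decimate_bounded:
  assumes "\<beta> > 0" "k \<ge> 1" "\<And>w. w \<in> word_sphere r (k + m) \<Longrightarrow> \<bar>h w\<bar> \<le> c"
  shows "\<exists>h'. (\<forall>w\<in>word_sphere r k. \<bar>h' w\<bar> \<le> (tree_map r \<beta> ^^ m) c) \<and>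
    (\<forall>F. local_on (word_ball r k) F \<longrightarrow> ball_exp r \<beta> (k + m) h F = ball_exp r \<beta> k h' F)"
  using assms(3)
proof (induction m arbitrary: h c)
  case (Suc m)
  have push: "\<bar>push_fields r \<beta> h w\<bar> \<le> tree_map r \<beta> c" if "w \<in> word_sphere r (k + m)" for w
    using push_fields_abs[OF assms(1) that] assms(2) Suc.prems by simp
  have "\<exists>h'. (\<forall>w\<in>word_sphere r k. \<bar>h' w\<bar> \<le> (tree_map r \<beta> ^^ m) (tree_map r \<beta> c)) \<and>
      (\<forall>F. local_on (word_ball r k) F \<longrightarrow>
        ball_exp r \<beta> (k + m) (push_fields r \<beta> h) F = ball_exp r \<beta> k h' F)"
    by (rule Suc.IH) (rule push)
  then obtain h' where h': "\<forall>w\<in>word_sphere r k. \<bar>h' w\<bar> \<le> (tree_map r \<beta> ^^ m) (tree_map r \<beta> c)"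
    "\<forall>F. local_on (word_ball r k) F \<longrightarrow> ball_exp r \<beta> (k + m) (push_fields r \<beta> h) F = ball_exp r \<beta> k h' F"
    by (elim exE conjE)
  have "ball_exp r \<beta> (k + Suc m) h F = ball_exp r \<beta> k h' F" if F: "local_on (word_ball r k) F" for F
    using ball_exp_decimate[OF local_on_mono[OF F word_ball_mono[OF le_add1]]] h'(2) F by simp
  then show ?case using h'(1) unfolding funpow_Suc_right comp_def by (intro exI[of _ h'] conjI allI impI)
next
  case 0
  then show ?case by (intro exI[of _ h]) simp
qed

lemma ball_exp_decimate_const:
  assumes "k \<ge> 1" "local_on (word_ball r k) F"
  shows "ball_exp r \<beta> (k + m) (\<lambda>_. c) F = ball_exp r \<beta> k (\<lambda>_. (tree_map r \<beta> ^^ m) c) F"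
proof (induction m arbitrary: c)
  case (Suc m)
  have "ball_exp r \<beta> (k + Suc m) (\<lambda>_. c) F = ball_exp r \<beta> (k + m) (push_fields r \<beta> (\<lambda>_. c)) F"
    using ball_exp_decimate[OF local_on_mono[OF assms(2) word_ball_mono[OF le_add1]]] by simp
  also have "\<dots> = ball_exp r \<beta> (k + m) (\<lambda>_. tree_map r \<beta> c) F"
    using assms(1) by (intro ball_exp_cong push_fields_const[where k = "k + m"]) simp_all
  finally show ?case unfolding Suc.IH funpow_Suc_right comp_def .
qed simp

section \<open>Nearest-neighbour correlations on the star\<close>

text \<open>The mean of the product of two spins with fields \<open>x\<close> and \<open>y\<close>
  and coupling \<beta>: equal spins have total weight \<open>2 * exp \<beta> * cosh (x + y)\<close>,
  opposite ones \<open>2 * exp (- \<beta>) * cosh (x - y)\<close>.\<close>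

definition edge_corr :: "real \<Rightarrow> real \<Rightarrow> real \<Rightarrow> real" where
  "edge_corr \<beta> x y = (exp \<beta> * cosh (x + y) - exp (- \<beta>) * cosh (x - y)) /
     (exp \<beta> * cosh (x + y) + exp (- \<beta>) * cosh (x - y))"

lemma ssum_pair:
  assumes "i \<noteq> j"
  shows "ssum {i, j} (\<lambda>z. G (z i) (z j)) = G 1 1 + G 1 (-1) + G (-1) 1 + G (-1) (-1)"
proof -
  have 1: "ssum {i} F = F (\<lambda>_\<in>{i}. 1) + F (\<lambda>_\<in>{i}. -1)" for i :: 'a and F
  proof -
    have "{i} \<rightarrow>\<^sub>E spins = {\<lambda>_\<in>{i}. 1, \<lambda>_\<in>{i}. -1}"
      by (auto simp: spins_def PiE_insert_eq fun_eq_iff)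
    moreover have "(\<lambda>_\<in>{i}. 1 :: real) \<noteq> (\<lambda>_\<in>{i}. -1)"
      by (metis one_neq_neg_one restrict_apply' singletonI)
    ultimately show ?thesis by (simp add: ssum_def)
  qed
  have "ssum ({i} \<union> {j}) (\<lambda>z. G (z i) (z j)) = ssum {i} (\<lambda>y. ssum {j} (\<lambda>z. G (y i) (z j)))"
    using assms by (subst ssum_Un) auto
  then show ?thesis by (simp add: 1 insert_commute)
qed

text \<open>All leaves of the star except \<open>s\<close> are summed out; their fields reach the
  root through \<open>field_map\<close>, and a system of two spins remains.\<close>

lemma ball_exp_edge:
  assumes s: "s \<in> word_sphere r 1"
  shows "ball_exp r \<beta> 1 h (\<lambda>z. z [] * z s) = edge_corr \<beta> (h s) (\<Sum>w\<in>word_sphere r 1 - {s}. field_map \<beta> (h w))"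
proof -
  let ?S = "word_sphere r 1 - {s}" and ?B = "{[], s}"
  let ?k = "\<Sum>w\<in>?S. field_map \<beta> (h w)"
  define c where "c = (\<Prod>w\<in>?S. 2 * exp ((ln (cosh (\<beta> + h w)) + ln (cosh (\<beta> - h w))) / 2))"
  have c: "c > 0" by (auto simp: c_def intro!: prod_pos)
  have s': "s \<noteq> []" "tl s = []" "w \<in> word_sphere r 1 \<Longrightarrow> w \<noteq> [] \<and> tl w = []" for w
    using s children_Nil[of r] by (auto simp: children_def)
  have ball: "word_ball r 1 = ?B \<union> ?S" "?B \<inter> ?S = {}"
    using s s'(3) word_ball_Suc[of r 0] by auto
  have star: "word_ball r 1 - {[]} = word_sphere r 1" using word_ball_Suc[of r 0] s'(3) by auto
  have main: "ssum (word_ball r 1) (\<lambda>z. G (z []) (z s) * ball_weight r \<beta> 1 h z) =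
      ssum ?B (\<lambda>y. c * (G (y []) (y s) * exp (\<beta> * y [] * y s + h s * y s + ?k * y [])))" for G
    unfolding ball(1) ssum_Un[OF ball(2)]
  proof (rule ssum_cong)
    fix y assume y: "y \<in> ?B \<rightarrow>\<^sub>E spins"
    have y0: "y [] = 1 \<or> y [] = -1" using conf_spin[OF y] by simp
    have weight: "ball_weight r \<beta> 1 h (\<lambda>i. if i \<in> ?B then y i else z i) =
        exp (\<beta> * y [] * y s + h s * y s) * exp (\<Sum>w\<in>?S. (\<beta> * y [] + h w) * z w)" for z
    proof -
      let ?x = "\<lambda>i. if i \<in> ?B then y i else z i"
      have "ball_weight r \<beta> 1 h ?x = exp (\<Sum>w\<in>word_sphere r 1. (\<beta> * y [] + h w) * ?x w)"
        unfolding ball_weight_def star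
        using s'(3) by (simp add: sum_distrib_left sum.distrib[symmetric] algebra_simps cong: sum.cong)
      also have "(\<Sum>w\<in>word_sphere r 1. (\<beta> * y [] + h w) * ?x w) =
          (\<beta> * y [] + h s) * y s + (\<Sum>w\<in>?S. (\<beta> * y [] + h w) * ?x w)"
        using s by (simp add: sum.remove)
      also have "(\<Sum>w\<in>?S. (\<beta> * y [] + h w) * ?x w) = (\<Sum>w\<in>?S. (\<beta> * y [] + h w) * z w)"
        using ball(2) by (intro sum.cong) auto
      finally show ?thesis by (simp add: exp_add[symmetric] algebra_simps)
    qed
    have "ssum ?S (\<lambda>z. exp (\<Sum>w\<in>?S. (\<beta> * y [] + h w) * z w)) = c * exp (?k * y [])"
      using prod_cosh_field_map[of ?S "\<lambda>_. y []" \<beta> h] y0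
      by (simp add: ssum_exp_linear c_def sum_distrib_right)
    then show "ssum ?S (\<lambda>z. G (if [] \<in> ?B then y [] else z []) (if s \<in> ?B then y s else z s) *
        ball_weight r \<beta> 1 h (\<lambda>i. if i \<in> ?B then y i else z i)) =
        c * (G (y []) (y s) * exp (\<beta> * y [] * y s + h s * y s + ?k * y []))"
      unfolding weight by (simp add: ssum_mult_left mult.assoc[symmetric] exp_add)
  qed
  have num: "ssum (word_ball r 1) (\<lambda>z. z [] * z s * ball_weight r \<beta> 1 h z) =
      c * (2 * (exp \<beta> * cosh (h s + ?k) - exp (- \<beta>) * cosh (h s - ?k)))"
    using s'(1) unfolding main[of "\<lambda>a b. a * b"] ssum_mult_left
    by (subst ssum_pair[where G = "\<lambda>a b. a * b * exp (\<beta> * a * b + h s * b + ?k * a)"])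
      (auto simp: cosh_def exp_add[symmetric] algebra_simps)
  have den: "ssum (word_ball r 1) (ball_weight r \<beta> 1 h) =
      c * (2 * (exp \<beta> * cosh (h s + ?k) + exp (- \<beta>) * cosh (h s - ?k)))"
    using s'(1) main[of "\<lambda>a b. 1"] unfolding ssum_mult_left mult_1
    by (subst (asm) ssum_pair[where G = "\<lambda>a b. exp (\<beta> * a * b + h s * b + ?k * a)"])
      (auto simp: cosh_def exp_add[symmetric] algebra_simps)
  have "c * (2 * X) / (c * (2 * Y)) = X / Y" for X Y using c by simp
  then show ?thesis
    unfolding ball_exp_def edge_corr_def num den .
qed

text \<open>\<open>edge_corr\<close> increases with the ratio of \<open>cosh (x + y)\<close> to
  \<open>cosh (x - y)\<close>. Writing the comparison of two such ratios as a sum of two products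
  reveals its sign as soon as \<open>H\<close> and \<open>K\<close> dominate \<open>x\<close> and
  \<open>y\<close> in absolute value.\<close>

lemma edge_corr_identity:
  "cosh (H + K) * cosh (x - y) - cosh (x + y) * cosh (H - K) =
    sinh (H + x) * sinh (K - y) + sinh (H - x) * sinh (K + y :: real)"
proof -
  have ss: "2 * (sinh a * sinh b) = cosh (a + b) - cosh (a - b)" for a b :: real
    by (simp add: cosh_add cosh_diff)
  have e: "H + K + (x - y) = H + x + (K - y)" "H + K - (x - y) = H - x + (K + y)"
    "x + y + (H - K) = H + x - (K - y)" "x + y - (H - K) = - (H - x - (K + y))"
    by simp_all
  show ?thesis
    using two_cosh_mult[of "H + K" "x - y"] two_cosh_mult[of "x + y" "H - K"]
      ss[of "H + x" "K - y"] ss[of "H - x" "K + y"]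
    unfolding e cosh_minus by linarith
qed

lemma edge_corr_le_iff:
  "edge_corr \<beta> x y \<le> edge_corr \<beta> H K \<longleftrightarrow>
    0 \<le> sinh (H + x) * sinh (K - y) + sinh (H - x) * sinh (K + y)"
proof -
  have *: "(P - Q) / (P + Q) \<le> (P' - Q') / (P' + Q') \<longleftrightarrow> P * Q' \<le> P' * Q"
    if "P > 0" "Q > 0" "P' > 0" "Q' > 0" for P Q P' Q' :: real
  proof -
    have "(P - Q) / (P + Q) \<le> (P' - Q') / (P' + Q') \<longleftrightarrow> (P - Q) * (P' + Q') \<le> (P' - Q') * (P + Q)"
      using that by (simp add: pos_divide_le_eq pos_le_divide_eq add_pos_pos)
    then show ?thesis by (simp add: algebra_simps)
  qed
  have "edge_corr \<beta> x y \<le> edge_corr \<beta> H K \<longleftrightarrow>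
      exp \<beta> * cosh (x + y) * (exp (- \<beta>) * cosh (H - K)) \<le> exp \<beta> * cosh (H + K) * (exp (- \<beta>) * cosh (x - y))"
    unfolding edge_corr_def by (rule *) simp_all
  also have "\<dots> \<longleftrightarrow> cosh (x + y) * cosh (H - K) \<le> cosh (H + K) * cosh (x - y)"
    by (simp add: exp_minus field_simps)
  finally show ?thesis unfolding edge_corr_identity[symmetric] by simp
qed

lemma edge_corr_le:
  assumes "\<bar>x\<bar> \<le> H" "\<bar>y\<bar> \<le> K"
  shows "edge_corr \<beta> x y \<le> edge_corr \<beta> H K"
  unfolding edge_corr_le_iff using assms by (intro add_nonneg_nonneg mult_nonneg_nonneg) auto

text \<open>Both products of \<open>edge_corr_identity\<close> must vanish, and \<open>sinh\<close>
  vanishes only at 0; the two mixed cases would force \<open>H = 0\<close> or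
  \<open>K = 0\<close>.\<close>

lemma edge_corr_eqD:
  assumes "\<bar>x\<bar> \<le> H" "\<bar>y\<bar> \<le> K" "H > 0" "K > 0" "edge_corr \<beta> H K \<le> edge_corr \<beta> x y"
  shows "x = H \<and> y = K \<or> x = - H \<and> y = - K"
proof -
  have nn: "0 \<le> sinh (H + x) * sinh (K - y)" "0 \<le> sinh (H - x) * sinh (K + y)"
    using assms by (intro mult_nonneg_nonneg; auto)+
  have "0 \<le> sinh (x + H) * sinh (y - K) + sinh (x - H) * sinh (y + K)"
    using assms(5) unfolding edge_corr_le_iff .
  moreover have "sinh (y - K) = - sinh (K - y)" "sinh (x - H) = - sinh (H - x)"
    using sinh_minus[of "K - y"] sinh_minus[of "H - x"] by simp_all
  ultimately have "sinh (H + x) * sinh (K - y) + sinh (H - x) * sinh (K + y) \<le> 0"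
    by (simp add: add.commute)
  then have "sinh (H + x) * sinh (K - y) = 0" "sinh (H - x) * sinh (K + y) = 0"
    using nn by linarith+
  then have "(H + x = 0 \<or> K - y = 0) \<and> (H - x = 0 \<or> K + y = 0)" by (simp only: mult_eq_0_iff sinh_real_zero_iff)
  then show ?thesis using assms by auto
qed

lemma continuous_edge_corr [continuous_intros]:
  assumes "continuous_on S f" "continuous_on S g" "continuous_on S k"
  shows "continuous_on S (\<lambda>x. edge_corr (f x) (g x) (k x))"
proof -
  have "0 < exp b * cosh (x + y) + exp (- b) * cosh (x - y)" for b x y :: real
    by (intro add_pos_pos mult_pos_pos) auto
  then have "exp b * cosh (x + y) + exp (- b) * cosh (x - y) \<noteq> 0" for b x y :: real
    by (metis less_irrefl)
  then show ?thesis
    unfolding edge_corr_def by (intro continuous_intros assms) auto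
qed

section \<open>The plus field and rigidity of the plus phase\<close>

text \<open>The start is the field exerted by \<open>2 * r - 1\<close> frozen neighbours of equal
  sign, the largest that frozen spins can produce. The iterates therefore bound the fields uniformly
  in the far spins.\<close>

definition field_bound :: "nat \<Rightarrow> real \<Rightarrow> nat \<Rightarrow> real" where
  "field_bound r \<beta> m = (tree_map r \<beta> ^^ m) (real (2 * r - 1) * \<beta>)"

definition plus_field :: "nat \<Rightarrow> real \<Rightarrow> real" where
  "plus_field r \<beta> = lim (field_bound r \<beta>)"

text \<open>The share of the root in the energy: summed over the views from all vertices it gives
  \<open>graph_energy\<close>, which counts each edge from both ends.\<close>

definition star_obs :: "nat \<Rightarrow> (word \<Rightarrow> real) \<Rightarrow> real" where
  "star_obs r z = (\<Sum>s\<in>word_sphere r 1. z [] * z s)"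

text \<open>The mean of \<open>star_obs\<close> when all neighbours of the root carry the field
  \<open>c\<close>. At \<open>plus_field\<close> it is the maximum against which the energy per
  vertex is measured.\<close>

definition star_corr :: "nat \<Rightarrow> real \<Rightarrow> real \<Rightarrow> real" where
  "star_corr r \<beta> c = real (2 * r) * edge_corr \<beta> c (tree_map r \<beta> c)"

lemma tree_map_0 [simp]: "tree_map r \<beta> 0 = 0"
  by (simp add: tree_map_def)

lemma tree_map_nonneg: "\<beta> > 0 \<Longrightarrow> 0 \<le> h \<Longrightarrow> 0 \<le> tree_map r \<beta> h"
  using tree_map_mono[of \<beta> 0 h r] by simp

lemma field_bound_Suc: "field_bound r \<beta> (Suc m) = tree_map r \<beta> (field_bound r \<beta> m)"
  by (simp add: field_bound_def)

lemma field_bound_nonneg: "\<beta> > 0 \<Longrightarrow> 0 \<le> field_bound r \<beta> m"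
  by (induction m) (simp add: field_bound_def, simp only: field_bound_Suc tree_map_nonneg)

lemma field_bound_decseq:
  assumes "\<beta> > 0"
  shows "decseq (field_bound r \<beta>)"
proof (rule decseq_SucI)
  show "field_bound r \<beta> (Suc m) \<le> field_bound r \<beta> m" for m
  proof (induction m)
    case 0
    show ?case
      unfolding field_bound_Suc unfolding field_bound_def tree_map_def[of r \<beta>] funpow_0
      by (rule mult_left_mono[OF field_map_le[OF assms]]) simp
  next
    case (Suc m)
    then show ?case unfolding field_bound_Suc by (rule tree_map_mono[OF assms])
  qed
qed

lemma field_bound_tendsto:
  assumes "\<beta> > 0"
  shows "field_bound r \<beta> \<longlonglongrightarrow> plus_field r \<beta>"
proof -
  obtain L where "field_bound r \<beta> \<longlonglongrightarrow> L"
    using decseq_convergent[OF field_bound_decseq[OF assms]] field_bound_nonneg[OF assms] by metis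
  then show ?thesis unfolding plus_field_def using limI by blast
qed

lemma plus_field_nonneg: "\<beta> > 0 \<Longrightarrow> 0 \<le> plus_field r \<beta>"
  by (rule LIMSEQ_le_const[OF field_bound_tendsto]) (auto simp: field_bound_nonneg)

lemma continuous_tree_map [continuous_intros]:
  "continuous_on S f \<Longrightarrow> continuous_on S g \<Longrightarrow> continuous_on S (\<lambda>x. tree_map r (f x) (g x))"
  unfolding tree_map_def by (intro continuous_intros)

lemma tree_map_plus_field:
  assumes "\<beta> > 0"
  shows "tree_map r \<beta> (plus_field r \<beta>) = plus_field r \<beta>"
proof (rule LIMSEQ_unique)
  have "continuous_on UNIV (tree_map r \<beta>)"
    by (rule continuous_tree_map[OF continuous_on_const continuous_on_id])
  then have "isCont (tree_map r \<beta>) (plus_field r \<beta>)"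
    by (simp add: continuous_on_eq_continuous_at)
  then show "(\<lambda>m. tree_map r \<beta> (field_bound r \<beta> m)) \<longlonglongrightarrow> tree_map r \<beta> (plus_field r \<beta>)"
    using field_bound_tendsto[OF assms] by (rule isCont_tendsto_compose)
  show "(\<lambda>m. tree_map r \<beta> (field_bound r \<beta> m)) \<longlonglongrightarrow> plus_field r \<beta>"
    using LIMSEQ_Suc[OF field_bound_tendsto[OF assms]] by (simp add: field_bound_Suc)
qed

lemma funpow_fixpoint: "f x = x \<Longrightarrow> (f ^^ m) x = x"
  by (induction m) auto

lemma plus_field_pos_rank:
  assumes "\<beta> > 0" "plus_field r \<beta> > 0"
  shows "0 < real (2 * r - 1)"
proof (rule ccontr)
  assume "\<not> ?thesis"
  then have "real (2 * r - 1) = 0" by simp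
  then have "tree_map r \<beta> x = 0" for x by (simp only: tree_map_def mult_zero_left)
  then show False using tree_map_plus_field[OF assms(1), of r] assms(2) by simp
qed

lemma local_on_star_obs: "k \<ge> 1 \<Longrightarrow> local_on (word_ball r k) (star_obs r)"
proof -
  assume k: "k \<ge> 1"
  have "w \<in> word_ball r k" if "w \<in> word_sphere r 1" for w
    using that k by (simp add: word_ball_def word_sphere_def)
  then have "star_obs r z = star_obs r z'" if "\<forall>w\<in>word_ball r k. z w = z' w" for z z'
    unfolding star_obs_def using that Nil_in_ball by (intro sum.cong) simp_all
  then show ?thesis unfolding local_on_def by blast
qed

lemma card_sphere_1: "card (word_sphere r 1) = 2 * r"
  by (simp add: sphere_1 card_image inj_on_def card_letters del: One_nat_def)

lemma card_sphere_1_remove: "s \<in> word_sphere r 1 \<Longrightarrow> card (word_sphere r 1 - {s}) = 2 * r - 1"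
  using card_Diff_singleton[of s "word_sphere r 1"] card_sphere_1[of r] by simp

lemma ball_exp_star: "ball_exp r \<beta> 1 h (star_obs r) =
    (\<Sum>s\<in>word_sphere r 1. edge_corr \<beta> (h s) (\<Sum>w\<in>word_sphere r 1 - {s}. field_map \<beta> (h w)))"
proof -
  have "star_obs r = (\<lambda>z. \<Sum>s\<in>word_sphere r 1. z [] * z s)" by (simp add: star_obs_def fun_eq_iff)
  then show ?thesis by (simp only: ball_exp_sum ball_exp_edge cong: sum.cong)
qed

lemma ball_exp_star_const: "ball_exp r \<beta> 1 (\<lambda>_. c) (star_obs r) = star_corr r \<beta> c"
proof -
  have "ball_exp r \<beta> 1 (\<lambda>_. c) (star_obs r) = (\<Sum>s\<in>word_sphere r 1. edge_corr \<beta> c (tree_map r \<beta> c))"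
    unfolding ball_exp_star
    by (intro sum.cong refl) (simp only: sum_constant card_sphere_1_remove tree_map_def)
  then show ?thesis
    by (simp only: star_corr_def sum_constant card_sphere_1)
qed

lemma star_edge_abs:
  assumes "\<beta> > 0" "s \<in> word_sphere r 1" "\<forall>w\<in>word_sphere r 1. \<bar>h w\<bar> \<le> c"
  shows "\<bar>\<Sum>w\<in>word_sphere r 1 - {s}. field_map \<beta> (h w)\<bar> \<le> tree_map r \<beta> c"
proof -
  have "\<bar>\<Sum>w\<in>word_sphere r 1 - {s}. field_map \<beta> (h w)\<bar> \<le> (\<Sum>w\<in>word_sphere r 1 - {s}. field_map \<beta> c)"
    using assms by (intro order_trans[OF sum_abs] sum_mono field_map_abs) auto
  then show ?thesis
    by (simp only: sum_constant card_sphere_1_remove[OF assms(2)] tree_map_def)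
qed

text \<open>Decimation down to the star keeps the fields in absolute value below
  \<open>plus_field\<close>, because this is a fixed point of the recursion; on the star the edge
  correlations are monotone in the bounds on the fields.\<close>

lemma ball_exp_star_le:
  assumes "\<beta> > 0" "k \<ge> 1" "\<forall>w\<in>word_sphere r k. \<bar>h w\<bar> \<le> plus_field r \<beta>"
  shows "ball_exp r \<beta> k h (star_obs r) \<le> star_corr r \<beta> (plus_field r \<beta>)"
proof -
  let ?H = "plus_field r \<beta>"
  note fixp = funpow_fixpoint[where f = "tree_map r \<beta>", OF tree_map_plus_field[OF assms(1)]]
  have k: "k = 1 + (k - 1)" using assms(2) by simp
  have "\<exists>h'. (\<forall>w\<in>word_sphere r 1. \<bar>h' w\<bar> \<le> (tree_map r \<beta> ^^ (k - 1)) ?H) \<and>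
    (\<forall>F. local_on (word_ball r 1) F \<longrightarrow> ball_exp r \<beta> (1 + (k - 1)) h F = ball_exp r \<beta> 1 h' F)"
    by (rule ball_exp_decimate_bounded[OF assms(1) order_refl]) (use assms(3) k in simp)
  then obtain h' where h': "\<forall>w\<in>word_sphere r 1. \<bar>h' w\<bar> \<le> ?H"
    "\<forall>F. local_on (word_ball r 1) F \<longrightarrow> ball_exp r \<beta> k h F = ball_exp r \<beta> 1 h' F"
    unfolding fixp k[symmetric] by (elim exE conjE)
  have eq: "ball_exp r \<beta> k h (star_obs r) = ball_exp r \<beta> 1 h' (star_obs r)"
    using h'(2) local_on_star_obs[OF order_refl] by simp
  have "ball_exp r \<beta> 1 h' (star_obs r) \<le> (\<Sum>s\<in>word_sphere r 1. edge_corr \<beta> ?H (tree_map r \<beta> ?H))"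
    unfolding ball_exp_star
    using h'(1) star_edge_abs[OF assms(1) _ h'(1)] by (intro sum_mono edge_corr_le) blast+
  also have "\<dots> = star_corr r \<beta> ?H"
    by (simp only: star_corr_def sum_constant card_sphere_1)
  finally show ?thesis using eq by simp
qed

lemma sum_le_const_eqD:
  fixes a :: "'i \<Rightarrow> real"
  assumes "finite S" "\<And>i. i \<in> S \<Longrightarrow> a i \<le> c" "real (card S) * c \<le> sum a S" "i \<in> S"
  shows "a i = c"
proof -
  have "sum (\<lambda>i. c - a i) S \<le> 0" using assms(3) by (simp add: sum_subtractf)
  moreover have "0 \<le> sum (\<lambda>i. c - a i) S" using assms(2) by (intro sum_nonneg) auto
  ultimately have "sum (\<lambda>i. c - a i) S = 0" by linarith
  then have "\<forall>i\<in>S. c - a i = 0"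
    using assms(1,2) by (subst (asm) sum_nonneg_eq_0_iff) auto
  then show ?thesis using assms(4) by simp
qed

text \<open>A sum that reaches its upper bound has every term at the bound; the sign
  \<open>\<sigma>\<close> treats both extremes at once.\<close>

lemma field_map_sum_saturated:
  assumes "\<beta> > 0" "finite S" "\<And>w. w \<in> S \<Longrightarrow> \<bar>h w\<bar> \<le> H" "\<sigma> = 1 \<or> \<sigma> = -1"
    and "(\<Sum>w\<in>S. field_map \<beta> (h w)) = \<sigma> * (real (card S) * field_map \<beta> H)" "w \<in> S"
  shows "h w = \<sigma> * H"
proof -
  have fm: "field_map \<beta> (\<sigma> * x) = \<sigma> * field_map \<beta> x" for x using assms(4) by auto
  have ss: "\<sigma> * \<sigma> = 1" using assms(4) by auto
  have "\<sigma> * field_map \<beta> (h w) = field_map \<beta> H"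
  proof (rule sum_le_const_eqD[OF assms(2) _ _ assms(6)])
    show "real (card S) * field_map \<beta> H \<le> (\<Sum>w\<in>S. \<sigma> * field_map \<beta> (h w))"
      unfolding sum_distrib_left[symmetric] assms(5) mult.assoc[symmetric] ss by simp
    fix w assume "w \<in> S"
    then have "\<sigma> * h w \<le> H" using assms(3)[of w] assms(4) by (auto simp: abs_le_iff)
    then show "\<sigma> * field_map \<beta> (h w) \<le> field_map \<beta> H"
      using field_map_le_iff[OF assms(1)] by (simp add: fm[symmetric])
  qed
  then have "\<sigma> * h w = H" unfolding fm[symmetric] field_map_eq_iff[OF assms(1)] .
  then show ?thesis using assms(4) by auto
qed

text \<open>On the star, equality in the edge comparison at one leaf fixes a sign, and the saturated
  sum over the other leaves passes it on to them. On larger balls the pushed fields are extremal by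
  induction, and saturation passes the sign from every vertex to its children.\<close>

lemma plus_rigid:
  assumes "\<beta> > 0" "k \<ge> 1" "\<forall>w\<in>word_sphere r k. \<bar>h w\<bar> \<le> plus_field r \<beta>"
    and "star_corr r \<beta> (plus_field r \<beta>) \<le> ball_exp r \<beta> k h (star_obs r)"
  shows "\<exists>\<sigma>. (\<sigma> = 1 \<or> \<sigma> = -1) \<and> (\<forall>w\<in>word_sphere r k. h w = \<sigma> * plus_field r \<beta>)"
proof (cases "plus_field r \<beta> = 0")
  \<comment> \<open>All fields vanish, so either sign would do.\<close>
  case True
  then have "\<forall>w\<in>word_sphere r k. h w = 1 * plus_field r \<beta>" using assms(3) by fastforce
  then show ?thesis by blast
next
  case False
  let ?H = "plus_field r \<beta>"
  have H: "?H > 0" using False plus_field_nonneg[OF assms(1), of r] by linarith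
  have fixH: "real (2 * r - 1) * field_map \<beta> ?H = ?H"
    using tree_map_plus_field[OF assms(1), of r] by (simp only: tree_map_def)
  show ?thesis
    using assms(2-4)
  proof (induction k arbitrary: h rule: nat_induct_at_least)
    case base
    show ?case
    proof (cases "word_sphere r 1 = {}")
      case False
      then obtain s where s: "s \<in> word_sphere r 1" by blast
      let ?k = "\<Sum>w\<in>word_sphere r 1 - {s}. field_map \<beta> (h w)"
      have k: "\<bar>?k\<bar> \<le> ?H"
        using star_edge_abs[OF assms(1) s base(1)] tree_map_plus_field[OF assms(1), of r] by simp
      have "edge_corr \<beta> (h s) ?k = edge_corr \<beta> ?H ?H"
      proof (rule sum_le_const_eqD[OF finite_word_sphere _ _ s])
        show "real (card (word_sphere r 1)) * edge_corr \<beta> ?H ?H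
            \<le> (\<Sum>t\<in>word_sphere r 1. edge_corr \<beta> (h t) (\<Sum>w\<in>word_sphere r 1 - {t}. field_map \<beta> (h w)))"
          using base(2) unfolding ball_exp_star star_corr_def card_sphere_1 tree_map_plus_field[OF assms(1)] .
        fix t assume t: "t \<in> word_sphere r 1"
        then show "edge_corr \<beta> (h t) (\<Sum>w\<in>word_sphere r 1 - {t}. field_map \<beta> (h w)) \<le> edge_corr \<beta> ?H ?H"
          using star_edge_abs[OF assms(1) t base(1)] tree_map_plus_field[OF assms(1), of r] base(1)
          by (intro edge_corr_le) simp_all
      qed
      then have "h s = ?H \<and> ?k = ?H \<or> h s = - ?H \<and> ?k = - ?H"
        using bspec[OF base(1) s] k H by (intro edge_corr_eqD[where \<beta> = \<beta>]) simp_all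
      then obtain \<sigma> where \<sigma>: "\<sigma> = 1 \<or> \<sigma> = -1" "h s = \<sigma> * ?H" "?k = \<sigma> * ?H"
        by (elim disjE conjE) (metis mult_1 mult_minus1)+
      have "h w = \<sigma> * ?H" if w: "w \<in> word_sphere r 1 - {s}" for w
      proof (rule field_map_sum_saturated[OF assms(1) _ _ \<sigma>(1) _ w])
        show "?k = \<sigma> * (real (card (word_sphere r 1 - {s})) * field_map \<beta> ?H)"
          unfolding card_sphere_1_remove[OF s] fixH by (rule \<sigma>(3))
      qed (use base(1) in auto)
      then show ?thesis using \<sigma> by blast
    qed blast
  next
    case (Suc k)
    have push: "\<bar>push_fields r \<beta> h p\<bar> \<le> ?H" if "p \<in> word_sphere r k" for p
      using push_fields_abs[OF assms(1) that Suc.hyps bspec[OF Suc.prems(1)]] tree_map_plus_field[OF assms(1), of r] by simp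
    have "star_corr r \<beta> ?H \<le> ball_exp r \<beta> k (push_fields r \<beta> h) (star_obs r)"
      using Suc.prems(2) ball_exp_decimate[OF local_on_star_obs[OF Suc.hyps]] by simp
    from Suc.IH[OF ballI[OF push] this] obtain \<sigma> where
      \<sigma>: "\<sigma> = 1 \<or> \<sigma> = -1" "\<forall>p\<in>word_sphere r k. push_fields r \<beta> h p = \<sigma> * ?H" by blast
    have "h w = \<sigma> * ?H" if w: "w \<in> word_sphere r (Suc k)" for w
    proof -
      let ?p = "tl w"
      have p: "?p \<in> word_sphere r k" by (rule tl_in_sphere[OF w])
      have "?p \<in> words r" "length ?p = k" using p unfolding word_sphere_def by blast+
      then have p': "?p \<in> words r" "?p \<noteq> []" using Suc.hyps by (metis list.size(3) not_one_le_zero)+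
      have wc: "w \<in> children r ?p" using w by (auto simp: children_def word_sphere_def)
      show ?thesis
      proof (rule field_map_sum_saturated[OF assms(1) finite_children _ \<sigma>(1) _ wc])
        show "(\<Sum>w\<in>children r ?p. field_map \<beta> (h w)) = \<sigma> * (real (card (children r ?p)) * field_map \<beta> ?H)"
          using bspec[OF \<sigma>(2) p] unfolding push_fields_def card_children[OF p'] fixH .
        show "\<bar>h u\<bar> \<le> ?H" if "u \<in> children r ?p" for u
          using Suc.prems(1) children_sphere[OF p] that by blast
      qed
    qed
    then show ?case using \<sigma>(1) by blast
  qed
qed

section \<open>Compactness of the boundary fields and quantitative rigidity\<close>

lemma subseq_finite:
  fixes h :: "nat \<Rightarrow> 'i \<Rightarrow> real"
  assumes "finite S" "\<forall>w\<in>S. \<forall>j. \<bar>h j w\<bar> \<le> M"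
  shows "\<exists>s l. strict_mono (s :: nat \<Rightarrow> nat) \<and> (\<forall>w\<in>S. (\<lambda>j. h (s j) w) \<longlonglongrightarrow> l w)"
  using assms
proof (induction S rule: finite_induct)
  case empty
  then show ?case by (intro exI[of _ id]) (simp add: strict_mono_def)
next
  case (insert u S)
  then obtain s l where s: "strict_mono s" "\<And>w. w \<in> S \<Longrightarrow> (\<lambda>j. h (s j) w) \<longlonglongrightarrow> l w" by blast
  have "bounded (range (\<lambda>j. h (s j) u))"
    using insert.prems by (auto simp: bounded_iff intro!: exI[of _ M])
  then obtain a t where t: "strict_mono t" "((\<lambda>j. h (s j) u) \<circ> t) \<longlonglongrightarrow> a"
    using bounded_imp_convergent_subsequence by blast
  have "(\<lambda>j. h ((s \<circ> t) j) w) \<longlonglongrightarrow> (l(u := a)) w" if "w \<in> insert u S" for w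
  proof (cases "w = u")
    case True
    then show ?thesis using t(2) by (simp add: comp_def)
  next
    case False
    then have "(\<lambda>j. h (s j) w) \<longlonglongrightarrow> l w" using s(2) that by blast
    from LIMSEQ_subseq_LIMSEQ[OF this t(1)] show ?thesis using False by (simp add: comp_def)
  qed
  then show ?case using strict_mono_o[OF s(1) t(1)] by blast
qed

lemma ball_exp_tendsto:
  assumes "\<And>w. w \<in> word_sphere r k \<Longrightarrow> ((\<lambda>j. h j w) \<longlongrightarrow> l w) \<F>"
  shows "((\<lambda>j. ball_exp r \<beta> k (h j) F) \<longlongrightarrow> ball_exp r \<beta> k l F) \<F>"
  unfolding ball_exp_def ssum_def ball_weight_def
  using assms ball_Z_neq_0[of r k \<beta> l, unfolded ssum_def ball_weight_def]
  by (intro tendsto_intros) auto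

text \<open>The \<open>j\<close>-th family obeys only the \<open>j\<close>-th iterate as a bound;
  limit points obey the sharp bound \<open>plus_field\<close>, which is the hypothesis of
  rigidity.\<close>

lemma bounded_fields_limit:
  fixes h :: "nat \<Rightarrow> word \<Rightarrow> real"
  assumes "\<beta> > 0" "\<forall>j. \<forall>w\<in>word_sphere r k. \<bar>h j w\<bar> \<le> field_bound r \<beta> j"
  shows "\<exists>s l. strict_mono (s :: nat \<Rightarrow> nat) \<and> (\<forall>w\<in>word_sphere r k. \<bar>l w\<bar> \<le> plus_field r \<beta>) \<and>
    (\<forall>F. (\<lambda>j. ball_exp r \<beta> k (h (s j)) F) \<longlonglongrightarrow> ball_exp r \<beta> k l F)"
proof -
  have "\<forall>w\<in>word_sphere r k. \<forall>j. \<bar>h j w\<bar> \<le> field_bound r \<beta> 0"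
    using assms(2) decseqD[OF field_bound_decseq[OF assms(1)] le0, of r] order_trans by blast
  from subseq_finite[OF finite_word_sphere this] obtain s l
    where s: "strict_mono s" "\<And>w. w \<in> word_sphere r k \<Longrightarrow> (\<lambda>j. h (s j) w) \<longlonglongrightarrow> l w" by blast
  have "\<bar>l w\<bar> \<le> plus_field r \<beta>" if w: "w \<in> word_sphere r k" for w
  proof (rule LIMSEQ_le)
    show "(\<lambda>j. \<bar>h (s j) w\<bar>) \<longlonglongrightarrow> \<bar>l w\<bar>" using s(2)[OF w] by (rule tendsto_rabs)
    show "(\<lambda>j. field_bound r \<beta> (s j)) \<longlonglongrightarrow> plus_field r \<beta>"
      using LIMSEQ_subseq_LIMSEQ[OF field_bound_tendsto[OF assms(1)] s(1)] by (simp add: comp_def)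
    show "\<exists>N. \<forall>n\<ge>N. \<bar>h (s n) w\<bar> \<le> field_bound r \<beta> (s n)" using assms(2) w by blast
  qed
  moreover have "(\<lambda>j. ball_exp r \<beta> k (h (s j)) F) \<longlonglongrightarrow> ball_exp r \<beta> k l F" for F
    by (rule ball_exp_tendsto) (rule s(2))
  ultimately show ?thesis using s(1) by blast
qed

text \<open>Rigidity leaves the sign open; on these observables both signs have the same
  mean.\<close>

definition even_obs :: "word set \<Rightarrow> ((word \<Rightarrow> real) \<Rightarrow> real) \<Rightarrow> bool" where
  "even_obs B F \<longleftrightarrow> (\<forall>z\<in>B \<rightarrow>\<^sub>E spins. F (\<lambda>w\<in>B. - z w) = F z)"

lemma ball_exp_even: "even_obs (word_ball r k) F \<Longrightarrow> ball_exp r \<beta> k (\<lambda>w. - h w) F = ball_exp r \<beta> k h F"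
  unfolding ball_exp_flip by (rule ball_exp_cong) (simp_all add: even_obs_def)

text \<open>By compactness: counterexamples for \<open>\<epsilon> = 1 / (j + 1)\<close> and
  \<open>m = j\<close> have a limit point to which \<open>plus_rigid\<close> applies.\<close>

lemma near_plus:
  assumes "\<beta> > 0" "k \<ge> 1" "even_obs (word_ball r k) F" "\<delta> > 0"
  shows "\<exists>\<epsilon>>0. \<exists>m. \<forall>h. (\<forall>w\<in>word_sphere r k. \<bar>h w\<bar> \<le> field_bound r \<beta> m) \<longrightarrow>
    star_corr r \<beta> (plus_field r \<beta>) - \<epsilon> \<le> ball_exp r \<beta> k h (star_obs r) \<longrightarrow>
    \<bar>ball_exp r \<beta> k h F - ball_exp r \<beta> k (\<lambda>_. plus_field r \<beta>) F\<bar> \<le> \<delta>"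
proof (rule ccontr)
  let ?H = "plus_field r \<beta>"
  assume neg: "\<not> ?thesis"
  have "\<forall>j. \<exists>h. (\<forall>w\<in>word_sphere r k. \<bar>h w\<bar> \<le> field_bound r \<beta> j) \<and>
    star_corr r \<beta> ?H - inverse (real (Suc j)) \<le> ball_exp r \<beta> k h (star_obs r) \<and>
    \<not> \<bar>ball_exp r \<beta> k h F - ball_exp r \<beta> k (\<lambda>_. ?H) F\<bar> \<le> \<delta>"
  proof
    fix j
    have "inverse (real (Suc j)) > 0" by simp
    then show "\<exists>h. (\<forall>w\<in>word_sphere r k. \<bar>h w\<bar> \<le> field_bound r \<beta> j) \<and>
    star_corr r \<beta> ?H - inverse (real (Suc j)) \<le> ball_exp r \<beta> k h (star_obs r) \<and>
    \<not> \<bar>ball_exp r \<beta> k h F - ball_exp r \<beta> k (\<lambda>_. ?H) F\<bar> \<le> \<delta>"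
      using neg by meson
  qed
  then obtain h where h: "\<forall>j. \<forall>w\<in>word_sphere r k. \<bar>h j w\<bar> \<le> field_bound r \<beta> j"
    "\<And>j. star_corr r \<beta> ?H - inverse (real (Suc j)) \<le> ball_exp r \<beta> k (h j) (star_obs r)"
    "\<And>j. \<not> \<bar>ball_exp r \<beta> k (h j) F - ball_exp r \<beta> k (\<lambda>_. ?H) F\<bar> \<le> \<delta>"
    unfolding choice_iff by blast
  from bounded_fields_limit[OF assms(1) h(1)] obtain s l where s: "strict_mono s"
    and l: "\<forall>w\<in>word_sphere r k. \<bar>l w\<bar> \<le> ?H"
    and lim: "\<And>F. (\<lambda>j. ball_exp r \<beta> k (h (s j)) F) \<longlonglongrightarrow> ball_exp r \<beta> k l F" by blast
  have "star_corr r \<beta> ?H \<le> ball_exp r \<beta> k l (star_obs r)"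
  proof (rule LIMSEQ_le)
    have "(\<lambda>j. inverse (real (Suc (s j)))) \<longlonglongrightarrow> 0"
      using LIMSEQ_subseq_LIMSEQ[OF LIMSEQ_inverse_real_of_nat s] by (simp add: comp_def)
    then show "(\<lambda>j. star_corr r \<beta> ?H - inverse (real (Suc (s j)))) \<longlonglongrightarrow> star_corr r \<beta> ?H"
      using tendsto_diff[OF tendsto_const] by fastforce
    show "(\<lambda>j. ball_exp r \<beta> k (h (s j)) (star_obs r)) \<longlonglongrightarrow> ball_exp r \<beta> k l (star_obs r)" by (rule lim)
  qed (use h(2) in blast)
  from plus_rigid[OF assms(1,2) l this] obtain \<sigma> where \<sigma>: "\<sigma> = 1 \<or> \<sigma> = -1"
    "\<And>w. w \<in> word_sphere r k \<Longrightarrow> l w = \<sigma> * ?H" by blast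
  have "ball_exp r \<beta> k l F = ball_exp r \<beta> k (\<lambda>_. \<sigma> * ?H) F"
    by (rule ball_exp_cong) (simp_all add: \<sigma>(2))
  also have "\<dots> = ball_exp r \<beta> k (\<lambda>_. ?H) F"
    using \<sigma>(1) ball_exp_even[OF assms(3), of \<beta> "\<lambda>_. ?H"] by auto
  finally have "(\<lambda>j. ball_exp r \<beta> k (h (s j)) F) \<longlonglongrightarrow> ball_exp r \<beta> k (\<lambda>_. ?H) F"
    using lim[of F] by simp
  then obtain j where "dist (ball_exp r \<beta> k (h (s j)) F) (ball_exp r \<beta> k (\<lambda>_. ?H) F) < \<delta>"
    using assms(4) by (meson LIMSEQ_iff_nz lim_sequentially order_refl)
  then show False using h(3)[of "s j"] by (simp add: dist_real_def)
qed

lemma star_upper: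
  assumes "\<beta> > 0" "k \<ge> 1" "\<epsilon> > 0"
  shows "\<exists>m. \<forall>h. (\<forall>w\<in>word_sphere r k. \<bar>h w\<bar> \<le> field_bound r \<beta> m) \<longrightarrow>
    ball_exp r \<beta> k h (star_obs r) \<le> star_corr r \<beta> (plus_field r \<beta>) + \<epsilon>"
proof (rule ccontr)
  let ?H = "plus_field r \<beta>"
  assume neg: "\<not> ?thesis"
  then have "\<forall>j. \<exists>h. (\<forall>w\<in>word_sphere r k. \<bar>h w\<bar> \<le> field_bound r \<beta> j) \<and>
    star_corr r \<beta> ?H + \<epsilon> \<le> ball_exp r \<beta> k h (star_obs r)"
    by (meson le_cases)
  then obtain h where h: "\<forall>j. \<forall>w\<in>word_sphere r k. \<bar>h j w\<bar> \<le> field_bound r \<beta> j"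
    "\<And>j. star_corr r \<beta> ?H + \<epsilon> \<le> ball_exp r \<beta> k (h j) (star_obs r)"
    unfolding choice_iff by blast
  from bounded_fields_limit[OF assms(1) h(1)] obtain s l where s: "strict_mono s"
    and l: "\<forall>w\<in>word_sphere r k. \<bar>l w\<bar> \<le> ?H"
    and lim: "\<And>F. (\<lambda>j. ball_exp r \<beta> k (h (s j)) F) \<longlonglongrightarrow> ball_exp r \<beta> k l F" by blast
  have "star_corr r \<beta> ?H + \<epsilon> \<le> ball_exp r \<beta> k l (star_obs r)"
    by (rule LIMSEQ_le_const[OF lim]) (use h(2) in blast)
  then show False using ball_exp_star_le[OF assms(1,2) l] assms(3) by simp
qed

text \<open>The bound is linear in the energy deficit so that it can be averaged over conditional
  laws. Below a threshold \<open>e\<close> the deficit is covered by \<open>near_plus\<close>; above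
  it, the trivial bound \<open>2 * c\<close> on the deviation is at most \<open>2 * c / e\<close>
  times the deficit. \<open>C\<close> comes before \<epsilon>, because \<epsilon> will be chosen in
  terms of \<open>C\<close>.\<close>

lemma deviation_controlled_by_star:
  assumes "\<beta> > 0" "k \<ge> 1" "even_obs (word_ball r k) F" "\<delta> > 0"
  shows "\<exists>C\<ge>0. \<forall>\<epsilon>>0. \<exists>m. \<forall>h. (\<forall>w\<in>word_sphere r k. \<bar>h w\<bar> \<le> field_bound r \<beta> m) \<longrightarrow>
    0 \<le> star_corr r \<beta> (plus_field r \<beta>) + \<epsilon> - ball_exp r \<beta> k h (star_obs r) \<and>
    \<bar>ball_exp r \<beta> k h F - ball_exp r \<beta> k (\<lambda>_. plus_field r \<beta>) F\<bar>
      \<le> \<delta> + C * (star_corr r \<beta> (plus_field r \<beta>) + \<epsilon> - ball_exp r \<beta> k h (star_obs r))"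
proof -
  let ?S = "star_corr r \<beta> (plus_field r \<beta>)" and ?F = "ball_exp r \<beta> k (\<lambda>_. plus_field r \<beta>) F"
  obtain e m1 where e: "e > 0" and m1: "\<And>h. (\<forall>w\<in>word_sphere r k. \<bar>h w\<bar> \<le> field_bound r \<beta> m1) \<Longrightarrow>
    ?S - e \<le> ball_exp r \<beta> k h (star_obs r) \<Longrightarrow> \<bar>ball_exp r \<beta> k h F - ?F\<bar> \<le> \<delta>"
    using near_plus[OF assms] by meson
  define c where "c = (\<Sum>z\<in>word_ball r k \<rightarrow>\<^sub>E spins. \<bar>F z\<bar>)"
  have c: "c \<ge> 0" by (simp add: c_def sum_nonneg)
  have F: "\<bar>ball_exp r \<beta> k h F\<bar> \<le> c" for h
    unfolding c_def by (rule ball_exp_abs_le, rule member_le_sum) auto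
  show ?thesis
  proof (intro exI[of _ "2 * c / e"] conjI allI impI)
    show "0 \<le> 2 * c / e" using c e by simp
    fix \<epsilon> :: real assume \<epsilon>: "\<epsilon> > 0"
    obtain m2 where m2: "\<And>h. (\<forall>w\<in>word_sphere r k. \<bar>h w\<bar> \<le> field_bound r \<beta> m2) \<Longrightarrow>
      ball_exp r \<beta> k h (star_obs r) \<le> ?S + \<epsilon>"
      using star_upper[OF assms(1,2) \<epsilon>] by meson
    show "\<exists>m. \<forall>h. (\<forall>w\<in>word_sphere r k. \<bar>h w\<bar> \<le> field_bound r \<beta> m) \<longrightarrow>
      0 \<le> ?S + \<epsilon> - ball_exp r \<beta> k h (star_obs r) \<and>
      \<bar>ball_exp r \<beta> k h F - ?F\<bar> \<le> \<delta> + 2 * c / e * (?S + \<epsilon> - ball_exp r \<beta> k h (star_obs r))"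
    proof (intro exI[of _ "max m1 m2"] allI impI)
      fix h assume h: "\<forall>w\<in>word_sphere r k. \<bar>h w\<bar> \<le> field_bound r \<beta> (max m1 m2)"
      have le: "field_bound r \<beta> (max m1 m2) \<le> field_bound r \<beta> m1" "field_bound r \<beta> (max m1 m2) \<le> field_bound r \<beta> m2"
        using decseqD[OF field_bound_decseq[OF assms(1)]] by simp_all
      have h1: "\<forall>w\<in>word_sphere r k. \<bar>h w\<bar> \<le> field_bound r \<beta> m1"
        and h2: "\<forall>w\<in>word_sphere r k. \<bar>h w\<bar> \<le> field_bound r \<beta> m2"
        using h le order_trans by blast+
      have pos: "0 \<le> ?S + \<epsilon> - ball_exp r \<beta> k h (star_obs r)" using m2[OF h2] by simp
      have "\<bar>ball_exp r \<beta> k h F - ?F\<bar> \<le> \<delta> + 2 * c / e * (?S + \<epsilon> - ball_exp r \<beta> k h (star_obs r))"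
      proof (cases "?S - e \<le> ball_exp r \<beta> k h (star_obs r)")
        case True
        have "0 \<le> 2 * c / e * (?S + \<epsilon> - ball_exp r \<beta> k h (star_obs r))"
          using c e pos by (intro mult_nonneg_nonneg) auto
        then show ?thesis using m1[OF h1 True] by linarith
      next
        case False
        have "2 * c = 2 * c / e * e" using e by simp
        also have "\<dots> \<le> 2 * c / e * (?S + \<epsilon> - ball_exp r \<beta> k h (star_obs r))"
          using False \<epsilon> c e by (intro mult_left_mono) auto
        finally show ?thesis using F[of h] F[of "\<lambda>_. plus_field r \<beta>"] assms(4) by linarith
      qed
      then show "0 \<le> ?S + \<epsilon> - ball_exp r \<beta> k h (star_obs r) \<and>
        \<bar>ball_exp r \<beta> k h F - ?F\<bar> \<le> \<delta> + 2 * c / e * (?S + \<epsilon> - ball_exp r \<beta> k h (star_obs r))"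
        using pos by blast
    qed
  qed
qed

section \<open>Growth of small fields below the plus field\<close>

lemma star_corr_mono:
  assumes "\<beta> > 0" "0 \<le> a" "a \<le> c"
  shows "star_corr r \<beta> a \<le> star_corr r \<beta> c"
  unfolding star_corr_def
  using assms tree_map_mono[OF assms(1,3), of r] tree_map_nonneg[OF assms(1,2), of r]
  by (intro mult_left_mono edge_corr_le) auto

text \<open>By concavity \<open>tree_map r \<beta> x / x\<close> does not increase with
  \<open>x\<close>, so below \<open>a\<close> every step multiplies by at least
  \<open>\<rho> = tree_map r \<beta> a / a > 1\<close>.\<close>

lemma iterates_exceed:
  assumes "\<beta> > 0" "0 < a" "a < tree_map r \<beta> a" "0 < B"
  shows "\<exists>m. a \<le> (tree_map r \<beta> ^^ m) B"
proof (rule ccontr)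
  assume "\<not> ?thesis"
  then have lt: "(tree_map r \<beta> ^^ m) B < a" for m by (simp add: not_le)
  define \<rho> where "\<rho> = tree_map r \<beta> a / a"
  have \<rho>: "\<rho> > 1" using assms by (simp add: \<rho>_def)
  have growth: "x * \<rho> \<le> tree_map r \<beta> x" if "0 < x" "x < a" for x
  proof -
    have "x * field_map \<beta> a \<le> a * field_map \<beta> x"
      using field_map_strictly_concave[OF assms(1) that] by simp
    then have "real (2 * r - 1) * (x * field_map \<beta> a) \<le> real (2 * r - 1) * (a * field_map \<beta> x)"
      by (rule mult_left_mono) simp
    then have "x * tree_map r \<beta> a \<le> a * tree_map r \<beta> x"
      unfolding tree_map_def by (simp only: mult_ac)
    then show ?thesis using assms(2) by (simp add: \<rho>_def field_simps)
  qed
  have "B * \<rho> ^ m \<le> (tree_map r \<beta> ^^ m) B" for m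
  proof (induction m)
    case (Suc m)
    have pos: "0 < B * \<rho> ^ m" using assms(4) \<rho> by simp
    have "B * \<rho> ^ Suc m = (B * \<rho> ^ m) * \<rho>" by simp
    also have "\<dots> \<le> (tree_map r \<beta> ^^ m) B * \<rho>"
      using Suc.IH \<rho> by (intro mult_right_mono) auto
    also have "\<dots> \<le> tree_map r \<beta> ((tree_map r \<beta> ^^ m) B)"
      using pos Suc.IH lt[of m] by (intro growth) auto
    finally show ?case by simp
  qed simp
  moreover obtain m where "a / B < \<rho> ^ m" using real_arch_pow[OF \<rho>] by blast
  ultimately show False using lt[of m] assms(4)
    by (metis divide_less_eq less_le_trans mult.commute not_less_iff_gr_or_eq)
qed

text \<open>\<open>plus_field\<close> is fixed by the map, but a point \<open>a\<close> slightly
  below it is moved up, by strict concavity, and a strict inequality survives a small decrease of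
  \<beta>. At the smaller \<open>\<beta>'\<close> the iterates of any \<open>B > 0\<close> then pass
  \<open>a\<close>. The choice of \<open>\<beta>'\<close> does not depend on
  \<open>B\<close>.\<close>

lemma free_star_lower_bound:
  assumes "\<beta> > 0" "plus_field r \<beta> > 0" "\<epsilon> > 0"
  shows "\<exists>\<beta>'. 0 < \<beta>' \<and> \<beta>' < \<beta> \<and> (\<forall>B>0. \<exists>R\<ge>1.
    star_corr r \<beta> (plus_field r \<beta>) - \<epsilon> \<le> ball_exp r \<beta>' R (\<lambda>_. B) (star_obs r))"
proof -
  let ?H = "plus_field r \<beta>"
  have rank: "0 < real (2 * r - 1)" by (rule plus_field_pos_rank[OF assms(1,2)])
  have cont: "continuous_on UNIV (\<lambda>a. star_corr r \<beta> a)" "continuous_on UNIV (\<lambda>b. star_corr r b a)"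
    "continuous_on UNIV (\<lambda>b. tree_map r b a)" for a
    unfolding star_corr_def by (intro continuous_intros)+
  have ev: "eventually (\<lambda>y. f y > f x - e) (at_left x)"
    if "continuous_on UNIV f" "e > 0" for f :: "real \<Rightarrow> real" and x e
  proof -
    have "(f \<longlongrightarrow> f x) (at_left x)"
      using that(1) by (simp add: continuous_on_eq_continuous_at isCont_def filterlim_at_split)
    then show ?thesis using order_tendstoD(1)[of f "f x" _ "f x - e"] that(2) by simp
  qed
  have "eventually (\<lambda>a. 0 < a) (at_left ?H)" "eventually (\<lambda>a. a < ?H) (at_left ?H)"
    using eventually_at_left_field assms(2) by (auto intro!: exI[of _ 0] simp: eventually_at_left_field)
  moreover note ev[OF cont(1), of "\<epsilon> / 2" ?H]
  ultimately have "eventually (\<lambda>a. 0 < a \<and> a < ?H \<and> star_corr r \<beta> a > star_corr r \<beta> ?H - \<epsilon> / 2) (at_left ?H)"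
    using assms(3) by (simp add: eventually_conj)
  then obtain a where a: "0 < a" "a < ?H" "star_corr r \<beta> a > star_corr r \<beta> ?H - \<epsilon> / 2"
    using eventually_happens'[OF trivial_limit_at_left_real] by blast
  have "a * ?H < ?H * tree_map r \<beta> a"
  proof -
    have "real (2 * r - 1) * (a * field_map \<beta> ?H) < real (2 * r - 1) * (?H * field_map \<beta> a)"
      using field_map_strictly_concave[OF assms(1) a(1,2)] rank by (rule mult_strict_left_mono)
    then have "a * tree_map r \<beta> ?H < ?H * tree_map r \<beta> a"
      unfolding tree_map_def by (simp only: mult_ac)
    then show ?thesis unfolding tree_map_plus_field[OF assms(1)] .
  qed
  then have ga: "a < tree_map r \<beta> a" using assms(2) by (simp add: mult.commute)
  have "eventually (\<lambda>b. 0 < b) (at_left \<beta>)" "eventually (\<lambda>b. b < \<beta>) (at_left \<beta>)"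
    using assms(1) by (auto intro!: exI[of _ 0] simp: eventually_at_left_field)
  moreover note ev[OF cont(2)[of a], of "\<epsilon> / 2" \<beta>] ev[OF cont(3)[of a], of "tree_map r \<beta> a - a" \<beta>]
  ultimately have "eventually (\<lambda>b. 0 < b \<and> b < \<beta> \<and> star_corr r b a > star_corr r \<beta> a - \<epsilon> / 2 \<and>
      tree_map r b a > a) (at_left \<beta>)"
    using assms(3) ga by (simp add: eventually_conj)
  then obtain b where b: "0 < b" "b < \<beta>" "star_corr r b a > star_corr r \<beta> a - \<epsilon> / 2" "a < tree_map r b a"
    using eventually_happens'[OF trivial_limit_at_left_real] by blast
  have "\<exists>R\<ge>1. star_corr r \<beta> ?H - \<epsilon> \<le> ball_exp r b R (\<lambda>_. B) (star_obs r)" if B: "B > 0" for B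
  proof -
    obtain m where m: "a \<le> (tree_map r b ^^ m) B"
      using iterates_exceed[OF b(1) a(1) b(4) B] by blast
    have "star_corr r \<beta> ?H - \<epsilon> \<le> star_corr r b a" using a(3) b(3) by simp
    also have "\<dots> \<le> star_corr r b ((tree_map r b ^^ m) B)"
      using a(1) m by (intro star_corr_mono[OF b(1)]) auto
    also have "\<dots> = ball_exp r b (1 + m) (\<lambda>_. B) (star_obs r)"
      by (simp only: ball_exp_star_const ball_exp_decimate_const[OF order_refl local_on_star_obs[OF order_refl]])
    finally show ?thesis by (intro exI[of _ "1 + m"]) simp
  qed
  then show ?thesis using b(1,2) by blast
qed

section \<open>The Ising model over a permutation representation\<close>

text \<open>Each edge is counted from both ends, hence the factor \<open>\<beta> / 2\<close> in
  \<open>graph_weight\<close>; on spin configurations a loop contributes a constant.\<close>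

definition graph_energy :: "nat \<Rightarrow> nat \<Rightarrow> (word \<Rightarrow> nat \<Rightarrow> nat) \<Rightarrow> (nat \<Rightarrow> real) \<Rightarrow> real" where
  "graph_energy r n \<tau> x = (\<Sum>u\<in>{1..n}. \<Sum>a\<in>letters r. x u * x (\<tau> [a] u))"

definition graph_weight :: "nat \<Rightarrow> nat \<Rightarrow> (word \<Rightarrow> nat \<Rightarrow> nat) \<Rightarrow> real \<Rightarrow> real \<Rightarrow> (nat \<Rightarrow> real) \<Rightarrow> real" where
  "graph_weight r n \<tau> \<beta> B x = exp (\<beta> / 2 * graph_energy r n \<tau> x + B * (\<Sum>u\<in>{1..n}. x u))"

definition graph_exp ::
  "nat \<Rightarrow> nat \<Rightarrow> (word \<Rightarrow> nat \<Rightarrow> nat) \<Rightarrow> real \<Rightarrow> real \<Rightarrow> ((nat \<Rightarrow> real) \<Rightarrow> real) \<Rightarrow> real" where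
  "graph_exp r n \<tau> \<beta> B F = ssum {1..n} (\<lambda>x. F x * graph_weight r n \<tau> \<beta> B x) /
     ssum {1..n} (graph_weight r n \<tau> \<beta> B)"

definition good :: "nat \<Rightarrow> nat \<Rightarrow> (word \<Rightarrow> nat \<Rightarrow> nat) \<Rightarrow> nat \<Rightarrow> nat set" where
  "good r n \<tau> R = {v \<in> {1..n}. inj_on (\<lambda>w. \<tau> w v) (word_ball r R)}"

lemma graph_weight_pos [simp]: "0 < graph_weight r n \<tau> \<beta> B x"
  by (simp add: graph_weight_def)

lemma graph_Z_pos: "0 < ssum {1..n} (graph_weight r n \<tau> \<beta> B)"
  by (intro ssum_pos) auto

lemma graph_exp_add:
  "graph_exp r n \<tau> \<beta> B (\<lambda>x. F x + G x) = graph_exp r n \<tau> \<beta> B F + graph_exp r n \<tau> \<beta> B G"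
  by (simp add: graph_exp_def ssum_add distrib_right add_divide_distrib)

lemma graph_exp_cmult: "graph_exp r n \<tau> \<beta> B (\<lambda>x. c * F x) = c * graph_exp r n \<tau> \<beta> B F"
  by (simp add: graph_exp_def ssum_mult_left mult.assoc)

lemma graph_exp_const: "graph_exp r n \<tau> \<beta> B (\<lambda>_. c) = c"
  using graph_Z_pos[of n r \<tau> \<beta> B] by (simp add: graph_exp_def ssum_mult_left)

lemma graph_exp_sum:
  "graph_exp r n \<tau> \<beta> B (\<lambda>x. \<Sum>i\<in>I. F i x) = (\<Sum>i\<in>I. graph_exp r n \<tau> \<beta> B (F i))"
  by (simp add: graph_exp_def ssum_sum sum_distrib_right sum_divide_distrib)

lemma graph_exp_mono:
  "(\<And>x. x \<in> {1..n} \<rightarrow>\<^sub>E spins \<Longrightarrow> F x \<le> G x) \<Longrightarrow> graph_exp r n \<tau> \<beta> B F \<le> graph_exp r n \<tau> \<beta> B G"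
  unfolding graph_exp_def using graph_Z_pos[of n r \<tau> \<beta> B]
  by (intro divide_right_mono ssum_mono mult_right_mono) (auto intro: less_imp_le)

definition local_pairs :: "nat \<Rightarrow> nat \<Rightarrow> (word \<times> (nat \<times> bool)) set" where
  "local_pairs r R = {(p, a). p \<in> word_ball r R \<and> a \<in> letters r \<and> letter_mult a p \<in> word_ball r R}"

lemma finite_local_pairs: "finite (local_pairs r R)"
proof (rule finite_subset)
  show "local_pairs r R \<subseteq> word_ball r R \<times> letters r" by (auto simp: local_pairs_def)
qed simp

section \<open>The view from a vertex with an injectively embedded ball\<close>

locale rooted_rep =
  fixes r n :: nat and \<tau> :: "word \<Rightarrow> nat \<Rightarrow> nat" and v :: nat
  assumes hom: "\<tau> \<in> perm_homs r n" and root: "v \<in> {1..n}"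
begin

lemma in_range: "w \<in> words r \<Longrightarrow> \<tau> w v \<in> {1..n}"
  using perm_hom_in[OF hom _ root] .

lemma root_eq: "\<tau> [] v = v"
  using perm_hom_Nil[OF hom] by simp

lemma letter_act: "a \<in> letters r \<Longrightarrow> w \<in> words r \<Longrightarrow> \<tau> (letter_mult a w) v = \<tau> [a] (\<tau> w v)"
  using perm_hom_letter[OF hom] by simp

lemma inj_pairs:
  assumes "inj_on (\<lambda>w. \<tau> w v) (word_ball r R)"
  shows "inj_on (\<lambda>(p, a). (\<tau> p v, a)) (local_pairs r R)"
  using assms by (auto simp: inj_on_def local_pairs_def)

lemma sum_local_pairs:
  fixes x :: "nat \<Rightarrow> real"
  assumes inj: "inj_on (\<lambda>w. \<tau> w v) (word_ball r R)"
  shows "(\<Sum>(u, a)\<in>(\<lambda>(p, a). (\<tau> p v, a)) ` local_pairs r R. x u * x (\<tau> [a] u)) =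
    2 * (\<Sum>w\<in>word_ball r R - {[]}. x (\<tau> w v) * x (\<tau> (tl w) v))"
proof -
  have "(\<Sum>(u, a)\<in>(\<lambda>(p, a). (\<tau> p v, a)) ` local_pairs r R. x u * x (\<tau> [a] u)) =
      (\<Sum>(p, a)\<in>local_pairs r R. x (\<tau> p v) * x (\<tau> (letter_mult a p) v))"
    unfolding sum.reindex[OF inj_pairs[OF inj]] comp_def
    by (intro sum.cong refl) (auto simp: local_pairs_def letter_act word_ball_in)
  also have "\<dots> = 2 * (\<Sum>w\<in>word_ball r R - {[]}. x (\<tau> w v) * x (\<tau> (tl w) v))"
    unfolding local_pairs_def using sum_oriented_edges[of "\<lambda>w. x (\<tau> w v)" r R] by simp
  finally show ?thesis .
qed

text \<open>An edge with an end in the image of the ball of radius \<open>K\<close> comes from an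
  edge of the ball of radius \<open>Suc K\<close>. This is why conditioning requires injectivity one
  layer further out.\<close>

lemma nonlocal_pair:
  assumes "(u, a) \<in> {1..n} \<times> letters r - (\<lambda>(p, a). (\<tau> p v, a)) ` local_pairs r (Suc K)"
  shows "u \<notin> (\<lambda>w. \<tau> w v) ` word_ball r K" "\<tau> [a] u \<notin> (\<lambda>w. \<tau> w v) ` word_ball r K"
proof -
  have a: "a \<in> letters r" using assms by auto
  have len: "letter_mult b p \<in> word_ball r (Suc K)" if "p \<in> word_ball r K" "b \<in> letters r" for b p
    using that length_letter_mult[of b p] letter_mult_in[of b r p] by (simp add: word_ball_def)
  have up: "p \<in> word_ball r (Suc K)" if "p \<in> word_ball r K" for p
    using that by (simp add: word_ball_def)
  have no: False if "u = \<tau> p v" "(p, a) \<in> local_pairs r (Suc K)" for p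
    using assms that by force
  show "u \<notin> (\<lambda>w. \<tau> w v) ` word_ball r K"
    using no len up a unfolding local_pairs_def by blast
  show "\<tau> [a] u \<notin> (\<lambda>w. \<tau> w v) ` word_ball r K"
  proof
    assume "\<tau> [a] u \<in> (\<lambda>w. \<tau> w v) ` word_ball r K"
    then obtain p where p: "p \<in> word_ball r K" "\<tau> [a] u = \<tau> p v" by blast
    have pw: "p \<in> words r" by (rule word_ball_in[OF p(1)])
    have a': "inv_letter a \<in> letters r" using a by simp
    have "u = \<tau> (letter_mult (inv_letter a) p) v"
      using perm_hom_inv_letter[OF hom a, of u] letter_act[OF a' pw] p(2) by simp
    moreover have "(letter_mult (inv_letter a) p, a) \<in> local_pairs r (Suc K)"
      unfolding local_pairs_def using len[OF p(1) a'] up[OF p(1)] a letter_mult_inv'[OF pw, of a] by simp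
    ultimately show False by (rule no)
  qed
qed

lemma image_ball_subset: "(\<lambda>w. \<tau> w v) ` word_ball r K \<subseteq> {1..n}"
  using in_range word_ball_in by blast

text \<open>Conditioning on the spins outside the image of the ball: the conditional law on the ball
  is an Ising model with the fields that the spins on the next sphere exert.\<close>

lemma nonneg_if_ball_exp_nonneg:
  assumes \<beta>: "\<beta> > 0" and k: "k \<ge> 1"
    and inj: "inj_on (\<lambda>w. \<tau> w v) (word_ball r (Suc (k + m)))"
    and G: "local_on (word_ball r k) G"
    and nonneg: "\<And>h. \<forall>w\<in>word_sphere r k. \<bar>h w\<bar> \<le> field_bound r \<beta> m \<Longrightarrow> 0 \<le> ball_exp r \<beta> k h G"
  shows "0 \<le> graph_exp r n \<tau> \<beta> 0 (\<lambda>x. G (\<lambda>w. x (\<tau> w v)))"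
proof -
  let ?T = "\<lambda>w. \<tau> w v"
  define K where "K = k + m"
  let ?I = "?T ` word_ball r K"
  define L where "L = (\<lambda>(p, a). (\<tau> p v, a)) ` local_pairs r (Suc K)"
  define N where "N = {1..n} \<times> letters r - L"
  have injK: "inj_on ?T (word_ball r (Suc K))" using inj by (simp add: K_def)
  have injK': "inj_on ?T (word_ball r K)" by (rule inj_on_subset[OF injK word_ball_mono]) simp
  have L: "L \<subseteq> {1..n} \<times> letters r"
    using in_range word_ball_in by (auto simp: L_def local_pairs_def)
  have energy: "graph_energy r n \<tau> x = 2 * (\<Sum>w\<in>word_ball r (Suc K) - {[]}. x (?T w) * x (?T (tl w))) +
      (\<Sum>(u, a)\<in>N. x u * x (\<tau> [a] u))" for x
  proof -
    have "graph_energy r n \<tau> x = (\<Sum>(u, a)\<in>{1..n} \<times> letters r. x u * x (\<tau> [a] u))"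
      by (simp add: graph_energy_def sum.cartesian_product)
    also have "\<dots> = (\<Sum>(u, a)\<in>N. x u * x (\<tau> [a] u)) + (\<Sum>(u, a)\<in>L. x u * x (\<tau> [a] u))"
      unfolding N_def by (rule sum.subset_diff[OF L]) simp
    finally show ?thesis unfolding L_def sum_local_pairs[OF injK] by simp
  qed
  have part: "{1..n} = ({1..n} - ?I) \<union> ?I" "({1..n} - ?I) \<inter> ?I = {}"
    using image_ball_subset by blast+
  have "0 \<le> ssum {1..n} (\<lambda>x. G (\<lambda>w. x (?T w)) * graph_weight r n \<tau> \<beta> 0 x)"
  proof (subst part(1), subst ssum_Un[OF part(2)], rule ssum_nonneg)
    fix y assume y: "y \<in> {1..n} - ?I \<rightarrow>\<^sub>E spins"
    define h where "h p = \<beta> * (\<Sum>w\<in>children r p. y (?T w))" for p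
    define mrg where "mrg z = (\<lambda>i. if i \<in> {1..n} - ?I then y i else (\<lambda>u\<in>?I. z (inv_into (word_ball r K) ?T u)) i)"
      for z :: "word \<Rightarrow> real"
    \<comment> \<open>Collects the edges that miss the image of the ball and so do not see
      \<open>z\<close>.\<close>
    define c where "c = exp (\<beta> / 2 * (\<Sum>(u, a)\<in>N. y u * y (\<tau> [a] u)))"
    have in_I: "mrg z (?T w) = z w" if "w \<in> word_ball r K" for z w
      using that inv_into_f_f[OF injK' that] by (simp add: mrg_def)
    have out_I: "mrg z u = y u" if "u \<in> {1..n}" "u \<notin> ?I" for z u
      using that by (simp add: mrg_def)
    have sph: "?T w \<notin> ?I" "?T w \<in> {1..n}" if w: "w \<in> word_sphere r (Suc K)" for w
    proof -
      have wb: "w \<in> word_ball r (Suc K)" "w \<notin> word_ball r K"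
        using w by (auto simp: word_sphere_def word_ball_def)
      then show "?T w \<in> {1..n}" using in_range word_ball_in by blast
      show "?T w \<notin> ?I"
      proof
        assume "?T w \<in> ?I"
        then obtain p where p: "p \<in> word_ball r K" "?T w = ?T p" by blast
        have "p \<in> word_ball r (Suc K)" using p(1) by (simp add: word_ball_def)
        then have "w = p" using inj_onD[OF injK p(2) wb(1)] by blast
        then show False using p(1) wb(2) by blast
      qed
    qed
    have N_sum: "(\<Sum>(u, a)\<in>N. mrg z u * mrg z (\<tau> [a] u)) = (\<Sum>(u, a)\<in>N. y u * y (\<tau> [a] u))" for z
    proof (intro sum.cong refl, clarify)
      fix u a assume ua: "(u, a) \<in> N"
      then have "u \<in> {1..n}" "[a] \<in> words r" by (auto simp: N_def)
      moreover have "u \<notin> ?I" "\<tau> [a] u \<notin> ?I"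
        using nonlocal_pair[of u a K] ua unfolding N_def L_def by blast+
      ultimately show "mrg z u * mrg z (\<tau> [a] u) = y u * y (\<tau> [a] u)"
        using out_I perm_hom_in[OF hom, of "[a]" u] by simp
    qed
    have weight: "graph_weight r n \<tau> \<beta> 0 (mrg z) = c * ball_weight r \<beta> K h z" for z
    proof -
      have "(\<Sum>w\<in>word_ball r (Suc K) - {[]}. mrg z (?T w) * mrg z (?T (tl w))) =
          (\<Sum>w\<in>word_ball r K - {[]}. z w * z (tl w)) + (\<Sum>w\<in>word_sphere r (Suc K). y (?T w) * z (tl w))"
      proof -
        have "(\<Sum>w\<in>word_ball r (Suc K) - {[]}. mrg z (?T w) * mrg z (?T (tl w))) =
            (\<Sum>w\<in>word_ball r K - {[]}. mrg z (?T w) * mrg z (?T (tl w))) +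
            (\<Sum>w\<in>word_sphere r (Suc K). mrg z (?T w) * mrg z (?T (tl w)))"
          by (rule sum_ball_Suc)
        moreover have "(\<Sum>w\<in>word_ball r K - {[]}. mrg z (?T w) * mrg z (?T (tl w))) =
            (\<Sum>w\<in>word_ball r K - {[]}. z w * z (tl w))"
          by (intro sum.cong refl) (simp add: in_I tl_in_ball)
        moreover have "(\<Sum>w\<in>word_sphere r (Suc K). mrg z (?T w) * mrg z (?T (tl w))) =
            (\<Sum>w\<in>word_sphere r (Suc K). y (?T w) * z (tl w))"
        proof (intro sum.cong refl)
          fix w assume w: "w \<in> word_sphere r (Suc K)"
          have "tl w \<in> word_ball r K" using tl_in_sphere[OF w] sphere_subset_ball by blast
          then show "mrg z (?T w) * mrg z (?T (tl w)) = y (?T w) * z (tl w)"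
            using in_I out_I sph[OF w] by simp
        qed
        ultimately show ?thesis by simp
      qed
      moreover have "\<beta> * (\<Sum>w\<in>word_sphere r (Suc K). y (?T w) * z (tl w)) = (\<Sum>p\<in>word_sphere r K. h p * z p)"
      proof -
        have "(\<Sum>w\<in>word_sphere r (Suc K). y (?T w) * z (tl w)) =
            (\<Sum>p\<in>word_sphere r K. \<Sum>w\<in>children r p. y (?T w) * z p)"
          unfolding sum_sphere_Suc by (intro sum.cong refl) (simp add: children_def)
        then show ?thesis
          by (simp add: h_def sum_distrib_left sum_distrib_right mult.assoc)
      qed
      ultimately show ?thesis
        unfolding graph_weight_def energy N_sum c_def ball_weight_def
        by (simp add: exp_add[symmetric] distrib_left)
    qed
    have local: "G (\<lambda>w. mrg z (?T w)) = G z" for z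
      by (rule local_onD[OF G]) (rule in_I, simp add: K_def word_ball_def)
    \<comment> \<open>The bound is the start of \<open>field_bound\<close>, so \<open>m\<close>
      decimation steps lead to the bound in \<open>nonneg\<close>.\<close>
    have "\<bar>h p\<bar> \<le> real (2 * r - 1) * \<beta>" if p: "p \<in> word_sphere r K" for p
    proof -
      have p': "p \<in> words r" "p \<noteq> []" using p k by (auto simp: word_sphere_def K_def)
      have "\<bar>\<Sum>w\<in>children r p. y (?T w)\<bar> \<le> (\<Sum>w\<in>children r p. 1)"
      proof (rule order_trans[OF sum_abs], rule sum_mono)
        fix w assume "w \<in> children r p"
        then have "w \<in> word_sphere r (Suc K)" using children_sphere[OF p] by blast
        then have "?T w \<in> {1..n} - ?I" using sph by blast
        then show "\<bar>y (?T w)\<bar> \<le> 1" using conf_abs[OF y] by simp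
      qed
      then show ?thesis
        using \<beta> unfolding h_def abs_mult
        by (simp add: card_children[OF p'] mult.commute mult_right_mono)
    qed
    then have "\<exists>h'. (\<forall>w\<in>word_sphere r k. \<bar>h' w\<bar> \<le> (tree_map r \<beta> ^^ m) (real (2 * r - 1) * \<beta>)) \<and>
      (\<forall>F. local_on (word_ball r k) F \<longrightarrow> ball_exp r \<beta> (k + m) h F = ball_exp r \<beta> k h' F)"
      by (intro ball_exp_decimate_bounded \<beta> k) (simp only: K_def)
    then have G_nonneg: "0 \<le> ball_exp r \<beta> K h G"
      using nonneg G unfolding field_bound_def K_def by metis
    have "ssum ?I (\<lambda>z. G (\<lambda>w. (\<lambda>i. if i \<in> {1..n} - ?I then y i else z i) (?T w)) *
        graph_weight r n \<tau> \<beta> 0 (\<lambda>i. if i \<in> {1..n} - ?I then y i else z i)) =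
      ssum (word_ball r K) (\<lambda>z. G (\<lambda>w. mrg z (?T w)) * graph_weight r n \<tau> \<beta> 0 (mrg z))"
      unfolding ssum_reindex[OF injK'] mrg_def ..
    also have "\<dots> = c * ssum (word_ball r K) (\<lambda>z. G z * ball_weight r \<beta> K h z)"
      unfolding local weight ssum_mult_left[symmetric] by (simp only: mult_ac)
    also have "\<dots> = c * (ball_exp r \<beta> K h G * ssum (word_ball r K) (ball_weight r \<beta> K h))"
      by (simp add: ball_exp_def)
    also have "\<dots> \<ge> 0"
      using G_nonneg less_imp_le[OF ball_Z_pos] by (intro mult_nonneg_nonneg) (simp_all add: c_def)
    finally show "0 \<le> ssum ?I (\<lambda>z. G (\<lambda>w. (\<lambda>i. if i \<in> {1..n} - ?I then y i else z i) (?T w)) *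
        graph_weight r n \<tau> \<beta> 0 (\<lambda>i. if i \<in> {1..n} - ?I then y i else z i))" .
  qed
  then show ?thesis
    unfolding graph_exp_def using graph_Z_pos[of n r \<tau> \<beta> 0] by simp
qed

text \<open>The spins outside the image of the ball contribute only their number of configurations,
  a constant that cancels in quotients.\<close>

lemma ssum_local:
  assumes inj: "inj_on (\<lambda>w. \<tau> w v) (word_ball r R)"
  shows "\<exists>c>0. \<forall>G. local_on (word_ball r R) G \<longrightarrow>
    ssum {1..n} (\<lambda>x. G (\<lambda>w. x (\<tau> w v))) = c * ssum (word_ball r R) G"
proof (intro exI[of _ "ssum ({1..n} - (\<lambda>w. \<tau> w v) ` word_ball r R) (\<lambda>_. 1)"] conjI allI impI)
  let ?T = "\<lambda>w. \<tau> w v"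
  let ?I = "?T ` word_ball r R"
  show "0 < ssum ({1..n} - ?I) (\<lambda>_. 1)" by (intro ssum_pos) auto
  fix G :: "(word \<Rightarrow> real) \<Rightarrow> real" assume G: "local_on (word_ball r R) G"
  have part: "{1..n} = ({1..n} - ?I) \<union> ?I" "({1..n} - ?I) \<inter> ?I = {}"
    using image_ball_subset by blast+
  have "ssum {1..n} (\<lambda>x. G (\<lambda>w. x (?T w))) = ssum (({1..n} - ?I) \<union> ?I) (\<lambda>x. G (\<lambda>w. x (?T w)))"
    using part(1) by simp
  also have "\<dots> = ssum ({1..n} - ?I) (\<lambda>y. 1 * ssum (word_ball r R) G)"
    unfolding ssum_Un[OF part(2)] ssum_reindex[OF inj] mult_1
  proof (intro ssum_cong local_onD[OF G])
    fix y z w assume "w \<in> word_ball r R"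
    then show "(if ?T w \<in> {1..n} - ?I then y (?T w) else (\<lambda>u\<in>?I. z (inv_into (word_ball r R) ?T u)) (?T w)) = z w"
      using inv_into_f_f[OF inj] by simp
  qed
  also have "\<dots> = ssum ({1..n} - ?I) (\<lambda>y. 1) * ssum (word_ball r R) G"
    by (rule ssum_mult_right)
  finally show "ssum {1..n} (\<lambda>x. G (\<lambda>w. x (?T w))) = ssum ({1..n} - ?I) (\<lambda>_. 1) * ssum (word_ball r R) G" .
qed

end

text \<open>For a loop the product \<open>x u * x u\<close> is 1, hence the empty set rather than
  \<open>{u}\<close>. Terms are indexed by a vertex and a letter, so parallel edges remain separate
  terms.\<close>

definition term_set :: "(word \<Rightarrow> nat \<Rightarrow> nat) \<Rightarrow> (nat \<times> nat \<times> bool) + nat \<Rightarrow> nat set" where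
  "term_set \<tau> k = (case k of Inl (u, a) \<Rightarrow> (if u = \<tau> [a] u then {} else {u, \<tau> [a] u}) | Inr u \<Rightarrow> {u})"

definition coupling :: "real \<Rightarrow> real \<Rightarrow> (nat \<times> nat \<times> bool) + nat \<Rightarrow> real" where
  "coupling \<beta> B k = (case k of Inl _ \<Rightarrow> \<beta> / 2 | Inr _ \<Rightarrow> B)"

definition all_terms :: "nat \<Rightarrow> nat \<Rightarrow> ((nat \<times> nat \<times> bool) + nat) set" where
  "all_terms r n = Inl ` ({1..n} \<times> letters r) \<union> Inr ` {1..n}"

lemma finite_all_terms: "finite (all_terms r n)"
  by (simp add: all_terms_def)

lemma term_set_subset:
  assumes "\<tau> \<in> perm_homs r n" "k \<in> all_terms r n"
  shows "term_set \<tau> k \<subseteq> {1..n}"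
proof -
  have "\<tau> [a] u \<in> {1..n}" if "a \<in> letters r" "u \<in> {1..n}" for a u
    using perm_hom_in[OF assms(1), of "[a]" u] that by simp
  then show ?thesis
    using assms(2) unfolding all_terms_def term_set_def by (auto simp del: atLeastAtMost_iff split: if_splits)
qed

lemma chi_Inl:
  assumes "x \<in> {1..n} \<rightarrow>\<^sub>E spins" "u \<in> {1..n}"
  shows "chi (term_set \<tau> (Inl (u, a))) x = x u * x (\<tau> [a] u)"
  using conf_sq[OF assms] by (auto simp: chi_def term_set_def)

lemma chi_Inr: "chi (term_set \<tau> (Inr u)) x = x u"
  by (simp add: chi_def term_set_def)

lemma sum_terms:
  assumes "x \<in> {1..n} \<rightarrow>\<^sub>E spins" "finite P" "finite Q" "fst ` P \<subseteq> {1..n}"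
  shows "(\<Sum>k\<in>Inl ` P \<union> Inr ` Q. coupling \<beta> B k * chi (term_set \<tau> k) x) =
    \<beta> / 2 * (\<Sum>(u, a)\<in>P. x u * x (\<tau> [a] u)) + B * (\<Sum>u\<in>Q. x u)"
proof -
  have "(\<Sum>k\<in>Inl ` P \<union> Inr ` Q. coupling \<beta> B k * chi (term_set \<tau> k) x) =
      (\<Sum>k\<in>Inl ` P. coupling \<beta> B k * chi (term_set \<tau> k) x) +
      (\<Sum>k\<in>Inr ` Q. coupling \<beta> B k * chi (term_set \<tau> k) x)"
    using assms(2,3) by (intro sum.union_disjoint) auto
  also have "(\<Sum>k\<in>Inl ` P. coupling \<beta> B k * chi (term_set \<tau> k) x) = (\<Sum>(u, a)\<in>P. \<beta> / 2 * (x u * x (\<tau> [a] u)))"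
    unfolding sum.reindex[OF inj_Inl] comp_def
  proof (intro sum.cong refl, clarify)
    fix u a b assume "(u, a, b) \<in> P"
    then have "u \<in> {1..n}" using assms(4) by force
    then show "coupling \<beta> B (Inl (u, a, b)) * chi (term_set \<tau> (Inl (u, a, b))) x = \<beta> / 2 * (x u * x (\<tau> [(a, b)] u))"
      using chi_Inl[OF assms(1)] by (simp add: coupling_def)
  qed
  also have "\<dots> = \<beta> / 2 * (\<Sum>(u, a)\<in>P. x u * x (\<tau> [a] u))"
    by (simp add: sum_distrib_left case_prod_unfold)
  also have "(\<Sum>k\<in>Inr ` Q. coupling \<beta> B k * chi (term_set \<tau> k) x) = B * (\<Sum>u\<in>Q. x u)"
    unfolding sum.reindex[OF inj_Inr] comp_def by (simp add: coupling_def chi_Inr sum_distrib_left)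
  finally show ?thesis .
qed

lemma graph_weight_terms:
  assumes "x \<in> {1..n} \<rightarrow>\<^sub>E spins"
  shows "graph_weight r n \<tau> \<beta> B x = exp (\<Sum>k\<in>all_terms r n. coupling \<beta> B k * chi (term_set \<tau> k) x)"
  using sum_terms[OF assms, of "{1..n} \<times> letters r" "{1..n}" \<beta> B \<tau>]
  by (simp add: graph_weight_def all_terms_def graph_energy_def sum.cartesian_product)

lemma graph_exp_pair_nonneg:
  assumes "\<tau> \<in> perm_homs r n" "\<beta> \<ge> 0" "B \<ge> 0" "u \<in> {1..n}" "a \<in> letters r"
  shows "0 \<le> graph_exp r n \<tau> \<beta> B (\<lambda>x. x u * x (\<tau> [a] u))"
proof -
  have "Inl (u, a) \<in> all_terms r n" using assms(4,5) by (simp add: all_terms_def)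
  then have A: "term_set \<tau> (Inl (u, a)) \<subseteq> {1..n}" by (rule term_set_subset[OF assms(1)])
  have "ssum {1..n} (\<lambda>x. x u * x (\<tau> [a] u) * graph_weight r n \<tau> \<beta> B x) =
      ssum {1..n} (\<lambda>x. chi (term_set \<tau> (Inl (u, a))) x *
        exp (\<Sum>k\<in>all_terms r n. coupling \<beta> B k * chi (term_set \<tau> k) x))"
    by (intro ssum_cong) (simp only: graph_weight_terms chi_Inl[OF _ assms(4)])
  also have "\<dots> \<ge> 0"
    using assms(2,3) term_set_subset[OF assms(1)]
    by (intro griffiths_first finite_all_terms A) (auto simp: coupling_def split: sum.splits)
  finally show ?thesis
    unfolding graph_exp_def using graph_Z_pos[of n r \<tau> \<beta> B] by simp
qed

context rooted_rep
begin

text \<open>Keeping only the couplings inside the image of the ball and the fields on the image of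
  its sphere leaves, by injectivity, the ball model. All other couplings and fields are
  non-negative, so by Griffiths restoring them cannot lower the correlation.\<close>

lemma ball_exp_le_graph_exp:
  assumes inj: "inj_on (\<lambda>w. \<tau> w v) (word_ball r R)" and R: "R \<ge> 1" and \<beta>: "\<beta> \<ge> 0" and B: "B \<ge> 0"
    and s: "s \<in> word_sphere r 1"
  shows "ball_exp r \<beta> R (\<lambda>_. B) (\<lambda>z. z [] * z s) \<le> graph_exp r n \<tau> \<beta> B (\<lambda>x. x v * x (\<tau> s v))"
proof -
  let ?T = "\<lambda>w. \<tau> w v"
  define P where "P = (\<lambda>(p, a). (\<tau> p v, a)) ` local_pairs r R"
  define Q where "Q = ?T ` word_sphere r R"
  define K where "K = Inl ` P \<union> Inr ` Q"
  have sR: "s \<in> word_ball r R" using s R by (simp add: word_sphere_def word_ball_def)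
  have fin: "finite P" "finite Q" by (simp_all add: P_def Q_def finite_local_pairs)
  have P: "P \<subseteq> {1..n} \<times> letters r"
    using in_range word_ball_in by (auto simp: P_def local_pairs_def)
  have Q: "Q \<subseteq> {1..n}" using image_ball_subset sphere_subset_ball unfolding Q_def by blast
  have K: "K \<subseteq> all_terms r n" using P Q unfolding K_def all_terms_def by blast
  then have K_Un: "K \<union> (all_terms r n - K) = all_terms r n" by blast
  have neq: "v \<noteq> ?T s"
  proof
    assume "v = ?T s"
    then have "?T [] = ?T s" by (simp add: root_eq)
    then have "[] = s" using inj_onD[OF inj _ Nil_in_ball sR] by blast
    then show False using s by (simp add: word_sphere_def)
  qed
  have A: "{v, ?T s} \<subseteq> {1..n}" using root image_ball_subset sR by blast
  have chiA: "chi {v, ?T s} x = x v * x (?T s)" for x :: "nat \<Rightarrow> real"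
    using neq by (simp add: chi_def)
  have w: "exp (\<Sum>k\<in>K. coupling \<beta> B k * chi (term_set \<tau> k) x) = ball_weight r \<beta> R (\<lambda>_. B) (\<lambda>w. x (?T w))"
    if x: "x \<in> {1..n} \<rightarrow>\<^sub>E spins" for x
  proof -
    have P1: "fst ` P \<subseteq> {1..n}" using P by force
    have "(\<Sum>k\<in>K. coupling \<beta> B k * chi (term_set \<tau> k) x) =
        \<beta> / 2 * (2 * (\<Sum>w\<in>word_ball r R - {[]}. x (?T w) * x (?T (tl w)))) + B * (\<Sum>u\<in>Q. x u)"
      unfolding K_def sum_terms[OF x fin P1] unfolding P_def sum_local_pairs[OF inj] by (rule refl)
    also have "(\<Sum>u\<in>Q. x u) = (\<Sum>w\<in>word_sphere r R. x (?T w))"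
      unfolding Q_def by (subst sum.reindex[OF inj_on_subset[OF inj sphere_subset_ball]]) simp
    finally show ?thesis by (simp add: ball_weight_def sum_distrib_left)
  qed
  obtain c where c: "c > 0" "\<forall>G. local_on (word_ball r R) G \<longrightarrow>
    ssum {1..n} (\<lambda>x. G (\<lambda>w. x (\<tau> w v))) = c * ssum (word_ball r R) G"
    using ssum_local[OF inj] by (elim exE conjE)
  have loc: "local_on (word_ball r R) (ball_weight r \<beta> R (\<lambda>_. B))"
    unfolding local_on_def
  proof (intro allI impI)
    fix z z' :: "word \<Rightarrow> real" assume eq: "\<forall>w\<in>word_ball r R. z w = z' w"
    have "(\<Sum>w\<in>word_ball r R - {[]}. z w * z (tl w)) = (\<Sum>w\<in>word_ball r R - {[]}. z' w * z' (tl w))"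
      using eq by (intro sum.cong refl) (simp add: tl_in_ball)
    moreover have "(\<Sum>w\<in>word_sphere r R. B * z w) = (\<Sum>w\<in>word_sphere r R. B * z' w)"
      using eq sphere_subset_ball by (intro sum.cong refl) (metis subsetD)
    ultimately show "ball_weight r \<beta> R (\<lambda>_. B) z = ball_weight r \<beta> R (\<lambda>_. B) z'"
      by (simp only: ball_weight_def)
  qed
  have loc': "local_on (word_ball r R) (\<lambda>z. z [] * z s * ball_weight r \<beta> R (\<lambda>_. B) z)"
    using loc sR Nil_in_ball unfolding local_on_def by metis
  have "ball_exp r \<beta> R (\<lambda>_. B) (\<lambda>z. z [] * z s) =
      ssum {1..n} (\<lambda>x. x (?T []) * x (?T s) * ball_weight r \<beta> R (\<lambda>_. B) (\<lambda>w. x (?T w))) /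
      ssum {1..n} (\<lambda>x. ball_weight r \<beta> R (\<lambda>_. B) (\<lambda>w. x (?T w)))"
    unfolding ball_exp_def mp[OF spec[OF c(2)] loc] mp[OF spec[OF c(2)] loc'] using c(1) by simp
  also have "\<dots> = ssum {1..n} (\<lambda>x. chi {v, ?T s} x * exp (\<Sum>k\<in>K. coupling \<beta> B k * chi (term_set \<tau> k) x)) /
      ssum {1..n} (\<lambda>x. exp (\<Sum>k\<in>K. coupling \<beta> B k * chi (term_set \<tau> k) x))"
    unfolding chiA root_eq by (intro arg_cong2[where f = "(/)"] ssum_cong) (simp_all only: w)
  also have "\<dots> \<le> ssum {1..n} (\<lambda>x. chi {v, ?T s} x * exp (\<Sum>k\<in>K \<union> (all_terms r n - K). coupling \<beta> B k * chi (term_set \<tau> k) x)) /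
      ssum {1..n} (\<lambda>x. exp (\<Sum>k\<in>K \<union> (all_terms r n - K). coupling \<beta> B k * chi (term_set \<tau> k) x))"
  proof (rule griffiths_mono)
    show "finite K" using K finite_all_terms finite_subset by blast
    show "term_set \<tau> k \<subseteq> {1..n}" if "k \<in> K \<union> (all_terms r n - K)" for k
      using that term_set_subset[OF hom] unfolding K_Un by blast
    show "0 \<le> coupling \<beta> B k" for k
      using \<beta> B by (simp add: coupling_def split: sum.split)
  qed (use A finite_all_terms in auto)
  also have "\<dots> = graph_exp r n \<tau> \<beta> B (\<lambda>x. x v * x (?T s))"
    unfolding K_Un graph_exp_def chiA
    by (intro arg_cong2[where f = "(/)"] ssum_cong) (simp_all only: graph_weight_terms)
  finally show ?thesis .
qed

end

section \<open>The energy per vertex\<close>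

text \<open>Jensen's inequality for the exponential, from its tangent at the mean
  \<open>m\<close>.\<close>

lemma exp_mean_le:
  fixes w E :: "('a \<Rightarrow> real) \<Rightarrow> real"
  assumes "finite V" "\<And>x. 0 < w x"
  shows "exp (t * (ssum V (\<lambda>x. E x * w x) / ssum V w)) * ssum V w \<le> ssum V (\<lambda>x. exp (t * E x) * w x)"
proof -
  define m where "m = ssum V (\<lambda>x. E x * w x) / ssum V w"
  have Z: "0 < ssum V w" by (intro ssum_pos assms)
  have "ssum V (\<lambda>x. exp (t * m) * (1 - t * m) * w x + exp (t * m) * t * (E x * w x)) =
      exp (t * m) * (1 - t * m) * ssum V w + exp (t * m) * t * ssum V (\<lambda>x. E x * w x)"
    by (simp only: ssum_add ssum_mult_left)
  also have "ssum V (\<lambda>x. E x * w x) = m * ssum V w"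
    using Z by (simp add: m_def)
  also have "exp (t * m) * (1 - t * m) * ssum V w + exp (t * m) * t * (m * ssum V w) = exp (t * m) * ssum V w"
    by (simp add: algebra_simps)
  finally have eq: "exp (t * m) * ssum V w =
      ssum V (\<lambda>x. exp (t * m) * (1 - t * m) * w x + exp (t * m) * t * (E x * w x))" ..
  show ?thesis
    unfolding m_def[symmetric] eq
  proof (rule ssum_mono)
    fix x
    have "exp (t * m) * (1 + (t * E x - t * m)) \<le> exp (t * m) * exp (t * E x - t * m)"
      by (intro mult_left_mono exp_ge_add_one_self) simp
    also have "\<dots> = exp (t * E x)" by (simp add: exp_add[symmetric])
    finally have "exp (t * m) * (1 + (t * E x - t * m)) * w x \<le> exp (t * E x) * w x"
      using assms(2)[of x] by (intro mult_right_mono) auto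
    then show "exp (t * m) * (1 - t * m) * w x + exp (t * m) * t * (E x * w x) \<le> exp (t * E x) * w x"
      by (simp add: algebra_simps)
  qed
qed

text \<open>Convexity of the free energy in \<open>\<beta>\<close>; switching the field off costs at most \<open>2 B n\<close>
  on the logarithmic scale.\<close>

lemma energy_comparison:
  assumes "\<beta>' < \<beta>" "B \<ge> 0"
  shows "graph_exp r n \<tau> \<beta>' B (graph_energy r n \<tau>) - 4 * B * real n / (\<beta> - \<beta>')
    \<le> graph_exp r n \<tau> \<beta> 0 (graph_energy r n \<tau>)"
proof -
  let ?E = "graph_energy r n \<tau>" and ?V = "{1..n}"
  \<comment> \<open>Half the gap, because the energy enters the weight with the factor
    \<open>\<beta> / 2\<close>.\<close>
  define t where "t = (\<beta> - \<beta>') / 2"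
  have t: "t > 0" using assms(1) by (simp add: t_def)
  have b: "\<beta>' + 2 * t = \<beta>" "\<beta> + 2 * (- t) = \<beta>'" by (simp_all add: t_def field_simps)
  define Z where "Z \<beta> B = ssum ?V (graph_weight r n \<tau> \<beta> B)" for \<beta> B
  have Z: "0 < Z b c" for b c unfolding Z_def by (rule graph_Z_pos)
  have shift: "exp (s * ?E x) * graph_weight r n \<tau> b c x = graph_weight r n \<tau> (b + 2 * s) c x" for s b c x
    by (simp add: graph_weight_def exp_add[symmetric] algebra_simps add_divide_distrib)
  have 1: "exp (t * graph_exp r n \<tau> \<beta>' B ?E) * Z \<beta>' B \<le> Z \<beta> B"
    using exp_mean_le[of ?V "graph_weight r n \<tau> \<beta>' B" t ?E]
    unfolding shift Z_def graph_exp_def b by simp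
  have 2: "exp (- t * graph_exp r n \<tau> \<beta> 0 ?E) * Z \<beta> 0 \<le> Z \<beta>' 0"
    using exp_mean_le[of ?V "graph_weight r n \<tau> \<beta> 0" "- t" ?E]
    unfolding shift Z_def graph_exp_def b by simp
  have M: "\<bar>\<Sum>u\<in>?V. x u\<bar> \<le> real n" if "x \<in> ?V \<rightarrow>\<^sub>E spins" for x :: "nat \<Rightarrow> real"
  proof -
    have "\<bar>\<Sum>u\<in>?V. x u\<bar> \<le> (\<Sum>u\<in>?V. 1)"
      using conf_abs[OF that] by (intro order_trans[OF sum_abs] sum_mono) simp
    then show ?thesis by simp
  qed
  have field: "graph_weight r n \<tau> b B x = exp (B * (\<Sum>u\<in>?V. x u)) * graph_weight r n \<tau> b 0 x" for b x
    by (simp add: graph_weight_def exp_add[symmetric] add.commute)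
  have 3: "Z \<beta> B \<le> exp (B * real n) * Z \<beta> 0"
    unfolding Z_def ssum_mult_left[symmetric]
  proof (rule ssum_mono)
    fix x :: "nat \<Rightarrow> real" assume x: "x \<in> ?V \<rightarrow>\<^sub>E spins"
    have "B * (\<Sum>u\<in>?V. x u) \<le> B * real n" using M[OF x] assms(2) by (intro mult_left_mono) auto
    then show "graph_weight r n \<tau> \<beta> B x \<le> exp (B * real n) * graph_weight r n \<tau> \<beta> 0 x"
      unfolding field[of \<beta>] by (intro mult_right_mono) (auto intro: less_imp_le)
  qed
  have 4: "exp (- (B * real n)) * Z \<beta>' 0 \<le> Z \<beta>' B"
    unfolding Z_def ssum_mult_left[symmetric]
  proof (rule ssum_mono)
    fix x :: "nat \<Rightarrow> real" assume x: "x \<in> ?V \<rightarrow>\<^sub>E spins"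
    have "B * - real n \<le> B * (\<Sum>u\<in>?V. x u)" using M[OF x] assms(2) by (intro mult_left_mono) auto
    then show "exp (- (B * real n)) * graph_weight r n \<tau> \<beta>' 0 x \<le> graph_weight r n \<tau> \<beta>' B x"
      unfolding field[of \<beta>'] by (intro mult_right_mono) (auto intro: less_imp_le)
  qed
  \<comment> \<open>Jensen at \<open>(\<beta>', B)\<close> and at \<open>(\<beta>, 0)\<close>,
    together with the removal of the field at both temperatures, gives a chain from
    \<open>Z \<beta> 0\<close> to itself. Cancelling it leaves \<open>t\<close> times the energy
    difference bounded by \<open>2 * B * n\<close>.\<close>
  have "exp (t * graph_exp r n \<tau> \<beta>' B ?E) * exp (- (B * real n)) * exp (- t * graph_exp r n \<tau> \<beta> 0 ?E) * Z \<beta> 0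
      \<le> exp (t * graph_exp r n \<tau> \<beta>' B ?E) * exp (- (B * real n)) * Z \<beta>' 0"
    using mult_left_mono[OF 2, of "exp (t * graph_exp r n \<tau> \<beta>' B ?E) * exp (- (B * real n))"]
    by (simp add: mult.assoc)
  also have "\<dots> \<le> exp (t * graph_exp r n \<tau> \<beta>' B ?E) * Z \<beta>' B"
    using mult_left_mono[OF 4, of "exp (t * graph_exp r n \<tau> \<beta>' B ?E)"] by (simp add: mult.assoc)
  also note 1
  also note 3
  finally have "exp (t * graph_exp r n \<tau> \<beta>' B ?E) * exp (- (B * real n)) * exp (- t * graph_exp r n \<tau> \<beta> 0 ?E)
      \<le> exp (B * real n)"
    using Z[of \<beta> 0] by simp
  then have "t * graph_exp r n \<tau> \<beta>' B ?E - B * real n - t * graph_exp r n \<tau> \<beta> 0 ?E \<le> B * real n"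
    by (simp add: exp_add[symmetric])
  then have "graph_exp r n \<tau> \<beta>' B ?E - 2 * B * real n / t \<le> graph_exp r n \<tau> \<beta> 0 ?E"
    using t by (simp add: field_simps)
  then show ?thesis by (simp add: t_def)
qed

lemma star_obs_view:
  assumes "\<tau> \<in> perm_homs r n"
  shows "star_obs r (\<lambda>w. x (\<tau> w v)) = (\<Sum>a\<in>letters r. x v * x (\<tau> [a] v))"
  unfolding star_obs_def sphere_1
  by (subst sum.reindex) (simp_all add: inj_on_def perm_hom_Nil[OF assms])

lemma graph_energy_view:
  assumes "\<tau> \<in> perm_homs r n"
  shows "graph_energy r n \<tau> = (\<lambda>x. \<Sum>v\<in>{1..n}. star_obs r (\<lambda>w. x (\<tau> w v)))"
  by (simp add: fun_eq_iff graph_energy_def star_obs_view[OF assms])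

lemma good_mono: "R \<le> R' \<Longrightarrow> good r n \<tau> R' \<subseteq> good r n \<tau> R"
proof -
  assume "R \<le> R'"
  then have "word_ball r R \<subseteq> word_ball r R'" by (rule word_ball_mono)
  then show ?thesis unfolding good_def using inj_on_subset by blast
qed

lemma finite_good [simp]: "finite (good r n \<tau> R)"
  by (simp add: good_def)

lemma card_good_le: "card (good r n \<tau> R) \<le> n"
proof -
  have "good r n \<tau> R \<subseteq> {1..n}" unfolding good_def by blast
  from card_mono[OF finite_atLeastAtMost this] show ?thesis by simp
qed

lemma ball_star_le_graph:
  assumes "\<tau> \<in> perm_homs r n" "v \<in> good r n \<tau> R" "R \<ge> 1" "\<beta> \<ge> 0" "B \<ge> 0"
  shows "ball_exp r \<beta> R (\<lambda>_. B) (star_obs r) \<le> graph_exp r n \<tau> \<beta> B (\<lambda>x. star_obs r (\<lambda>w. x (\<tau> w v)))"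
proof -
  interpret rooted_rep r n \<tau> v
    using assms(1,2) by unfold_locales (simp_all add: good_def)
  have inj: "inj_on (\<lambda>w. \<tau> w v) (word_ball r R)" using assms(2) by (simp add: good_def)
  have "ball_exp r \<beta> R (\<lambda>_. B) (star_obs r) = (\<Sum>s\<in>word_sphere r 1. ball_exp r \<beta> R (\<lambda>_. B) (\<lambda>z. z [] * z s))"
    unfolding star_obs_def[abs_def] by (rule ball_exp_sum)
  also have "\<dots> \<le> (\<Sum>s\<in>word_sphere r 1. graph_exp r n \<tau> \<beta> B (\<lambda>x. x v * x (\<tau> s v)))"
    by (intro sum_mono ball_exp_le_graph_exp[OF inj assms(3,4,5)])
  also have "\<dots> = graph_exp r n \<tau> \<beta> B (\<lambda>x. star_obs r (\<lambda>w. x (\<tau> w v)))"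
    unfolding star_obs_def root_eq by (rule graph_exp_sum[symmetric])
  finally show ?thesis .
qed

lemma graph_star_nonneg:
  assumes "\<tau> \<in> perm_homs r n" "v \<in> {1..n}" "\<beta> \<ge> 0" "B \<ge> 0"
  shows "0 \<le> graph_exp r n \<tau> \<beta> B (\<lambda>x. star_obs r (\<lambda>w. x (\<tau> w v)))"
  unfolding star_obs_view[OF assms(1)] graph_exp_sum
  by (intro sum_nonneg graph_exp_pair_nonneg assms)

text \<open>The other vertices contribute a non-negative amount by the first Griffiths inequality
  and may be dropped.\<close>

lemma good_energy:
  assumes "\<tau> \<in> perm_homs r n" "1 \<le> R" "R \<le> R'" "\<beta> \<ge> 0" "B \<ge> 0"
    and "S \<le> ball_exp r \<beta> R (\<lambda>_. B) (star_obs r)"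
  shows "real (card (good r n \<tau> R')) * S \<le> graph_exp r n \<tau> \<beta> B (graph_energy r n \<tau>)"
proof -
  let ?g = "\<lambda>v. graph_exp r n \<tau> \<beta> B (\<lambda>x. star_obs r (\<lambda>w. x (\<tau> w v)))"
  have "real (card (good r n \<tau> R')) * S = (\<Sum>v\<in>good r n \<tau> R'. S)" by simp
  also have "\<dots> \<le> (\<Sum>v\<in>good r n \<tau> R'. ?g v)"
  proof (rule sum_mono)
    fix v assume "v \<in> good r n \<tau> R'"
    then have "v \<in> good r n \<tau> R" by (rule subsetD[OF good_mono[OF assms(3)]])
    from order_trans[OF assms(6) ball_star_le_graph[OF assms(1) this assms(2,4,5)]] show "S \<le> ?g v" .
  qed
  also have "\<dots> \<le> (\<Sum>v\<in>{1..n}. ?g v)"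
  proof (rule sum_mono2)
    show "good r n \<tau> R' \<subseteq> {1..n}" unfolding good_def by blast
    show "0 \<le> ?g v" if "v \<in> {1..n} - good r n \<tau> R'" for v
      using that by (intro graph_star_nonneg[OF assms(1) _ assms(4,5)]) blast
  qed simp
  also have "\<dots> = graph_exp r n \<tau> \<beta> B (graph_energy r n \<tau>)"
    unfolding graph_energy_view[OF assms(1)] by (rule graph_exp_sum[symmetric])
  finally show ?thesis .
qed

text \<open>The radius may be enlarged to any \<open>R'\<close>, since it will also have to make
  room for the decimation steps.\<close>

lemma energy_lower_bound:
  assumes "\<beta> > 0" "\<epsilon> > 0"
  shows "\<exists>R. \<forall>n \<tau>. \<forall>R'::nat. \<tau> \<in> perm_homs r n \<longrightarrow> R \<le> R' \<longrightarrow>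
    real (card (good r n \<tau> R')) * (star_corr r \<beta> (plus_field r \<beta>) - \<epsilon>) - \<epsilon> * real n
      \<le> graph_exp r n \<tau> \<beta> 0 (graph_energy r n \<tau>)"
proof (cases "plus_field r \<beta> > 0")
  case True
  let ?S = "star_corr r \<beta> (plus_field r \<beta>) - \<epsilon>"
  obtain \<beta>' where \<beta>': "0 < \<beta>'" "\<beta>' < \<beta>" "\<forall>B>0. \<exists>R\<ge>1. ?S \<le> ball_exp r \<beta>' R (\<lambda>_. B) (star_obs r)"
    using free_star_lower_bound[OF assms(1) True assms(2)] by blast
  \<comment> \<open>Makes the error \<open>4 * B * n / (\<beta> - \<beta>')\<close> of
    \<open>energy_comparison\<close> equal to \<open>\<epsilon> * n\<close>.\<close>
  define B where "B = \<epsilon> * (\<beta> - \<beta>') / 4"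
  have B: "B > 0" using assms(2) \<beta>'(2) by (simp add: B_def)
  obtain R where R: "R \<ge> 1" "?S \<le> ball_exp r \<beta>' R (\<lambda>_. B) (star_obs r)"
    using \<beta>'(3) B by blast
  show ?thesis
  proof (intro exI[of _ R] allI impI)
    fix n \<tau> and R' :: nat assume \<tau>: "\<tau> \<in> perm_homs r n" "R \<le> R'"
    have "real (card (good r n \<tau> R')) * ?S \<le> graph_exp r n \<tau> \<beta>' B (graph_energy r n \<tau>)"
      using \<beta>'(1) B by (intro good_energy[OF \<tau>(1) R(1) \<tau>(2) _ _ R(2)]) auto
    moreover have "graph_exp r n \<tau> \<beta>' B (graph_energy r n \<tau>) - 4 * B * real n / (\<beta> - \<beta>')
        \<le> graph_exp r n \<tau> \<beta> 0 (graph_energy r n \<tau>)"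
      using B by (intro energy_comparison \<beta>'(2)) auto
    moreover have "4 * B * real n / (\<beta> - \<beta>') = \<epsilon> * real n" using \<beta>'(2) by (simp add: B_def)
    ultimately show "real (card (good r n \<tau> R')) * ?S - \<epsilon> * real n \<le> graph_exp r n \<tau> \<beta> 0 (graph_energy r n \<tau>)"
      by linarith
  qed
next
  case False
  \<comment> \<open>Without a positive limit field, the star with zero fields at \<beta> itself
    attains the target.\<close>
  then have H: "plus_field r \<beta> = 0" using plus_field_nonneg[OF assms(1), of r] by linarith
  let ?S = "star_corr r \<beta> (plus_field r \<beta>) - \<epsilon>"
  show ?thesis
  proof (intro exI[of _ 1] allI impI)
    fix n \<tau> and R' :: nat assume \<tau>: "\<tau> \<in> perm_homs r n" "1 \<le> R'"
    have "?S \<le> ball_exp r \<beta> 1 (\<lambda>_. 0) (star_obs r)"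
      unfolding ball_exp_star_const H using assms(2) by simp
    then have "real (card (good r n \<tau> R')) * ?S \<le> graph_exp r n \<tau> \<beta> 0 (graph_energy r n \<tau>)"
      using assms(1) by (intro good_energy[OF \<tau>(1) order_refl \<tau>(2)]) auto
    moreover have "0 \<le> \<epsilon> * real n" using assms(2) by simp
    ultimately show "real (card (good r n \<tau> R')) * ?S - \<epsilon> * real n \<le> graph_exp r n \<tau> \<beta> 0 (graph_energy r n \<tau>)"
      by linarith
  qed
qed

lemma graph_star_abs:
  assumes "\<tau> \<in> perm_homs r n" "v \<in> {1..n}"
  shows "graph_exp r n \<tau> \<beta> B (\<lambda>x. star_obs r (\<lambda>w. x (\<tau> w v))) \<le> 2 * real r"
proof -
  have "graph_exp r n \<tau> \<beta> B (\<lambda>x. star_obs r (\<lambda>w. x (\<tau> w v))) \<le> graph_exp r n \<tau> \<beta> B (\<lambda>_. 2 * real r)"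
  proof (rule graph_exp_mono)
    fix x assume x: "x \<in> {1..n} \<rightarrow>\<^sub>E spins"
    have "star_obs r (\<lambda>w. x (\<tau> w v)) \<le> (\<Sum>a\<in>letters r. 1)"
      unfolding star_obs_view[OF assms(1)]
    proof (rule sum_mono)
      fix a assume "a \<in> letters r"
      then have "\<tau> [a] v \<in> {1..n}" using perm_hom_in[OF assms(1) _ assms(2)] by simp
      then show "x v * x (\<tau> [a] v) \<le> 1"
        using conf_spin[OF x assms(2)] conf_spin[OF x] by fastforce
    qed
    then show "star_obs r (\<lambda>w. x (\<tau> w v)) \<le> 2 * real r" by (simp add: card_letters)
  qed
  then show ?thesis by (simp only: graph_exp_const)
qed

section \<open>Local convergence of even observables\<close>

lemma local_on_affine:
  assumes "local_on B F" "local_on B G"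
  shows "local_on B (\<lambda>z. a + b * F z + c * G z :: real)"
  unfolding local_on_def
proof (intro allI impI)
  fix z z' :: "'a \<Rightarrow> real" assume "\<forall>w\<in>B. z w = z' w"
  then have "F z = F z'" "G z = G z'" using assms unfolding local_on_def by blast+
  then show "a + b * F z + c * G z = a + b * F z' + c * G z'" by simp
qed

lemma ball_exp_affine:
  "ball_exp r \<beta> k h (\<lambda>z. a + b * F z + c * G z) = a + b * ball_exp r \<beta> k h F + c * ball_exp r \<beta> k h G"
  by (simp add: ball_exp_add ball_exp_cmult)

lemma graph_exp_affine:
  "graph_exp r n \<tau> \<beta> B (\<lambda>x. a + b * F x + c * G x) = a + b * graph_exp r n \<tau> \<beta> B F + c * graph_exp r n \<tau> \<beta> B G"
  by (simp add: graph_exp_add graph_exp_cmult graph_exp_const)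

text \<open>At a good vertex the energy deficit is non-negative, and by
  \<open>energy_lower_bound\<close> the deficits of these vertices add up to a small multiple of
  \<open>n\<close>. By Markov's inequality few of them exceed \<eta>; at all others
  \<open>deviation_controlled_by_star\<close> gives the claim.\<close>

lemma most_vertices_near_plus:
  assumes \<beta>: "\<beta> > 0" and k: "k \<ge> 1" and F: "local_on (word_ball r k) F" "even_obs (word_ball r k) F"
    and \<delta>: "\<delta> > 0"
  shows "\<exists>R. \<exists>\<kappa>>0. \<forall>n \<tau>. \<tau> \<in> perm_homs r n \<longrightarrow> real (card (good r n \<tau> R)) \<ge> (1 - \<kappa>) * real n \<longrightarrow>
    real (card {v \<in> {1..n}. \<bar>graph_exp r n \<tau> \<beta> 0 (\<lambda>x. F (\<lambda>w. x (\<tau> w v))) -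
      ball_exp r \<beta> k (\<lambda>_. plus_field r \<beta>) F\<bar> \<le> \<delta>}) \<ge> (1 - \<delta>) * real n"
proof -
  let ?S = "star_corr r \<beta> (plus_field r \<beta>)" and ?F = "ball_exp r \<beta> k (\<lambda>_. plus_field r \<beta>) F"
  obtain C where C: "C \<ge> 0" "\<forall>\<epsilon>>0. \<exists>m. \<forall>h. (\<forall>w\<in>word_sphere r k. \<bar>h w\<bar> \<le> field_bound r \<beta> m) \<longrightarrow>
    0 \<le> ?S + \<epsilon> - ball_exp r \<beta> k h (star_obs r) \<and>
    \<bar>ball_exp r \<beta> k h F - ?F\<bar> \<le> \<delta> / 2 + C * (?S + \<epsilon> - ball_exp r \<beta> k h (star_obs r))"
    using deviation_controlled_by_star[OF \<beta> k F(2), of "\<delta> / 2"] \<delta> by auto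
  \<comment> \<open>A deficit of at most \<eta> adds at most \<open>\<delta> / 2\<close> to the
    deviation.\<close>
  define \<eta> where "\<eta> = \<delta> / (2 * (C + 1))"
  have \<eta>: "\<eta> > 0" "C * \<eta> \<le> \<delta> / 2" using \<delta> C(1) by (simp_all add: \<eta>_def field_simps)
  \<comment> \<open>The bound on the total deficit contains \<epsilon> three times per vertex, which
    makes \<open>\<eta> * \<delta> / 3\<close>.\<close>
  define \<epsilon> where "\<epsilon> = \<eta> * \<delta> / 9"
  have \<epsilon>: "\<epsilon> > 0" using \<eta> \<delta> by (simp add: \<epsilon>_def)
  \<comment> \<open>The bad vertices are at most a fraction \<open>\<delta> / 3\<close>, and their
    energy, at most \<open>2 * r\<close> each, sums to at most \<open>\<eta> * \<delta> / 3\<close>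
    times \<open>n\<close>.\<close>
  define \<kappa> where "\<kappa> = min (\<delta> / 3) (\<eta> * \<delta> / (6 * (real r + 1)))"
  have "\<kappa> > 0" using \<eta> \<delta> by (simp add: \<kappa>_def)
  moreover have "\<kappa> \<le> \<delta> / 3" unfolding \<kappa>_def by (rule min.cobounded1)
  ultimately have \<kappa>: "\<kappa> > 0" "\<kappa> \<le> \<delta> / 3" .
  have \<kappa>2: "2 * real r * \<kappa> \<le> \<eta> * \<delta> / 3"
  proof -
    have "2 * real r * \<kappa> \<le> 2 * (real r + 1) * (\<eta> * \<delta> / (6 * (real r + 1)))"
      using \<eta> \<delta> \<kappa>(1) by (intro mult_mono) (auto simp: \<kappa>_def)
    also have "\<dots> = \<eta> * \<delta> / 3" by (simp add: divide_simps)
    finally show ?thesis .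
  qed
  obtain m where m: "\<And>h. \<forall>w\<in>word_sphere r k. \<bar>h w\<bar> \<le> field_bound r \<beta> m \<Longrightarrow>
    0 \<le> ?S + \<epsilon> - ball_exp r \<beta> k h (star_obs r) \<and>
    \<bar>ball_exp r \<beta> k h F - ?F\<bar> \<le> \<delta> / 2 + C * (?S + \<epsilon> - ball_exp r \<beta> k h (star_obs r))"
    using C(2) \<epsilon> by meson
  obtain R0 where R0: "\<And>n \<tau> R'. \<tau> \<in> perm_homs r n \<Longrightarrow> R0 \<le> R' \<Longrightarrow>
    real (card (good r n \<tau> R')) * (?S - \<epsilon>) - \<epsilon> * real n \<le> graph_exp r n \<tau> \<beta> 0 (graph_energy r n \<tau>)"
    using energy_lower_bound[OF \<beta> \<epsilon>] by meson
  define R where "R = max R0 (Suc (k + m))"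
  show ?thesis
  proof (intro exI[of _ R] exI[of _ \<kappa>] conjI allI impI \<kappa>(1))
    fix n \<tau>
    assume \<tau>: "\<tau> \<in> perm_homs r n" and many: "real (card (good r n \<tau> R)) \<ge> (1 - \<kappa>) * real n"
    let ?f = "\<lambda>v. graph_exp r n \<tau> \<beta> 0 (\<lambda>x. F (\<lambda>w. x (\<tau> w v)))"
    let ?g = "\<lambda>v. graph_exp r n \<tau> \<beta> 0 (\<lambda>x. star_obs r (\<lambda>w. x (\<tau> w v)))"
    let ?A = "good r n \<tau> R"
    note star_loc = local_on_star_obs[OF k, of r]
    have loc: "0 \<le> ?S + \<epsilon> - ?g v \<and> \<bar>?f v - ?F\<bar> \<le> \<delta> / 2 + C * (?S + \<epsilon> - ?g v)" if v: "v \<in> ?A" for v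
    proof -
      have v': "v \<in> {1..n}" "v \<in> good r n \<tau> (Suc (k + m))"
        using v good_mono[of "Suc (k + m)" R] by (auto simp: good_def R_def)
      interpret rooted_rep r n \<tau> v using \<tau> v' by unfold_locales
      have inj: "inj_on (\<lambda>w. \<tau> w v) (word_ball r (Suc (k + m)))" using v'(2) by (simp add: good_def)
      \<comment> \<open>\<open>nonneg_if_ball_exp_nonneg\<close> transfers every affine inequality
        between the two means from the ball to the graph; three of them make up the claim, two for
        the absolute value.\<close>
      have nn: "0 \<le> a + b * ?g v + c * ?f v"
        if "\<And>h. \<forall>w\<in>word_sphere r k. \<bar>h w\<bar> \<le> field_bound r \<beta> m \<Longrightarrow>
          0 \<le> a + b * ball_exp r \<beta> k h (star_obs r) + c * ball_exp r \<beta> k h F" for a b c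
        unfolding graph_exp_affine[symmetric]
        by (rule nonneg_if_ball_exp_nonneg[OF \<beta> k inj local_on_affine[OF star_loc F(1)]])
          (simp only: ball_exp_affine that)
      have "0 \<le> (?S + \<epsilon>) + (-1) * ?g v + 0 * ?f v"
        by (rule nn) (use m in force)
      moreover have "0 \<le> (\<delta> / 2 + C * (?S + \<epsilon>) + ?F) + (- C) * ?g v + (-1) * ?f v"
      proof (rule nn)
        fix h assume "\<forall>w\<in>word_sphere r k. \<bar>h w\<bar> \<le> field_bound r \<beta> m"
        from m[OF this] have "ball_exp r \<beta> k h F - ?F \<le> \<delta> / 2 + C * (?S + \<epsilon> - ball_exp r \<beta> k h (star_obs r))" by auto
        then show "0 \<le> (\<delta> / 2 + C * (?S + \<epsilon>) + ?F) + (- C) * ball_exp r \<beta> k h (star_obs r) + (-1) * ball_exp r \<beta> k h F"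
          by (simp add: algebra_simps)
      qed
      moreover have "0 \<le> (\<delta> / 2 + C * (?S + \<epsilon>) - ?F) + (- C) * ?g v + 1 * ?f v"
      proof (rule nn)
        fix h assume "\<forall>w\<in>word_sphere r k. \<bar>h w\<bar> \<le> field_bound r \<beta> m"
        from m[OF this] have "?F - ball_exp r \<beta> k h F \<le> \<delta> / 2 + C * (?S + \<epsilon> - ball_exp r \<beta> k h (star_obs r))" by auto
        then show "0 \<le> (\<delta> / 2 + C * (?S + \<epsilon>) - ?F) + (- C) * ball_exp r \<beta> k h (star_obs r) + 1 * ball_exp r \<beta> k h F"
          by (simp add: algebra_simps)
      qed
      ultimately show ?thesis by (simp add: abs_le_iff algebra_simps)
    qed
    define N where "N = {v \<in> ?A. ?S + \<epsilon> - ?g v > \<eta>}"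
    have "N \<subseteq> ?A" "finite N" by (auto simp: N_def)
    have "real (card N) * \<eta> = (\<Sum>v\<in>N. \<eta>)" by simp
    also have "\<dots> \<le> (\<Sum>v\<in>N. ?S + \<epsilon> - ?g v)" by (rule sum_mono) (simp add: N_def)
    also have "\<dots> \<le> (\<Sum>v\<in>?A. ?S + \<epsilon> - ?g v)"
      using loc \<open>N \<subseteq> ?A\<close> by (intro sum_mono2) auto
    also have "\<dots> = real (card ?A) * (?S + \<epsilon>) - (\<Sum>v\<in>?A. ?g v)"
      by (simp add: sum_subtractf)
    finally have N1: "real (card N) * \<eta> \<le> real (card ?A) * (?S + \<epsilon>) - (\<Sum>v\<in>?A. ?g v)" .
    have sub: "?A \<subseteq> {1..n}" by (auto simp: good_def)
    have cd: "real (card ({1..n} - ?A)) = real n - real (card ?A)"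
      using card_good_le[of r n \<tau> R] unfolding card_Diff_subset[OF finite_good sub] by (simp add: of_nat_diff)
    have "graph_exp r n \<tau> \<beta> 0 (graph_energy r n \<tau>) = (\<Sum>v\<in>{1..n}. ?g v)"
      unfolding graph_energy_view[OF \<tau>] by (rule graph_exp_sum)
    also have "\<dots> = (\<Sum>v\<in>{1..n} - ?A. ?g v) + (\<Sum>v\<in>?A. ?g v)"
      by (rule sum.subset_diff[OF sub]) simp
    also have "\<dots> \<le> (\<Sum>v\<in>{1..n} - ?A. 2 * real r) + (\<Sum>v\<in>?A. ?g v)"
      by (intro add_right_mono sum_mono graph_star_abs[OF \<tau>]) auto
    finally have E: "graph_exp r n \<tau> \<beta> 0 (graph_energy r n \<tau>) \<le> (real n - real (card ?A)) * (2 * real r) + (\<Sum>v\<in>?A. ?g v)"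
      unfolding sum_constant cd .
    have "real (card N) * \<eta> \<le> 2 * \<epsilon> * real (card ?A) + \<epsilon> * real n + (real n - real (card ?A)) * (2 * real r)"
      using N1 E R0[OF \<tau>, of R] by (simp add: R_def algebra_simps)
    also have "\<dots> \<le> 2 * \<epsilon> * real n + \<epsilon> * real n + (\<kappa> * real n) * (2 * real r)"
      using card_good_le[of r n \<tau> R] many \<epsilon>
      by (intro add_mono mult_left_mono mult_right_mono) (auto simp: algebra_simps)
    also have "\<dots> = (3 * \<epsilon> + 2 * real r * \<kappa>) * real n" by (simp add: algebra_simps)
    also have "\<dots> \<le> (\<eta> * \<delta> / 3 + \<eta> * \<delta> / 3) * real n"
      using \<kappa>2 by (intro mult_right_mono add_mono) (auto simp: \<epsilon>_def)
    also have "\<dots> = \<eta> * (2 * \<delta> / 3 * real n)" by simp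
    finally have cardN: "real (card N) \<le> 2 * \<delta> / 3 * real n"
      using \<eta>(1) by (simp add: mult.commute)
    have incl: "?A - N \<subseteq> {v \<in> {1..n}. \<bar>?f v - ?F\<bar> \<le> \<delta>}"
    proof
      fix v assume v: "v \<in> ?A - N"
      then have "?S + \<epsilon> - ?g v \<le> \<eta>" by (auto simp: N_def)
      then have "C * (?S + \<epsilon> - ?g v) \<le> C * \<eta>" using C(1) by (rule mult_left_mono)
      moreover have "\<bar>?f v - ?F\<bar> \<le> \<delta> / 2 + C * (?S + \<epsilon> - ?g v)" using loc v by blast
      ultimately have "\<bar>?f v - ?F\<bar> \<le> \<delta>" using \<eta>(2) by linarith
      then show "v \<in> {v \<in> {1..n}. \<bar>?f v - ?F\<bar> \<le> \<delta>}" using v sub by blast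
    qed
    have "(1 - \<delta>) * real n \<le> (1 - \<kappa>) * real n - 2 * \<delta> / 3 * real n"
      using mult_right_mono[OF \<kappa>(2), of "real n"] by (simp add: algebra_simps)
    also have "\<dots> \<le> real (card ?A) - real (card N)" using many cardN by linarith
    also have "\<dots> = real (card (?A - N))"
      using card_mono[OF finite_good \<open>N \<subseteq> ?A\<close>] by (simp add: card_Diff_subset[OF \<open>finite N\<close> \<open>N \<subseteq> ?A\<close>])
    also have "\<dots> \<le> real (card {v \<in> {1..n}. \<bar>?f v - ?F\<bar> \<le> \<delta>})"
      using card_mono[OF _ incl] by simp
    finally show "real (card {v \<in> {1..n}. \<bar>?f v - ?F\<bar> \<le> \<delta>}) \<ge> (1 - \<delta>) * real n" .
  qed
qed

section \<open>Cylinder sets and the weak topology\<close>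

definition cyl :: "nat \<Rightarrow> nat \<Rightarrow> (word \<Rightarrow> real) \<Rightarrow> (word \<Rightarrow> real) set" where
  "cyl r k z = {x \<in> words r \<rightarrow>\<^sub>E spins. \<forall>w\<in>word_ball r k. x w = z w}"

text \<open>The value 1 off the ball is an arbitrary spin; on large balls it hardly affects a
  continuous function.\<close>

definition extend :: "nat \<Rightarrow> nat \<Rightarrow> (word \<Rightarrow> real) \<Rightarrow> word \<Rightarrow> real" where
  "extend r k z = (\<lambda>w\<in>words r. if w \<in> word_ball r k then z w else 1)"

lemma space_config: "space (config_space r) = words r \<rightarrow>\<^sub>E spins"
  by (simp add: config_space_def space_PiM)

lemma topspace_config: "topspace (config_topology r) = words r \<rightarrow>\<^sub>E spins"
  by (simp add: config_topology_def)

lemma config_probs_space: "\<rho> \<in> config_probs r \<Longrightarrow> space \<rho> = words r \<rightarrow>\<^sub>E spins"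
  using sets_eq_imp_space_eq[of \<rho> "config_space r"] by (simp add: config_probs_def space_config)

lemma ball_subset_words: "word_ball r k \<subseteq> words r"
  using word_ball_in by blast

lemma cyl_measurable: 
  assumes "z \<in> word_ball r k \<rightarrow>\<^sub>E spins"
  shows "cyl r k z \<in> sets (config_space r)"
proof -
  have "cyl r k z = prod_emb (words r) (\<lambda>_. count_space spins) (word_ball r k) (\<Pi>\<^sub>E w\<in>word_ball r k. {z w})"
    unfolding cyl_def prod_emb_def by (auto simp: PiE_def Pi_def restrict_def extensional_def)
  also have "\<dots> \<in> sets (config_space r)"
    unfolding config_space_def
    by (rule sets_PiM_I[OF finite_word_ball ball_subset_words]) (use assms in \<open>auto dest: PiE_mem\<close>)
  finally show ?thesis .
qed

lemma cyl_sets: "\<rho> \<in> config_probs r \<Longrightarrow> z \<in> word_ball r k \<rightarrow>\<^sub>E spins \<Longrightarrow> cyl r k z \<in> sets \<rho>"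
  using cyl_measurable by (simp add: config_probs_def)

lemma extend_in: "z \<in> word_ball r k \<rightarrow>\<^sub>E spins \<Longrightarrow> extend r k z \<in> words r \<rightarrow>\<^sub>E spins"
proof -
  assume z: "z \<in> word_ball r k \<rightarrow>\<^sub>E spins"
  have "1 \<in> spins" by (simp add: spins_def)
  then show ?thesis using z by (auto simp: extend_def restrict_PiE_iff dest: PiE_mem)
qed

lemma restrict_ball_in: "x \<in> words r \<rightarrow>\<^sub>E spins \<Longrightarrow> restrict x (word_ball r k) \<in> word_ball r k \<rightarrow>\<^sub>E spins"
  using ball_subset_words by (auto dest: PiE_mem)

lemma cyl_iff:
  assumes "x \<in> words r \<rightarrow>\<^sub>E spins" "z \<in> word_ball r k \<rightarrow>\<^sub>E spins"
  shows "x \<in> cyl r k z \<longleftrightarrow> restrict x (word_ball r k) = z"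
proof -
  have "restrict x (word_ball r k) = z \<longleftrightarrow> (\<forall>w\<in>word_ball r k. x w = z w)"
    using assms(2) by (auto simp: fun_eq_iff PiE_def extensional_def)
  then show ?thesis using assms(1) by (simp add: cyl_def)
qed

lemma openin_cyl:
  assumes "x \<in> words r \<rightarrow>\<^sub>E spins"
  shows "openin (config_topology r) (cyl r k x)"
proof -
  define U where "U w = (if w \<in> word_ball r k then {x w} else spins)" for w
  have "cyl r k x = (\<Pi>\<^sub>E w\<in>words r. U w)"
    unfolding cyl_def U_def using assms ball_subset_words[of r k] by (auto simp: PiE_iff extensional_def split: if_splits)
  moreover have "openin (config_topology r) (\<Pi>\<^sub>E w\<in>words r. U w)"
    unfolding config_topology_def
  proof (rule product_topology_basis)
    show "openin (discrete_topology spins) (U w)" for w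
      using assms word_ball_in[of w r k] by (auto simp: U_def dest: PiE_mem)
    show "finite {w. U w \<noteq> topspace (discrete_topology spins)}"
      by (rule finite_subset[OF _ finite_word_ball[of r k]]) (auto simp: U_def)
  qed
  ultimately show ?thesis by simp
qed

text \<open>Uniform continuity by compactness: the space is covered by finitely many cylinders on
  which \<open>f\<close> stays within \<open>e / 2\<close> of its value at a centre, and the largest
  of their radii works.\<close>

lemma cylinder_approx:
  assumes f: "continuous_map (config_topology r) euclideanreal f" and e: "e > 0"
  shows "\<exists>k0. \<forall>k\<ge>k0. \<forall>x\<in>words r \<rightarrow>\<^sub>E spins. \<bar>f x - f (extend r k (restrict x (word_ball r k)))\<bar> \<le> e"
proof -
  let ?X = "words r \<rightarrow>\<^sub>E spins"
  define \<U> where "\<U> = {cyl r k x | k x. x \<in> ?X \<and> (\<forall>y\<in>cyl r k x. \<bar>f y - f x\<bar> < e / 2)}"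
  have comp: "compactin (config_topology r) ?X"
    using compact_space_product_topology[of "\<lambda>_. discrete_topology spins" "words r"]
    unfolding compact_space_def topspace_config[symmetric]
    by (simp add: config_topology_def compact_space_def compactin_discrete_topology)
  have open_U: "openin (config_topology r) U" if "U \<in> \<U>" for U
    using that openin_cyl unfolding \<U>_def by blast
  have cover: "?X \<subseteq> \<Union>\<U>"
  proof
    fix x assume x: "x \<in> ?X"
    define S where "S = {y \<in> topspace (config_topology r). f y \<in> {f x - e / 2<..<f x + e / 2}}"
    have "openin (config_topology r) S"
      unfolding S_def by (rule openin_continuous_map_preimage[OF f]) simp
    moreover have "x \<in> S" using x e by (simp add: S_def topspace_config)
    ultimately obtain U where U: "finite {i \<in> words r. U i \<noteq> topspace (discrete_topology spins)}"
      "\<And>i. i \<in> words r \<Longrightarrow> openin (discrete_topology spins) (U i)" "x \<in> Pi\<^sub>E (words r) U" "Pi\<^sub>E (words r) U \<subseteq> S"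
      unfolding config_topology_def openin_product_topology_alt by meson
    define D where "D = {i \<in> words r. U i \<noteq> spins}"
    have D: "finite D" using U(1) by (simp add: D_def)
    define k where "k = Max (insert 0 (length ` D))"
    have "length w \<le> k" if "w \<in> D" for w
      unfolding k_def by (rule Max_ge) (use D that in auto)
    then have Dk: "D \<subseteq> word_ball r k"
      by (auto simp: word_ball_def D_def)
    have sub: "cyl r k x \<subseteq> Pi\<^sub>E (words r) U"
    proof
      fix y assume y: "y \<in> cyl r k x"
      then have yX: "y \<in> ?X" by (simp add: cyl_def)
      have "y w \<in> U w" if w: "w \<in> words r" for w
      proof (cases "w \<in> D")
        case True
        then have "y w = x w" using y Dk by (auto simp: cyl_def)
        then show ?thesis using U(3) w by (auto dest: PiE_mem)
      next
        case False
        then have "U w = spins" using w by (simp add: D_def)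
        then show ?thesis using yX w by (auto dest: PiE_mem)
      qed
      then show "y \<in> Pi\<^sub>E (words r) U" using yX by (auto simp: PiE_iff)
    qed
    have "\<bar>f y - f x\<bar> < e / 2" if "y \<in> cyl r k x" for y
    proof -
      have "y \<in> S" using that sub U(4) by blast
      then show ?thesis unfolding S_def greaterThanLessThan_iff mem_Collect_eq abs_less_iff by linarith
    qed
    then have "cyl r k x \<in> \<U>" unfolding \<U>_def using x by blast
    moreover have "x \<in> cyl r k x" using x by (simp add: cyl_def)
    ultimately show "x \<in> \<Union>\<U>" by blast
  qed
  obtain \<F> where F: "finite \<F>" "\<F> \<subseteq> \<U>" "?X \<subseteq> \<Union>\<F>"
    using compactinD[OF comp open_U cover] by blast
  have "\<forall>A\<in>\<F>. \<exists>k. \<exists>x. A = cyl r k x \<and> x \<in> ?X \<and> (\<forall>y\<in>cyl r k x. \<bar>f y - f x\<bar> < e / 2)"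
    using F(2) unfolding \<U>_def by blast
  then obtain lev where lev: "\<And>A. A \<in> \<F> \<Longrightarrow> \<exists>x. A = cyl r (lev A) x \<and> x \<in> ?X \<and> (\<forall>y\<in>cyl r (lev A) x. \<bar>f y - f x\<bar> < e / 2)"
    by metis
  show ?thesis
  proof (intro exI[of _ "Max (insert 0 (lev ` \<F>))"] allI impI ballI)
    fix k x assume k: "Max (insert 0 (lev ` \<F>)) \<le> k" and x: "x \<in> ?X"
    let ?y = "extend r k (restrict x (word_ball r k))"
    obtain A where A: "A \<in> \<F>" "x \<in> A" using F(3) x by blast
    obtain x0 where x0: "A = cyl r (lev A) x0" "\<forall>y\<in>cyl r (lev A) x0. \<bar>f y - f x0\<bar> < e / 2"
      using lev[OF A(1)] by blast
    have lk: "lev A \<le> k" using k A(1) F(1) by simp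
    have x_in: "x \<in> cyl r (lev A) x0" using A(2) x0(1) by simp
    have "?y w = x w" if w: "w \<in> word_ball r (lev A)" for w
    proof -
      have "w \<in> word_ball r k" using w word_ball_mono[OF lk] by blast
      then show ?thesis using word_ball_in by (simp add: extend_def)
    qed
    then have y_in: "?y \<in> cyl r (lev A) x0"
      using x_in extend_in[OF restrict_ball_in[OF x]] by (simp add: cyl_def)
    have "\<bar>f x - f x0\<bar> < e / 2" "\<bar>f ?y - f x0\<bar> < e / 2" using x0(2) x_in y_in by blast+
    then show "\<bar>f x - f ?y\<bar> \<le> e" by linarith
  qed
qed

lemma cylinder_integral:
  assumes \<rho>: "\<rho> \<in> config_probs r"
  shows "integrable \<rho> (\<lambda>x. g (restrict x (word_ball r k)) :: real)"
    and "(\<integral>x. g (restrict x (word_ball r k)) \<partial>\<rho>) = (\<Sum>z\<in>word_ball r k \<rightarrow>\<^sub>E spins. g z * measure \<rho> (cyl r k z))"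
proof -
  let ?C = "word_ball r k \<rightarrow>\<^sub>E spins"
  interpret prob_space \<rho> using \<rho> by (simp add: config_probs_def)
  have eq: "g (restrict x (word_ball r k)) = (\<Sum>z\<in>?C. g z * indicator (cyl r k z) x)" if "x \<in> space \<rho>" for x
  proof -
    have x: "x \<in> words r \<rightarrow>\<^sub>E spins" using that config_probs_space[OF \<rho>] by simp
    have "(\<Sum>z\<in>?C. g z * indicator (cyl r k z) x) = (\<Sum>z\<in>?C. if restrict x (word_ball r k) = z then g z else 0)"
      by (intro sum.cong refl) (simp add: indicator_def cyl_iff[OF x])
    also have "\<dots> = g (restrict x (word_ball r k))"
      using restrict_ball_in[OF x] by (subst sum.delta') simp_all
    finally show ?thesis ..
  qed
  have int: "integrable \<rho> (\<lambda>x. \<Sum>z\<in>?C. g z * indicator (cyl r k z) x)"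
    using cyl_sets[OF \<rho>] by (intro Bochner_Integration.integrable_sum integrable_mult_right) (auto simp: less_top[symmetric])
  show "integrable \<rho> (\<lambda>x. g (restrict x (word_ball r k)))"
    by (rule Bochner_Integration.integrable_cong[THEN iffD1, OF refl _ int]) (simp add: eq)
  have "(\<integral>x. g (restrict x (word_ball r k)) \<partial>\<rho>) = (\<integral>x. (\<Sum>z\<in>?C. g z * indicator (cyl r k z) x) \<partial>\<rho>)"
    by (rule Bochner_Integration.integral_cong) (simp_all add: eq)
  also have "\<dots> = (\<Sum>z\<in>?C. g z * measure \<rho> (cyl r k z))"
    using cyl_sets[OF \<rho>] by (subst Bochner_Integration.integral_sum) (auto simp: less_top[symmetric])
  finally show "(\<integral>x. g (restrict x (word_ball r k)) \<partial>\<rho>) = (\<Sum>z\<in>?C. g z * measure \<rho> (cyl r k z))" .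
qed

lemma integral_cylinder_approx:
  assumes f: "continuous_map (config_topology r) euclideanreal f" and e: "e > 0"
  shows "\<exists>k\<ge>1. \<forall>\<rho>\<in>config_probs r.
    \<bar>(\<integral>x. f x \<partial>\<rho>) - (\<Sum>z\<in>word_ball r k \<rightarrow>\<^sub>E spins. f (extend r k z) * measure \<rho> (cyl r k z))\<bar> \<le> e"
proof -
  obtain k0 where k0: "\<And>k x. k \<ge> k0 \<Longrightarrow> x \<in> words r \<rightarrow>\<^sub>E spins \<Longrightarrow>
    \<bar>f x - f (extend r k (restrict x (word_ball r k)))\<bar> \<le> e"
    using cylinder_approx[OF f e] by blast
  define k where "k = max 1 k0"
  let ?g = "\<lambda>x. f (extend r k (restrict x (word_ball r k)))"
  have "\<bar>(\<integral>x. f x \<partial>\<rho>) - (\<Sum>z\<in>word_ball r k \<rightarrow>\<^sub>E spins. f (extend r k z) * measure \<rho> (cyl r k z))\<bar> \<le> e"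
    if \<rho>: "\<rho> \<in> config_probs r" for \<rho>
  proof -
    interpret prob_space \<rho> using \<rho> by (simp add: config_probs_def)
    note sp = config_probs_space[OF \<rho>]
    \<comment> \<open>Measurability of \<open>f\<close>: the topology and the product sigma-algebra
      are defined separately, and \<open>f\<close> is a uniform limit of measurable cylinder
      functions.\<close>
    have "\<exists>g. \<forall>j. g j \<in> borel_measurable \<rho> \<and> (\<forall>x\<in>space \<rho>. \<bar>f x - g j x\<bar> \<le> inverse (real (Suc j)))"
    proof (rule choice, rule allI)
      fix j
      obtain k1 where k1: "\<And>k x. k \<ge> k1 \<Longrightarrow> x \<in> words r \<rightarrow>\<^sub>E spins \<Longrightarrow>
        \<bar>f x - f (extend r k (restrict x (word_ball r k)))\<bar> \<le> inverse (real (Suc j))"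
        using cylinder_approx[OF f, of "inverse (real (Suc j))"] by auto
      show "\<exists>g. g \<in> borel_measurable \<rho> \<and> (\<forall>x\<in>space \<rho>. \<bar>f x - g x\<bar> \<le> inverse (real (Suc j)))"
        by (rule exI[of _ "\<lambda>x. f (extend r k1 (restrict x (word_ball r k1)))"])
          (use k1[OF order_refl] sp borel_measurable_integrable[OF cylinder_integral(1)[OF \<rho>, of "\<lambda>z. f (extend r k1 z)"]] in auto)
    qed
    then obtain g where g: "\<And>j. g j \<in> borel_measurable \<rho>"
      "\<And>j x. x \<in> space \<rho> \<Longrightarrow> \<bar>f x - g j x\<bar> \<le> inverse (real (Suc j))" by blast
    have meas: "f \<in> borel_measurable \<rho>"
    proof (rule borel_measurable_LIMSEQ_real[OF _ g(1)])
      fix x assume x: "x \<in> space \<rho>"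
      have "(\<lambda>j. f x - g j x) \<longlonglongrightarrow> 0"
        by (rule Lim_null_comparison[OF _ LIMSEQ_inverse_real_of_nat]) (use g(2)[OF x] in auto)
      then have "(\<lambda>j. f x - (f x - g j x)) \<longlonglongrightarrow> f x - 0" by (intro tendsto_intros)
      then show "(\<lambda>j. g j x) \<longlonglongrightarrow> f x" by simp
    qed
    have int_g: "integrable \<rho> ?g" by (rule cylinder_integral(1)[OF \<rho>])
    have close: "\<bar>f x - ?g x\<bar> \<le> e" if "x \<in> space \<rho>" for x
      using k0[of k x] that sp by (simp add: k_def)
    have int_d: "integrable \<rho> (\<lambda>x. f x - ?g x)"
      using borel_measurable_integrable[OF int_g] meas close
      by (intro integrable_const_bound[of _ e]) auto
    have "integrable \<rho> (\<lambda>x. (f x - ?g x) + ?g x)" by (intro Bochner_Integration.integrable_add int_d int_g)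
    then have int_f: "integrable \<rho> f" by simp
    have "\<bar>\<integral>x. f x - ?g x \<partial>\<rho>\<bar> \<le> (\<integral>x. \<bar>f x - ?g x\<bar> \<partial>\<rho>)" by (rule integral_abs_bound)
    also have "\<dots> \<le> (\<integral>x. e \<partial>\<rho>)"
      using int_d close by (intro integral_mono) auto
    finally have "\<bar>(\<integral>x. f x \<partial>\<rho>) - (\<integral>x. ?g x \<partial>\<rho>)\<bar> \<le> e"
      using int_f int_g by (simp add: prob_space)
    then show ?thesis by (simp add: cylinder_integral(2)[OF \<rho>, of "\<lambda>z. f (extend r k z)"])
  qed
  then show ?thesis by (intro exI[of _ k]) (simp add: k_def)
qed

text \<open>Induction over the generation of the topology; for a sub-basic set the integral of
  \<open>f\<close> is replaced by a finite sum over cylinders. \<open>0 \<notin> N\<close>, because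
  the cylinder probabilities will be known for radii \<open>k \<ge> 1\<close>.\<close>

lemma weak_neighbourhood:
  assumes "openin (weak_topology r) \<O>" "\<mu> \<in> \<O>" "\<mu> \<in> config_probs r"
  shows "\<exists>N e. finite N \<and> 0 \<notin> N \<and> e > 0 \<and> (\<forall>\<rho>\<in>config_probs r.
    (\<forall>k\<in>N. \<forall>z\<in>word_ball r k \<rightarrow>\<^sub>E spins. \<bar>measure \<rho> (cyl r k z) - measure \<mu> (cyl r k z)\<bar> \<le> e) \<longrightarrow> \<rho> \<in> \<O>)"
proof -
  have "generate_topology_on {{\<mu> \<in> config_probs r. (\<integral>x. f x \<partial>\<mu>) \<in> U} | f U.
        continuous_map (config_topology r) euclideanreal f \<and> open (U :: real set)} \<O>"
    using assms(1) unfolding weak_topology_def openin_topology_generated_by_iff .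
  then show ?thesis using assms(2)
  proof (induction rule: generate_topology_on.induct)
    case (Int a b)
    obtain N e where N: "finite N" "0 \<notin> N" "e > 0" "\<And>\<rho>. \<rho> \<in> config_probs r \<Longrightarrow>
      (\<forall>k\<in>N. \<forall>z\<in>word_ball r k \<rightarrow>\<^sub>E spins. \<bar>measure \<rho> (cyl r k z) - measure \<mu> (cyl r k z)\<bar> \<le> e) \<Longrightarrow> \<rho> \<in> a"
      using Int.IH(1) Int.prems by blast
    obtain N' e' where N': "finite N'" "0 \<notin> N'" "e' > 0" "\<And>\<rho>. \<rho> \<in> config_probs r \<Longrightarrow>
      (\<forall>k\<in>N'. \<forall>z\<in>word_ball r k \<rightarrow>\<^sub>E spins. \<bar>measure \<rho> (cyl r k z) - measure \<mu> (cyl r k z)\<bar> \<le> e') \<Longrightarrow> \<rho> \<in> b"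
      using Int.IH(2) Int.prems by blast
    have "\<rho> \<in> a \<inter> b" if "\<rho> \<in> config_probs r"
      "\<forall>k\<in>N \<union> N'. \<forall>z\<in>word_ball r k \<rightarrow>\<^sub>E spins. \<bar>measure \<rho> (cyl r k z) - measure \<mu> (cyl r k z)\<bar> \<le> min e e'" for \<rho>
      using N(4)[OF that(1)] N'(4)[OF that(1)] that(2) by (simp add: ball_Un)
    moreover have "finite (N \<union> N')" "0 \<notin> N \<union> N'" "0 < min e e'" using N N' by auto
    ultimately show ?case by blast
  next
    case (UN K)
    then obtain a where "a \<in> K" "\<mu> \<in> a" by blast
    from UN.IH[OF this] obtain N e where "finite N" "0 \<notin> N" "e > 0" "\<forall>\<rho>\<in>config_probs r.
      (\<forall>k\<in>N. \<forall>z\<in>word_ball r k \<rightarrow>\<^sub>E spins. \<bar>measure \<rho> (cyl r k z) - measure \<mu> (cyl r k z)\<bar> \<le> e) \<longrightarrow> \<rho> \<in> a"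
      by blast
    then show ?case using \<open>a \<in> K\<close> by (intro exI[of _ N] exI[of _ e]) blast
  next
    case (Basis s)
    then obtain f U where s: "s = {\<mu> \<in> config_probs r. (\<integral>x. f x \<partial>\<mu>) \<in> U}"
      "continuous_map (config_topology r) euclideanreal f" "open U" by blast
    have "(\<integral>x. f x \<partial>\<mu>) \<in> U" using Basis.prems s(1) by simp
    then obtain d where d: "d > 0" "\<And>y. \<bar>y - (\<integral>x. f x \<partial>\<mu>)\<bar> < d \<Longrightarrow> y \<in> U"
      using s(3) unfolding open_dist dist_real_def by blast
    \<comment> \<open>Errors of \<open>d / 4\<close> arise at \<open>\<rho>\<close>, at
      \<open>\<mu>\<close> and between the two cylinder sums, in total less than
      \<open>d\<close>.\<close>
    obtain k where k: "k \<ge> 1" "\<And>\<rho>. \<rho> \<in> config_probs r \<Longrightarrow>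
      \<bar>(\<integral>x. f x \<partial>\<rho>) - (\<Sum>z\<in>word_ball r k \<rightarrow>\<^sub>E spins. f (extend r k z) * measure \<rho> (cyl r k z))\<bar> \<le> d / 4"
      using integral_cylinder_approx[OF s(2), of "d / 4"] d(1) by auto
    define M where "M = (\<Sum>z\<in>word_ball r k \<rightarrow>\<^sub>E spins. \<bar>f (extend r k z)\<bar>)"
    have M: "M \<ge> 0" by (simp add: M_def sum_nonneg)
    have "\<rho> \<in> s" if \<rho>: "\<rho> \<in> config_probs r"
      "\<forall>k\<in>{k}. \<forall>z\<in>word_ball r k \<rightarrow>\<^sub>E spins. \<bar>measure \<rho> (cyl r k z) - measure \<mu> (cyl r k z)\<bar> \<le> d / (4 * (M + 1))" for \<rho>
    proof -
      let ?s = "\<lambda>\<rho>. \<Sum>z\<in>word_ball r k \<rightarrow>\<^sub>E spins. f (extend r k z) * measure \<rho> (cyl r k z)"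
      have "\<bar>?s \<rho> - ?s \<mu>\<bar> \<le> (\<Sum>z\<in>word_ball r k \<rightarrow>\<^sub>E spins. \<bar>f (extend r k z)\<bar> * (d / (4 * (M + 1))))"
        unfolding sum_subtractf[symmetric] right_diff_distrib[symmetric]
      proof (rule order_trans[OF sum_abs], rule sum_mono)
        fix z assume "z \<in> word_ball r k \<rightarrow>\<^sub>E spins"
        then have "\<bar>measure \<rho> (cyl r k z) - measure \<mu> (cyl r k z)\<bar> \<le> d / (4 * (M + 1))" using \<rho>(2) by blast
        then show "\<bar>f (extend r k z) * (measure \<rho> (cyl r k z) - measure \<mu> (cyl r k z))\<bar>
            \<le> \<bar>f (extend r k z)\<bar> * (d / (4 * (M + 1)))"
          unfolding abs_mult by (rule mult_left_mono) simp
      qed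
      also have "\<dots> = M * (d / (4 * (M + 1)))" by (simp only: M_def sum_distrib_right)
      also have "\<dots> \<le> d / 4" using M d(1) by (simp add: field_simps)
      finally have "\<bar>(\<integral>x. f x \<partial>\<rho>) - (\<integral>x. f x \<partial>\<mu>)\<bar> < d"
        using k(2)[OF \<rho>(1)] k(2)[OF assms(3)] d(1) by linarith
      then show ?thesis using d(2) \<rho>(1) s(1) by simp
    qed
    moreover have "0 < d / (4 * (M + 1))" using d(1) M by simp
    ultimately show ?case using k(1) by (intro exI[of _ "{k}"] exI[of _ "d / (4 * (M + 1))"]) auto
  qed simp
qed

lemma topspace_weak: "topspace (weak_topology r) = config_probs r"
proof -
  have "config_probs r = {\<mu> \<in> config_probs r. (\<integral>x. 0 \<partial>\<mu>) \<in> (UNIV :: real set)}" by simp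
  moreover have "continuous_map (config_topology r) euclideanreal (\<lambda>_. 0)" by simp
  ultimately have "config_probs r \<in> {{\<mu> \<in> config_probs r. (\<integral>x. f x \<partial>\<mu>) \<in> U} | f U.
        continuous_map (config_topology r) euclideanreal f \<and> open (U :: real set)}" by blast
  then have "config_probs r \<subseteq> topspace (weak_topology r)"
    unfolding weak_topology_def by (simp add: topology_generated_by_topspace) blast
  moreover have "topspace (weak_topology r) \<subseteq> config_probs r"
    unfolding weak_topology_def topology_generated_by_topspace by blast
  ultimately show ?thesis by blast
qed

lemma weak_limitI:
  assumes "\<And>m. \<rho> m \<in> config_probs r" "\<mu> \<in> config_probs r"
    and "\<And>k z. k \<ge> 1 \<Longrightarrow> z \<in> word_ball r k \<rightarrow>\<^sub>E spins \<Longrightarrow>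
      (\<lambda>m. measure (\<rho> m) (cyl r k z)) \<longlonglongrightarrow> measure \<mu> (cyl r k z)"
  shows "limitin (weak_topology r) \<rho> \<mu> sequentially"
  unfolding limitin_def topspace_weak
proof (intro conjI allI impI assms(2))
  fix \<O> assume O: "openin (weak_topology r) \<O> \<and> \<mu> \<in> \<O>"
  obtain N e where N: "finite N" "0 \<notin> N" "e > 0" "\<forall>\<rho>\<in>config_probs r.
      (\<forall>k\<in>N. \<forall>z\<in>word_ball r k \<rightarrow>\<^sub>E spins. \<bar>measure \<rho> (cyl r k z) - measure \<mu> (cyl r k z)\<bar> \<le> e) \<longrightarrow> \<rho> \<in> \<O>"
    using weak_neighbourhood[OF conjunct1[OF O] conjunct2[OF O] assms(2)] by (elim exE conjE)
  have "eventually (\<lambda>m. \<forall>k\<in>N. \<forall>z\<in>word_ball r k \<rightarrow>\<^sub>E spins.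
      \<bar>measure (\<rho> m) (cyl r k z) - measure \<mu> (cyl r k z)\<bar> \<le> e) sequentially"
  proof (intro eventually_ball_finite N(1) ballI finite_confs finite_word_ball)
    fix k z assume k: "k \<in> N" and z: "z \<in> word_ball r k \<rightarrow>\<^sub>E spins"
    have "k \<ge> 1" using k N(2) by (cases k) simp_all
    from tendstoD[OF assms(3)[OF this z] N(3)]
    show "eventually (\<lambda>m. \<bar>measure (\<rho> m) (cyl r k z) - measure \<mu> (cyl r k z)\<bar> \<le> e) sequentially"
      by (rule eventually_mono) (simp add: dist_real_def)
  qed
  then show "eventually (\<lambda>m. \<rho> m \<in> \<O>) sequentially"
    by (rule eventually_mono) (rule mp[OF bspec[OF N(4) assms(1)]])
qed

text \<open>The indicator of a cylinder, written as a product so that continuity reduces to single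
  coordinates.\<close>

lemma continuous_cyl_indicator:
  "continuous_map (config_topology r) euclideanreal (\<lambda>x. \<Prod>w\<in>word_ball r k. if x w = z w then 1 else 0)"
proof (rule continuous_map_prod[OF finite_word_ball])
  fix w assume w: "w \<in> word_ball r k"
  have "continuous_map (config_topology r) (discrete_topology spins) (\<lambda>x. x w)"
    unfolding config_topology_def by (rule continuous_map_product_projection[OF word_ball_in[OF w]])
  moreover have "continuous_map (discrete_topology spins) euclideanreal (\<lambda>s. if s = z w then 1 else 0)" by simp
  ultimately have "continuous_map (config_topology r) euclideanreal ((\<lambda>s. if s = z w then 1 else 0) \<circ> (\<lambda>x. x w))"
    by (rule continuous_map_compose)
  then show "continuous_map (config_topology r) euclideanreal (\<lambda>x. if x w = z w then 1 else 0)"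
    by (simp add: comp_def)
qed

lemma weak_limitD:
  assumes "limitin (weak_topology r) \<rho> \<mu> sequentially" "\<And>m. \<rho> m \<in> config_probs r"
    and z: "z \<in> word_ball r k \<rightarrow>\<^sub>E spins"
  shows "(\<lambda>m. measure (\<rho> m) (cyl r k z)) \<longlonglongrightarrow> measure \<mu> (cyl r k z)"
proof -
  let ?f = "\<lambda>x. \<Prod>w\<in>word_ball r k. if x w = z w then 1 else 0 :: real"
  have \<mu>: "\<mu> \<in> config_probs r" using assms(1) by (simp add: limitin_def topspace_weak)
  have int: "(\<integral>x. ?f x \<partial>\<nu>) = measure \<nu> (cyl r k z)" if \<nu>: "\<nu> \<in> config_probs r" for \<nu>
  proof -
    interpret prob_space \<nu> using \<nu> by (simp add: config_probs_def)
    have "(\<integral>x. ?f x \<partial>\<nu>) = (\<integral>x. indicator (cyl r k z) x \<partial>\<nu>)"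
    proof (rule Bochner_Integration.integral_cong[OF refl])
      fix x assume "x \<in> space \<nu>"
      then have "x \<in> words r \<rightarrow>\<^sub>E spins" by (simp add: config_probs_space[OF \<nu>])
      then have "x \<in> cyl r k z \<longleftrightarrow> (\<forall>w\<in>word_ball r k. x w = z w)" by (simp add: cyl_def)
      moreover have "?f x = (if \<forall>w\<in>word_ball r k. x w = z w then 1 else 0)"
      proof (cases "\<forall>w\<in>word_ball r k. x w = z w")
        case False
        then obtain w where w: "w \<in> word_ball r k" "x w \<noteq> z w" by blast
        have "?f x = 0" by (rule prod_zero[OF finite_word_ball]) (rule bexI[OF _ w(1)], simp add: w(2))
        then show ?thesis using False by simp
      qed simp
      ultimately show "?f x = indicator (cyl r k z) x" by (simp add: indicator_def)
    qed
    then show ?thesis using cyl_sets[OF \<nu> z] by simp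
  qed
  show ?thesis
  proof (rule tendstoI)
    fix e :: real assume e: "e > 0"
    let ?U = "{\<nu> \<in> config_probs r. (\<integral>x. ?f x \<partial>\<nu>) \<in> ball (measure \<mu> (cyl r k z)) e}"
    have "openin (weak_topology r) ?U"
      unfolding weak_topology_def openin_topology_generated_by_iff
      by (rule generate_topology_on.Basis, rule CollectI, intro exI conjI) (rule refl continuous_cyl_indicator open_ball)+
    moreover have "\<mu> \<in> ?U" using \<mu> e by (simp add: int)
    ultimately have "eventually (\<lambda>m. \<rho> m \<in> ?U) sequentially"
      using assms(1) unfolding limitin_def by blast
    then show "eventually (\<lambda>m. dist (measure (\<rho> m) (cyl r k z)) (measure \<mu> (cyl r k z)) < e) sequentially"
    proof (rule eventually_mono)
      fix m assume "\<rho> m \<in> ?U"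
      then show "dist (measure (\<rho> m) (cyl r k z)) (measure \<mu> (cyl r k z)) < e"
        unfolding mem_Collect_eq int[OF assms(2)] by (simp add: dist_commute)
    qed
  qed
qed

lemma measure_from_cylinders:
  assumes \<rho>: "\<rho> \<in> config_probs r"
  shows "measure \<rho> {x \<in> words r \<rightarrow>\<^sub>E spins. P (restrict x (word_ball r k))} =
    (\<Sum>z\<in>word_ball r k \<rightarrow>\<^sub>E spins. (if P z then 1 else 0) * measure \<rho> (cyl r k z))"
proof -
  interpret prob_space \<rho> using \<rho> by (simp add: config_probs_def)
  let ?A = "{x \<in> words r \<rightarrow>\<^sub>E spins. P (restrict x (word_ball r k))}"
  have "?A = (\<Union>z\<in>{z \<in> word_ball r k \<rightarrow>\<^sub>E spins. P z}. cyl r k z)"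
  proof (intro equalityI subsetI)
    fix x assume x: "x \<in> ?A"
    then have "x \<in> cyl r k (restrict x (word_ball r k))" by (simp add: cyl_def)
    then show "x \<in> (\<Union>z\<in>{z \<in> word_ball r k \<rightarrow>\<^sub>E spins. P z}. cyl r k z)"
      using x restrict_ball_in by blast
  next
    fix x assume "x \<in> (\<Union>z\<in>{z \<in> word_ball r k \<rightarrow>\<^sub>E spins. P z}. cyl r k z)"
    then obtain z where z: "z \<in> word_ball r k \<rightarrow>\<^sub>E spins" "P z" "x \<in> cyl r k z" by blast
    then show "x \<in> ?A" using cyl_iff[of x r z k] by (auto simp: cyl_def)
  qed
  moreover have "finite {z \<in> word_ball r k \<rightarrow>\<^sub>E spins. P z}" by (simp add: finite_PiE)
  then have fin: "finite (cyl r k ` {z \<in> word_ball r k \<rightarrow>\<^sub>E spins. P z})" by simp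
  ultimately have A: "?A \<in> sets \<rho>" using cyl_sets[OF \<rho>] by (auto intro!: sets.finite_UN)
  have "measure \<rho> ?A = (\<integral>x. indicator ?A x \<partial>\<rho>)" using A by simp
  also have "\<dots> = (\<integral>x. (if P (restrict x (word_ball r k)) then 1 else 0) \<partial>\<rho>)"
    by (rule Bochner_Integration.integral_cong) (simp_all add: indicator_def config_probs_space[OF \<rho>])
  also have "\<dots> = (\<Sum>z\<in>word_ball r k \<rightarrow>\<^sub>E spins. (if P z then 1 else 0) * measure \<rho> (cyl r k z))"
    by (rule cylinder_integral(2)[OF \<rho>])
  finally show ?thesis .
qed

text \<open>A measure on the product is determined by its finite-dimensional sets, and each of these
  depends on finitely many words, hence on the spins of a ball.\<close>

lemma config_probs_eqI:
  assumes \<mu>: "\<mu> \<in> config_probs r" and \<nu>: "\<nu> \<in> config_probs r"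
    and eq: "\<And>k z. z \<in> word_ball r k \<rightarrow>\<^sub>E spins \<Longrightarrow> measure \<mu> (cyl r k z) = measure \<nu> (cyl r k z)"
  shows "\<mu> = \<nu>"
proof (rule measure_eqI_PiM_infinite)
  interpret M: prob_space \<mu> using \<mu> by (simp add: config_probs_def)
  interpret N: prob_space \<nu> using \<nu> by (simp add: config_probs_def)
  show "sets \<mu> = sets (\<Pi>\<^sub>M g\<in>words r. count_space spins)" "sets \<nu> = sets (\<Pi>\<^sub>M g\<in>words r. count_space spins)"
    using \<mu> \<nu> by (simp_all add: config_probs_def config_space_def)
  show "finite_measure \<mu>" by unfold_locales
  fix A and D :: "word set"
  assume D: "finite D" "D \<subseteq> words r"
  define k where "k = Max (insert 0 (length ` D))"
  have Dk: "D \<subseteq> word_ball r k" using D by (auto simp: k_def word_ball_def)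
  have eqA: "prod_emb (words r) (\<lambda>_. count_space spins) D (Pi\<^sub>E D A) =
      {x \<in> words r \<rightarrow>\<^sub>E spins. (\<forall>w\<in>D. restrict x (word_ball r k) w \<in> A w)}"
  proof -
    have "(\<forall>w\<in>D. restrict x (word_ball r k) w \<in> A w) \<longleftrightarrow> restrict x D \<in> Pi\<^sub>E D A" for x :: "word \<Rightarrow> real"
      unfolding restrict_PiE_iff using Dk by (intro ball_cong refl) (simp add: subset_iff)
    then show ?thesis unfolding prod_emb_def by auto
  qed
  show "emeasure \<mu> (prod_emb (words r) (\<lambda>_. count_space spins) D (Pi\<^sub>E D A)) =
      emeasure \<nu> (prod_emb (words r) (\<lambda>_. count_space spins) D (Pi\<^sub>E D A))"
    unfolding eqA M.emeasure_eq_measure N.emeasure_eq_measure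
      measure_from_cylinders[OF \<mu>, of "\<lambda>z. \<forall>w\<in>D. z w \<in> A w"]
      measure_from_cylinders[OF \<nu>, of "\<lambda>z. \<forall>w\<in>D. z w \<in> A w"]
    using eq by (simp cong: sum.cong)
qed

text \<open>Makes the \<open>THE\<close> in \<open>boundary_state\<close> well defined.\<close>

lemma weak_limit_unique:
  assumes "limitin (weak_topology r) \<rho> \<mu> sequentially" "limitin (weak_topology r) \<rho> \<nu> sequentially"
    "\<And>m. \<rho> m \<in> config_probs r"
  shows "\<mu> = \<nu>"
proof (rule config_probs_eqI)
  show "\<mu> \<in> config_probs r" "\<nu> \<in> config_probs r"
    using assms(1,2) by (simp_all add: limitin_def topspace_weak)
  show "measure \<mu> (cyl r k z) = measure \<nu> (cyl r k z)" if "z \<in> word_ball r k \<rightarrow>\<^sub>E spins" for k z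
    using LIMSEQ_unique[OF weak_limitD[OF assms(1,3) that] weak_limitD[OF assms(2,3) that]] .
qed

section \<open>The boundary states\<close>

definition ind :: "nat \<Rightarrow> nat \<Rightarrow> (word \<Rightarrow> real) \<Rightarrow> (word \<Rightarrow> real) \<Rightarrow> real" where
  "ind r k z y = (if \<forall>w\<in>word_ball r k. y w = z w then 1 else 0)"

lemma local_on_ind: "local_on (word_ball r k) (ind r k z)"
  unfolding local_on_def ind_def by auto

lemma normalized_prob_space:
  assumes "finite C" "C \<noteq> {}" "\<And>x. x \<in> C \<Longrightarrow> 0 < w x"
  shows "prob_space (normalized_measure C w)"
proof -
  have Z: "0 < sum w C" using assms by (intro sum_pos) auto
  have "(\<Sum>x\<in>C. ennreal (w x / sum w C)) = ennreal (\<Sum>x\<in>C. w x / sum w C)"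
    using assms(3) Z by (intro sum_ennreal) (auto intro: divide_nonneg_pos less_imp_le)
  also have "(\<Sum>x\<in>C. w x / sum w C) = 1" using Z by (simp add: sum_divide_distrib[symmetric])
  finally show ?thesis
    unfolding normalized_measure_def using assms(1) by (intro prob_space_point_measure) simp_all
qed

lemma measurable_normalized: "f \<in> measurable (normalized_measure C w) N \<longleftrightarrow> f \<in> C \<rightarrow> space N"
  unfolding normalized_measure_def by (rule measurable_point_measure_eq1)

lemma measure_distr_normalized:
  assumes "finite C" "\<And>x. x \<in> C \<Longrightarrow> 0 < w x" "f \<in> C \<rightarrow> space N" "S \<in> sets N"
  shows "measure (distr (normalized_measure C w) N f) S =
    (\<Sum>x\<in>C. (if f x \<in> S then 1 else 0) * w x) / sum w C"
proof -
  have pos: "0 \<le> w x / sum w C" if "x \<in> C" for x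
    using assms(2) that by (intro divide_nonneg_nonneg sum_nonneg) (auto intro: less_imp_le)
  have sp: "space (normalized_measure C w) = C"
    by (simp add: normalized_measure_def space_point_measure)
  have "measure (distr (normalized_measure C w) N f) S = measure (normalized_measure C w) (f -` S \<inter> C)"
    using measure_distr[OF measurable_normalized[THEN iffD2, OF assms(3)] assms(4)] sp by simp
  also have "\<dots> = (\<Sum>x\<in>f -` S \<inter> C. w x / sum w C)"
    unfolding normalized_measure_def by (subst measure_point_measure_finite_if) (use assms(1) pos in auto)
  also have "\<dots> = (\<Sum>x\<in>C. if f x \<in> S then w x / sum w C else 0)"
    using assms(1) by (subst sum.If_cases) (auto simp: vimage_def Int_commute intro!: sum.cong)
  also have "\<dots> = (\<Sum>x\<in>C. (if f x \<in> S then 1 else 0) * w x) / sum w C"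
    unfolding sum_divide_distrib by (intro sum.cong) auto
  finally show ?thesis .
qed

text \<open>Decimation leaves a fixed field as it is; this is the consistency behind the extension
  to the infinite tree.\<close>

lemma ball_exp_fixpoint:
  assumes "tree_map r \<beta> c = c" "1 \<le> k" "k \<le> k'" "local_on (word_ball r k) F"
  shows "ball_exp r \<beta> k' (\<lambda>_. c) F = ball_exp r \<beta> k (\<lambda>_. c) F"
  using ball_exp_decimate_const[OF assms(2,4), of \<beta> "k' - k" c] assms(3)
    funpow_fixpoint[where f = "tree_map r \<beta>", OF assms(1), of "k' - k"]
  by simp

text \<open>Real-valued spins with Borel sets, because the extension theorem is applied to
  projective families over a Polish space.\<close>

definition ball_law :: "nat \<Rightarrow> real \<Rightarrow> real \<Rightarrow> nat \<Rightarrow> word set \<Rightarrow> (word \<Rightarrow> real) measure" where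
  "ball_law r \<beta> c k D = distr (normalized_measure (word_ball r k \<rightarrow>\<^sub>E spins) (ball_weight r \<beta> k (\<lambda>_. c)))
     (\<Pi>\<^sub>M w\<in>D. borel) (\<lambda>z. restrict z D)"

lemma ball_law_measurable:
  "(\<lambda>z. restrict z D) \<in> measurable (normalized_measure (word_ball r k \<rightarrow>\<^sub>E spins) w) (\<Pi>\<^sub>M w\<in>D. (borel :: real measure))"
  unfolding measurable_normalized by (auto simp: space_PiM)

lemma prob_space_ball_law: "prob_space (ball_law r \<beta> c k D)"
  unfolding ball_law_def
  by (intro prob_space.prob_space_distr normalized_prob_space ball_law_measurable) auto

lemma measure_ball_law:
  assumes "A \<in> sets (\<Pi>\<^sub>M w\<in>D. borel)"
  shows "measure (ball_law r \<beta> c k D) A = ball_exp r \<beta> k (\<lambda>_. c) (\<lambda>z. if restrict z D \<in> A then 1 else 0)"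
  unfolding ball_law_def ball_exp_def ssum_def
  by (rule measure_distr_normalized[OF _ _ _ assms]) (auto simp: space_PiM)

lemma ball_law_level_le:
  assumes "tree_map r \<beta> c = c" "1 \<le> k" "k \<le> k'" "D \<subseteq> word_ball r k"
  shows "ball_law r \<beta> c k' D = ball_law r \<beta> c k D"
proof (rule measure_eqI)
  interpret A: prob_space "ball_law r \<beta> c k D" by (rule prob_space_ball_law)
  interpret B: prob_space "ball_law r \<beta> c k' D" by (rule prob_space_ball_law)
  show "sets (ball_law r \<beta> c k' D) = sets (ball_law r \<beta> c k D)" by (simp add: ball_law_def)
  fix A assume "A \<in> sets (ball_law r \<beta> c k' D)"
  then have A: "A \<in> sets (\<Pi>\<^sub>M w\<in>D. borel)" by (simp add: ball_law_def)
  have "local_on (word_ball r k) (\<lambda>z. if restrict z D \<in> A then 1 else 0 :: real)"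
    unfolding local_on_def
  proof (intro allI impI)
    fix z z' :: "word \<Rightarrow> real" assume "\<forall>w\<in>word_ball r k. z w = z' w"
    then have "restrict z D = restrict z' D" using assms(4) by (intro restrict_ext) blast
    then show "(if restrict z D \<in> A then 1 else 0 :: real) = (if restrict z' D \<in> A then 1 else 0)" by simp
  qed
  then show "emeasure (ball_law r \<beta> c k' D) A = emeasure (ball_law r \<beta> c k D) A"
    unfolding A.emeasure_eq_measure B.emeasure_eq_measure measure_ball_law[OF A]
    by (simp add: ball_exp_fixpoint[OF assms(1-3)])
qed

lemma ball_law_level:
  assumes "tree_map r \<beta> c = c" "1 \<le> k" "1 \<le> k'" "D \<subseteq> word_ball r k" "D \<subseteq> word_ball r k'"
  shows "ball_law r \<beta> c k' D = ball_law r \<beta> c k D"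
proof (cases "k \<le> k'")
  case True
  then show ?thesis by (rule ball_law_level_le[OF assms(1,2) _ assms(4)])
next
  case False
  then have "k' \<le> k" by simp
  then show ?thesis by (rule ball_law_level_le[OF assms(1,3) _ assms(5), symmetric])
qed

lemma ball_law_restrict:
  assumes "D \<subseteq> H"
  shows "distr (ball_law r \<beta> c k H) (\<Pi>\<^sub>M w\<in>D. borel) (\<lambda>f. restrict f D) = ball_law r \<beta> c k D"
proof -
  have eq: "(\<lambda>f. restrict f D) \<circ> (\<lambda>z. restrict z H) = (\<lambda>z. restrict z D)"
    using assms by (auto simp: fun_eq_iff restrict_def)
  show ?thesis
    unfolding ball_law_def distr_distr[OF measurable_restrict_subset[OF assms] ball_law_measurable] eq ..
qed

text \<open>\<open>Suc\<close> keeps the radius positive, as decimation of constant fields asks for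
  \<open>k \<ge> 1\<close>.\<close>

definition level :: "word set \<Rightarrow> nat" where
  "level D = Suc (Max (insert 0 (length ` D)))"

lemma level_ball: "finite D \<Longrightarrow> D \<subseteq> words r \<Longrightarrow> D \<subseteq> word_ball r (level D)"
  by (auto simp: level_def word_ball_def intro!: le_SucI Max_ge)

text \<open>Kolmogorov's extension theorem supplies the candidate for a boundary state; convergence
  to it can then be checked on cylinders.\<close>

lemma tree_measure_exists:
  assumes c: "tree_map r \<beta> c = c"
  shows "\<exists>\<mu>\<in>config_probs r. \<forall>k\<ge>1. \<forall>z\<in>word_ball r k \<rightarrow>\<^sub>E spins.
    measure \<mu> (cyl r k z) = ball_exp r \<beta> k (\<lambda>_. c) (ind r k z)"
proof -
  define P where "P D = ball_law r \<beta> c (level D) D" for D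
  have proj: "projective_family (words r) P (\<lambda>_. borel)"
  proof (rule projective_family.intro)
    fix D H :: "word set" assume DH: "D \<subseteq> H" "finite H" "H \<subseteq> words r"
    have H: "H \<subseteq> word_ball r (level H)" by (rule level_ball[OF DH(2,3)])
    have D: "D \<subseteq> word_ball r (level D)"
      using DH finite_subset by (intro level_ball) blast+
    have "distr (P H) (Pi\<^sub>M D (\<lambda>_. borel)) (\<lambda>f. restrict f D) = ball_law r \<beta> c (level H) D"
      unfolding P_def by (rule ball_law_restrict[OF DH(1)])
    also have "\<dots> = P D"
      unfolding P_def by (rule ball_law_level[OF c _ _ D]) (use DH H in \<open>auto simp: level_def\<close>)
    finally show "P D = distr (P H) (Pi\<^sub>M D (\<lambda>_. borel)) (\<lambda>f. restrict f D)" ..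
  next
    fix D :: "word set"
    show "prob_space (P D)" unfolding P_def by (rule prob_space_ball_law)
  qed
  interpret K: polish_projective "words r" P
    using proj by (simp add: polish_projective_def)
  \<comment> \<open>The projective limit lives on real-valued assignments; \<open>sg\<close> maps
    them to spins and fixes the values that are spins already.\<close>
  define sg where "sg t = (if t = 1 then 1 else -1 :: real)" for t :: real
  have sg: "sg \<in> measurable borel (count_space spins)"
    unfolding sg_def[abs_def] by (intro measurable_If measurable_const) (simp_all add: spins_def)
  have sg_id: "sg s = s" if "s \<in> spins" for s using that by (auto simp: sg_def spins_def)
  let ?\<phi> = "\<lambda>x. \<lambda>w\<in>words r. sg (x w)"
  have \<phi>: "?\<phi> \<in> measurable K.lim (config_space r)"
    unfolding config_space_def
  proof (rule measurable_restrict)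
    fix w assume "w \<in> words r"
    then have "(\<lambda>x. x w) \<in> measurable K.lim borel"
      by (subst measurable_cong_sets[OF K.sets_lim refl]) (rule measurable_component_singleton)
    from measurable_compose[OF this sg] show "(\<lambda>x. sg (x w)) \<in> measurable K.lim (count_space spins)" .
  qed
  define \<mu> where "\<mu> = distr K.lim (config_space r) ?\<phi>"
  have "prob_space K.lim" by (rule K.P.prob_space_axioms)
  then have \<mu>: "\<mu> \<in> config_probs r"
    unfolding \<mu>_def config_probs_def using prob_space.prob_space_distr[OF _ \<phi>] by simp
  have "measure \<mu> (cyl r k z) = ball_exp r \<beta> k (\<lambda>_. c) (ind r k z)"
    if k: "k \<ge> 1" and z: "z \<in> word_ball r k \<rightarrow>\<^sub>E spins" for k z
  proof -
    let ?B = "word_ball r k"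
    define X where "X = (\<Pi>\<^sub>E w\<in>?B. sg -` {z w})"
    have "sg -` {z w} \<in> sets borel" if "w \<in> ?B" for w
      using measurable_sets[OF sg, of "{z w}"] PiE_mem[OF z that] by simp
    then have X: "X \<in> sets (\<Pi>\<^sub>M w\<in>?B. borel)"
      unfolding X_def by (intro sets_PiM_I_finite) auto
    have vim: "?\<phi> -` cyl r k z \<inter> space K.lim = prod_emb (words r) (\<lambda>_. borel) ?B X"
    proof -
      have "?\<phi> x \<in> words r \<rightarrow>\<^sub>E spins" for x by (simp add: sg_def spins_def)
      then have "x \<in> ?\<phi> -` cyl r k z \<longleftrightarrow> restrict x ?B \<in> X" for x
        unfolding cyl_def X_def restrict_PiE_iff vimage_eq mem_Collect_eq singleton_iff
        using ball_subset_words[of r k] by (auto simp: subset_iff)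
      then show ?thesis
        unfolding prod_emb_def K.space_lim space_PiM by blast
    qed
    have "measure \<mu> (cyl r k z) = measure K.lim (prod_emb (words r) (\<lambda>_. borel) ?B X)"
      unfolding \<mu>_def measure_distr[OF \<phi> cyl_measurable[OF z]] vim ..
    also have "\<dots> = measure (P ?B) X"
      by (rule K.measure_lim_emb[OF ball_subset_words finite_word_ball X])
    also have "P ?B = ball_law r \<beta> c k ?B"
      unfolding P_def
      by (rule ball_law_level[OF c k _ order_refl level_ball[OF finite_word_ball ball_subset_words]])
        (simp add: level_def)
    also have "measure \<dots> X = ball_exp r \<beta> k (\<lambda>_. c) (\<lambda>y. if restrict y ?B \<in> X then 1 else 0)"
      by (rule measure_ball_law[OF X])
    also have "\<dots> = ball_exp r \<beta> k (\<lambda>_. c) (ind r k z)"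
    proof (rule ball_exp_cong[OF refl])
      fix y assume y: "y \<in> ?B \<rightarrow>\<^sub>E spins"
      have "restrict y ?B \<in> X \<longleftrightarrow> (\<forall>w\<in>?B. y w = z w)"
        unfolding X_def restrict_PiE_iff vimage_eq singleton_iff
        using sg_id PiE_mem[OF y] by (intro ball_cong) simp_all
      then show "(if restrict y ?B \<in> X then 1 else 0) = ind r k z y" by (simp add: ind_def)
    qed
    finally show ?thesis .
  qed
  then show ?thesis using \<mu> by blast
qed

section \<open>Convergence of the Gibbs states on balls\<close>

definition fill :: "nat \<Rightarrow> real \<Rightarrow> nat \<Rightarrow> (word \<Rightarrow> real) \<Rightarrow> word \<Rightarrow> real" where
  "fill r b R z = (\<lambda>w\<in>words r. if w \<in> word_ball r R then z w else b)"

abbreviation ball_confs :: "nat \<Rightarrow> real \<Rightarrow> nat \<Rightarrow> (word \<Rightarrow> real) set" where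
  "ball_confs r b R \<equiv> {x \<in> words r \<rightarrow>\<^sub>E spins. \<forall>g\<in>words r - word_ball r R. x g = b}"

lemma bij_fill:
  assumes "b \<in> spins"
  shows "bij_betw (fill r b R) (word_ball r R \<rightarrow>\<^sub>E spins) (ball_confs r b R)"
proof (rule bij_betw_byWitness[where f' = "\<lambda>x. restrict x (word_ball r R)"])
  show "\<forall>z\<in>word_ball r R \<rightarrow>\<^sub>E spins. restrict (fill r b R z) (word_ball r R) = z"
    using ball_subset_words[of r R] by (auto simp: fill_def fun_eq_iff PiE_def extensional_def subset_iff)
  show "\<forall>x\<in>ball_confs r b R. fill r b R (restrict x (word_ball r R)) = x"
    by (auto simp: fill_def fun_eq_iff PiE_def extensional_def)
  show "fill r b R ` (word_ball r R \<rightarrow>\<^sub>E spins) \<subseteq> ball_confs r b R"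
    using assms by (auto simp: fill_def dest: PiE_mem)
  show "(\<lambda>x. restrict x (word_ball r R)) ` ball_confs r b R \<subseteq> word_ball r R \<rightarrow>\<^sub>E spins"
    using ball_subset_words[of r R] by (auto dest: PiE_mem simp: subset_iff)
qed

lemma edges_meeting_ball:
  "{e \<in> tree_edges r. e \<inter> word_ball r R \<noteq> {}} = (\<lambda>w. {w, tl w}) ` (word_ball r (Suc R) - {[]})"
proof -
  have "{w, tl w} \<inter> word_ball r R \<noteq> {} \<longleftrightarrow> w \<in> word_ball r (Suc R)" if "w \<in> words r - {[]}" for w
  proof -
    have "tl w \<in> words r" "length w = Suc (length (tl w))" using that tl_in_words by simp_all
    then show ?thesis using that by (auto simp: word_ball_def)
  qed
  moreover have "word_ball r (Suc R) - {[]} \<subseteq> words r - {[]}" using ball_subset_words by blast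
  ultimately show ?thesis unfolding tree_edges_eq by blast
qed

lemma gibbs_weight_fill:
  assumes "R \<ge> 1"
  shows "gibbs_weight r J (word_ball r R) (fill r b R z) =
    ball_weight r J R (\<lambda>_. b * (real (2 * r - 1) * J)) z"
proof -
  let ?x = "fill r b R z"
  have "(\<Sum>e | e \<in> tree_edges r \<and> e \<inter> word_ball r R \<noteq> {}. \<Prod>g\<in>e. ?x g) =
      (\<Sum>w\<in>word_ball r (Suc R) - {[]}. \<Prod>g\<in>{w, tl w}. ?x g)"
    unfolding edges_meeting_ball
    by (rule sum.reindex[unfolded comp_def]) (rule inj_on_subset[OF edge_inj], use ball_subset_words in blast)
  also have "\<dots> = (\<Sum>w\<in>word_ball r (Suc R) - {[]}. ?x w * ?x (tl w))"
  proof (intro sum.cong refl)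
    fix w assume "w \<in> word_ball r (Suc R) - {[]}"
    then have "w \<noteq> tl w" by (cases w) simp_all
    then show "(\<Prod>g\<in>{w, tl w}. ?x g) = ?x w * ?x (tl w)" by simp
  qed
  also have "\<dots> = (\<Sum>w\<in>word_ball r R - {[]}. ?x w * ?x (tl w)) + (\<Sum>w\<in>word_sphere r (Suc R). ?x w * ?x (tl w))"
    by (rule sum_ball_Suc)
  also have "(\<Sum>w\<in>word_ball r R - {[]}. ?x w * ?x (tl w)) = (\<Sum>w\<in>word_ball r R - {[]}. z w * z (tl w))"
  proof (intro sum.cong refl)
    fix w assume "w \<in> word_ball r R - {[]}"
    then have "w \<in> word_ball r R" "tl w \<in> word_ball r R" using tl_in_ball by blast+
    then show "?x w * ?x (tl w) = z w * z (tl w)" using word_ball_in by (simp add: fill_def)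
  qed
  also have "(\<Sum>w\<in>word_sphere r (Suc R). ?x w * ?x (tl w)) = (\<Sum>p\<in>word_sphere r R. b * real (2 * r - 1) * z p)"
  proof -
    have "(\<Sum>w\<in>word_sphere r (Suc R). ?x w * ?x (tl w)) = (\<Sum>p\<in>word_sphere r R. \<Sum>w\<in>children r p. b * z p)"
      unfolding sum_sphere_Suc
    proof (intro sum.cong refl)
      fix p w assume p: "p \<in> word_sphere r R" and w: "w \<in> children r p"
      then have "w \<in> word_sphere r (Suc R)" "tl w = p" using children_sphere[OF p] by (auto simp: children_def)
      then have "w \<in> words r" "w \<notin> word_ball r R" by (auto simp: word_sphere_def word_ball_def)
      moreover have "p \<in> word_ball r R" "p \<in> words r" using p by (auto simp: word_sphere_def word_ball_def)
      ultimately show "?x w * ?x (tl w) = b * z p" using \<open>tl w = p\<close> by (simp add: fill_def)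
    qed
    also have "\<dots> = (\<Sum>p\<in>word_sphere r R. b * real (2 * r - 1) * z p)"
    proof (intro sum.cong refl)
      fix p assume "p \<in> word_sphere r R"
      then have "p \<in> words r" "p \<noteq> []" using assms by (auto simp: word_sphere_def)
      then show "(\<Sum>w\<in>children r p. b * z p) = b * real (2 * r - 1) * z p"
        unfolding sum_constant card_children[OF \<open>p \<in> words r\<close> \<open>p \<noteq> []\<close>] by (simp only: mult_ac)
    qed
    finally show ?thesis .
  qed
  finally show ?thesis
    unfolding gibbs_weight_def ball_weight_def
    by (simp add: distrib_left sum_distrib_left mult_ac)
qed

lemma finite_ball_confs:
  assumes "b \<in> spins"
  shows "finite (ball_confs r b R)" "ball_confs r b R \<noteq> {}"
  using confs_nonempty[of "word_ball r R"] unfolding bij_betw_imp_surj_on[OF bij_fill[OF assms], symmetric]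
  by simp_all

lemma ball_gibbs_config_probs:
  assumes "b \<in> spins"
  shows "ball_gibbs r J b R \<in> config_probs r"
proof -
  have "(\<lambda>x. x) \<in> ball_confs r b R \<rightarrow> space (config_space r)" by (auto simp: space_config)
  then have "prob_space (ball_gibbs r J b R)"
    unfolding ball_gibbs_def tree_ball_eq
    by (intro prob_space.prob_space_distr normalized_prob_space finite_ball_confs[OF assms] measurable_normalized[THEN iffD2])
      (simp_all add: gibbs_weight_def)
  then show ?thesis by (simp add: config_probs_def ball_gibbs_def)
qed

lemma measure_ball_gibbs:
  assumes b: "b \<in> spins" and k: "1 \<le> k" "k \<le> R" and z: "z \<in> word_ball r k \<rightarrow>\<^sub>E spins"
  shows "measure (ball_gibbs r J b R) (cyl r k z) =
    ball_exp r J R (\<lambda>_. b * (real (2 * r - 1) * J)) (ind r k z)"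
proof -
  let ?w = "gibbs_weight r J (word_ball r R)"
  have R: "R \<ge> 1" using k by simp
  have "(\<lambda>x. x) \<in> ball_confs r b R \<rightarrow> space (config_space r)" by (auto simp: space_config)
  then have "measure (ball_gibbs r J b R) (cyl r k z) =
      (\<Sum>x\<in>ball_confs r b R. (if x \<in> cyl r k z then 1 else 0) * ?w x) / sum ?w (ball_confs r b R)"
    unfolding ball_gibbs_def tree_ball_eq
    by (intro measure_distr_normalized finite_ball_confs[OF b] cyl_measurable[OF z]) (simp_all add: gibbs_weight_def)
  also have "\<dots> = ssum (word_ball r R) (\<lambda>y. (if fill r b R y \<in> cyl r k z then 1 else 0) * ?w (fill r b R y)) /
      ssum (word_ball r R) (\<lambda>y. ?w (fill r b R y))"
    unfolding ssum_def
    by (subst (1 2) sum.reindex_bij_betw[OF bij_fill[OF b], symmetric]) (rule refl)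
  also have "\<dots> = ball_exp r J R (\<lambda>_. b * (real (2 * r - 1) * J)) (ind r k z)"
    unfolding gibbs_weight_fill[OF R] ball_exp_def
  proof (rule arg_cong2[where f = "(/)"], rule ssum_cong)
    fix y assume y: "y \<in> word_ball r R \<rightarrow>\<^sub>E spins"
    have "fill r b R y \<in> ball_confs r b R" using bij_betwE[OF bij_fill[OF b]] y by blast
    then have "fill r b R y \<in> words r \<rightarrow>\<^sub>E spins" by blast
    moreover have "fill r b R y w = y w" if "w \<in> word_ball r k" for w
      using that word_ball_mono[OF k(2), of r] word_ball_in[OF that] by (auto simp: fill_def)
    ultimately have "fill r b R y \<in> cyl r k z \<longleftrightarrow> (\<forall>w\<in>word_ball r k. y w = z w)"
      by (simp add: cyl_def)
    then show "(if fill r b R y \<in> cyl r k z then 1 else 0) * ball_weight r J R (\<lambda>_. b * (real (2 * r - 1) * J)) y =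
      ind r k z y * ball_weight r J R (\<lambda>_. b * (real (2 * r - 1) * J)) y"
      by (simp add: ind_def)
  qed simp
  finally show ?thesis .
qed

lemma tree_map_sign: "b \<in> spins \<Longrightarrow> tree_map r \<beta> (b * x) = b * tree_map r \<beta> x"
  by (auto simp: spins_def tree_map_def)

lemma tree_map_iter_sign: "b \<in> spins \<Longrightarrow> (tree_map r \<beta> ^^ m) (b * x) = b * (tree_map r \<beta> ^^ m) x"
  by (induction m) (simp_all add: tree_map_sign)

lemma boundary_state:
  assumes J: "J > 0" and b: "b \<in> spins"
  shows "boundary_state r J b \<in> config_probs r"
    and "k \<ge> 1 \<Longrightarrow> z \<in> word_ball r k \<rightarrow>\<^sub>E spins \<Longrightarrow>
      measure (boundary_state r J b) (cyl r k z) = ball_exp r J k (\<lambda>_. b * plus_field r J) (ind r k z)"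
proof -
  have "tree_map r J (b * plus_field r J) = b * plus_field r J"
    unfolding tree_map_sign[OF b] tree_map_plus_field[OF J] ..
  then obtain \<mu> where \<mu>: "\<mu> \<in> config_probs r" "\<forall>k\<ge>1. \<forall>z\<in>word_ball r k \<rightarrow>\<^sub>E spins.
    measure \<mu> (cyl r k z) = ball_exp r J k (\<lambda>_. b * plus_field r J) (ind r k z)"
    using tree_measure_exists by blast
  have lim: "limitin (weak_topology r) (ball_gibbs r J b) \<mu> sequentially"
  proof (rule weak_limitI[OF ball_gibbs_config_probs[OF b] \<mu>(1)])
    fix k z assume k: "(1::nat) \<le> k" and z: "z \<in> word_ball r k \<rightarrow>\<^sub>E spins"
    \<comment> \<open>The shift by \<open>k\<close> makes \<open>m\<close> the number of decimation
      steps, so the field is exactly the \<open>m\<close>-th iterate.\<close>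
    have eq: "measure (ball_gibbs r J b (m + k)) (cyl r k z) =
        ball_exp r J k (\<lambda>_. b * field_bound r J m) (ind r k z)" for m
    proof -
      have "measure (ball_gibbs r J b (m + k)) (cyl r k z) =
          ball_exp r J (k + m) (\<lambda>_. b * (real (2 * r - 1) * J)) (ind r k z)"
        unfolding add.commute[of m k] by (rule measure_ball_gibbs[OF b k le_add1 z])
      also have "\<dots> = ball_exp r J k (\<lambda>_. b * field_bound r J m) (ind r k z)"
        unfolding ball_exp_decimate_const[OF k local_on_ind] tree_map_iter_sign[OF b] field_bound_def ..
      finally show ?thesis .
    qed
    have "(\<lambda>m. ball_exp r J k (\<lambda>_. b * field_bound r J m) (ind r k z)) \<longlonglongrightarrow>
        ball_exp r J k (\<lambda>_. b * plus_field r J) (ind r k z)"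
      by (rule ball_exp_tendsto) (rule tendsto_mult_left[OF field_bound_tendsto[OF J]])
    then have "(\<lambda>m. measure (ball_gibbs r J b (m + k)) (cyl r k z)) \<longlonglongrightarrow> measure \<mu> (cyl r k z)"
      using \<mu>(2) k z by (simp only: eq)
    then show "(\<lambda>m. measure (ball_gibbs r J b m) (cyl r k z)) \<longlonglongrightarrow> measure \<mu> (cyl r k z)"
      by (rule LIMSEQ_offset)
  qed
  have "boundary_state r J b = \<mu>"
    unfolding boundary_state_def
  proof (rule the_equality)
    show "limitin (weak_topology r) (ball_gibbs r J b) \<mu> sequentially" by (rule lim)
    show "\<nu> = \<mu>" if "limitin (weak_topology r) (ball_gibbs r J b) \<nu> sequentially" for \<nu>
      by (rule weak_limit_unique[OF that lim ball_gibbs_config_probs[OF b]])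
  qed
  then show "boundary_state r J b \<in> config_probs r"
    and "k \<ge> 1 \<Longrightarrow> z \<in> word_ball r k \<rightarrow>\<^sub>E spins \<Longrightarrow>
      measure (boundary_state r J b) (cyl r k z) = ball_exp r J k (\<lambda>_. b * plus_field r J) (ind r k z)"
    using \<mu> by simp_all
qed

lemma average_measure:
  assumes \<mu>: "\<mu> \<in> config_probs r" and \<nu>: "\<nu> \<in> config_probs r"
  shows "average_measure \<mu> \<nu> \<in> config_probs r"
    and "A \<in> sets (config_space r) \<Longrightarrow> measure (average_measure \<mu> \<nu>) A = (measure \<mu> A + measure \<nu> A) / 2"
proof -
  interpret M: prob_space \<mu> using \<mu> by (simp add: config_probs_def)
  interpret N: prob_space \<nu> using \<nu> by (simp add: config_probs_def)
  have sets: "sets \<mu> = sets (config_space r)" "sets \<nu> = sets (config_space r)"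
    using \<mu> \<nu> by (simp_all add: config_probs_def)
  have em: "emeasure (average_measure \<mu> \<nu>) A = (emeasure \<mu> A + emeasure \<nu> A) / 2" if "A \<in> sets \<mu>" for A
    unfolding average_measure_def
  proof (rule emeasure_measure_of_sigma[OF sets.sigma_algebra_axioms _ _ that])
    show "positive (sets \<mu>) (\<lambda>A. (emeasure \<mu> A + emeasure \<nu> A) / 2)" by (simp add: positive_def)
    show "countably_additive (sets \<mu>) (\<lambda>A. (emeasure \<mu> A + emeasure \<nu> A) / 2)"
    proof (rule countably_additiveI)
      fix A :: "nat \<Rightarrow> (word \<Rightarrow> real) set" assume A: "range A \<subseteq> sets \<mu>" "disjoint_family A"
      have "(\<Sum>i. (emeasure \<mu> (A i) + emeasure \<nu> (A i)) / 2) = (\<Sum>i. emeasure \<mu> (A i) + emeasure \<nu> (A i)) / 2"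
        by (rule ennreal_suminf_divide)
      also have "(\<Sum>i. emeasure \<mu> (A i) + emeasure \<nu> (A i)) = (\<Sum>i. emeasure \<mu> (A i)) + (\<Sum>i. emeasure \<nu> (A i))"
        by (rule suminf_add[symmetric]) simp_all
      also have "\<dots> = emeasure \<mu> (\<Union>i. A i) + emeasure \<nu> (\<Union>i. A i)"
        using A sets by (simp add: suminf_emeasure)
      finally show "(\<Sum>i. (emeasure \<mu> (A i) + emeasure \<nu> (A i)) / 2) =
        (emeasure \<mu> (\<Union>i. A i) + emeasure \<nu> (\<Union>i. A i)) / 2" .
    qed
  qed
  have s: "sets (average_measure \<mu> \<nu>) = sets (config_space r)" "space (average_measure \<mu> \<nu>) = space \<mu>"
    unfolding average_measure_def sets(1)[symmetric] by (simp_all add: sets.space_closed)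
  have half: "(ennreal a + ennreal b) / 2 = ennreal ((a + b) / 2)" if "a \<ge> 0" "b \<ge> 0" for a b
    using that by (simp add: ennreal_plus[symmetric] divide_ennreal[symmetric] del: ennreal_plus)
  have "space \<nu> = space \<mu>" using \<mu> \<nu> by (simp add: config_probs_space)
  then have "emeasure (average_measure \<mu> \<nu>) (space (average_measure \<mu> \<nu>)) = 1"
    using half[of 1 1] em[OF sets.top] M.emeasure_space_1 N.emeasure_space_1 by (simp add: s(2))
  then have "prob_space (average_measure \<mu> \<nu>)" by (rule prob_spaceI)
  then show "average_measure \<mu> \<nu> \<in> config_probs r" using s(1) by (simp add: config_probs_def)
  show "measure (average_measure \<mu> \<nu>) A = (measure \<mu> A + measure \<nu> A) / 2" if "A \<in> sets (config_space r)"
    using em[of A] that sets half[of "measure \<mu> A" "measure \<nu> A"]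
    by (simp add: measure_def[of "average_measure \<mu> \<nu>"] M.emeasure_eq_measure N.emeasure_eq_measure)
qed

section \<open>Random permutation representations\<close>

definition letter_perm :: "(nat \<Rightarrow> nat \<Rightarrow> nat) \<Rightarrow> nat \<times> bool \<Rightarrow> nat \<Rightarrow> nat" where
  "letter_perm \<pi> a = (if snd a then \<pi> (fst a) else Hilbert_Choice.inv (\<pi> (fst a)))"

definition word_perm :: "(nat \<Rightarrow> nat \<Rightarrow> nat) \<Rightarrow> word \<Rightarrow> nat \<Rightarrow> nat" where
  "word_perm \<pi> w = foldr (\<lambda>a f. letter_perm \<pi> a \<circ> f) w id"

definition hom_of :: "nat \<Rightarrow> (nat \<Rightarrow> nat \<Rightarrow> nat) \<Rightarrow> word \<Rightarrow> nat \<Rightarrow> nat" where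
  "hom_of r \<pi> = restrict (word_perm \<pi>) (words r)"

lemma word_perm_simps [simp]: "word_perm \<pi> [] = id" "word_perm \<pi> (a # w) = letter_perm \<pi> a \<circ> word_perm \<pi> w"
  by (simp_all add: word_perm_def)

context
  fixes r n :: nat and \<pi> :: "nat \<Rightarrow> nat \<Rightarrow> nat"
  assumes \<pi>: "\<And>i. i \<in> {1..r} \<Longrightarrow> \<pi> i permutes {1..n}"
begin

lemma letter_perm_permutes: "a \<in> letters r \<Longrightarrow> letter_perm \<pi> a permutes {1..n}"
  using \<pi>[of "fst a"] by (auto simp: letter_perm_def letters_def permutes_inv)

lemma letter_perm_cancel: "a \<in> letters r \<Longrightarrow> letter_perm \<pi> a \<circ> letter_perm \<pi> (inv_letter a) = id"
  using \<pi>[of "fst a"] permutes_inv_o[of "\<pi> (fst a)"]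
  by (auto simp: letter_perm_def letters_def inv_letter_def)

lemma word_perm_permutes: "set w \<subseteq> letters r \<Longrightarrow> word_perm \<pi> w permutes {1..n}"
proof (induction w)
  case Nil
  show ?case unfolding word_perm_simps by (rule permutes_id)
next
  case (Cons a w)
  then show ?case unfolding word_perm_simps
    by (intro permutes_compose letter_perm_permutes) auto
qed

lemma word_perm_letter_mult:
  assumes "a \<in> letters r" "w \<in> words r"
  shows "word_perm \<pi> (letter_mult a w) = letter_perm \<pi> a \<circ> word_perm \<pi> w"
  using assms(2,1)
proof (cases rule: letter_mult_cases)
  case 1
  then show ?thesis by simp
next
  case 2
  have w: "w = hd w # tl w" using 2(1) by simp
  have hd: "hd w = inv_letter a" using 2(2) by simp
  have "letter_perm \<pi> a \<circ> word_perm \<pi> w = letter_perm \<pi> a \<circ> (letter_perm \<pi> (hd w) \<circ> word_perm \<pi> (tl w))"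
    by (subst w) simp
  also have "\<dots> = (letter_perm \<pi> a \<circ> letter_perm \<pi> (inv_letter a)) \<circ> word_perm \<pi> (tl w)"
    unfolding hd by (rule comp_assoc[symmetric])
  also have "\<dots> = word_perm \<pi> (tl w)" unfolding letter_perm_cancel[OF assms(1)] by simp
  finally show ?thesis using 2(3) by simp
qed

lemma word_perm_mult:
  "set u \<subseteq> letters r \<Longrightarrow> w \<in> words r \<Longrightarrow> word_perm \<pi> (foldr letter_mult u w) = word_perm \<pi> u \<circ> word_perm \<pi> w"
proof (induction u)
  case (Cons a u)
  then have "a \<in> letters r" "foldr letter_mult u w \<in> words r" using foldr_letter_mult_in by auto
  from word_perm_letter_mult[OF this] show ?case using Cons by (simp add: comp_assoc)
qed simp

text \<open>The universal property of the free group: the images of the generators may be prescribed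
  freely. It supplies the modified homomorphisms of the switching argument.\<close>

lemma hom_of_in: "hom_of r \<pi> \<in> perm_homs r n"
proof -
  have "hom_of r \<pi> \<in> hom (free_group r) (sym_group n)"
  proof (rule homI)
    show "hom_of r \<pi> w \<in> carrier (sym_group n)" if "w \<in> words r" for w
      using word_perm_permutes[OF words_set[OF that]] that by (simp add: sym_group_carrier hom_of_def)
    show "hom_of r \<pi> (u \<otimes>\<^bsub>free_group r\<^esub> w) = hom_of r \<pi> u \<otimes>\<^bsub>sym_group n\<^esub> hom_of r \<pi> w"
      if "u \<in> words r" "w \<in> words r" for u w
      using word_perm_mult[OF words_set[OF that(1)] that(2)] foldr_letter_mult_in[OF words_set[OF that(1)] that(2)] that
      by (simp add: hom_of_def sym_group_mult mult_free_group)
  qed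
  then show ?thesis by (simp add: perm_homs_def hom_of_def)
qed

lemma hom_of_letter: "a \<in> letters r \<Longrightarrow> hom_of r \<pi> [a] = letter_perm \<pi> a"
  by (simp add: hom_of_def)

end

lemma perm_hom_eqI:
  assumes "\<sigma> \<in> perm_homs r n" "\<tau> \<in> perm_homs r n" "\<And>a. a \<in> letters r \<Longrightarrow> \<sigma> [a] = \<tau> [a]"
  shows "\<sigma> = \<tau>"
proof (rule extensionalityI)
  show "\<sigma> \<in> extensional (words r)" "\<tau> \<in> extensional (words r)"
    using assms(1,2) by (simp_all add: perm_homs_def)
  show "\<sigma> w = \<tau> w" if "w \<in> words r" for w
    using that
  proof (induction w)
    case Nil
    show ?case using assms(1,2) by (simp add: perm_hom_Nil)
  next
    case (Cons a w)
    then have "a \<in> letters r" "w \<in> words r" by (auto simp: Cons_in_words)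
    then show ?case
      using perm_hom_Cons[OF assms(1) Cons.prems] perm_hom_Cons[OF assms(2) Cons.prems] Cons.IH assms(3) by simp
  qed
qed

lemma perm_hom_inv:
  assumes "\<sigma> \<in> perm_homs r n" "a \<in> letters r"
  shows "\<sigma> [inv_letter a] = Hilbert_Choice.inv (\<sigma> [a])"
proof -
  have 1: "\<sigma> [inv_letter a] \<circ> \<sigma> [a] = id"
    using perm_hom_inv_letter[OF assms] by (simp add: fun_eq_iff)
  have "\<sigma> [a] \<circ> \<sigma> [inv_letter a] = id"
    using perm_hom_inv_letter[OF assms(1), of "inv_letter a"] assms(2) by (simp add: fun_eq_iff)
  then show ?thesis using 1 by (rule inv_unique_comp[symmetric])
qed

lemma perm_hom_letter_perm:
  assumes "\<sigma> \<in> perm_homs r n" "a \<in> letters r"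
  shows "\<sigma> [a] = letter_perm (\<lambda>i. \<sigma> [(i, True)]) a"
proof (cases "snd a")
  case True
  then have "a = (fst a, True)" by (simp add: prod_eq_iff)
  then show ?thesis using True by (simp add: letter_perm_def)
next
  case False
  define b where "b = (fst a, True)"
  have "a = inv_letter b" "b \<in> letters r" using False assms(2) by (auto simp: b_def inv_letter_def letters_def prod_eq_iff)
  then have "\<sigma> [a] = Hilbert_Choice.inv (\<sigma> [b])" using perm_hom_inv[OF assms(1), of b] by simp
  then show ?thesis using False unfolding letter_perm_def b_def by simp
qed

lemma finite_perm_homs: "finite (perm_homs r n)"
proof (rule finite_imageD)
  let ?\<Phi> = "\<lambda>\<sigma>. \<lambda>a\<in>letters r. \<sigma> [a]"
  show "finite (?\<Phi> ` perm_homs r n)"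
  proof (rule finite_subset)
    show "?\<Phi> ` perm_homs r n \<subseteq> letters r \<rightarrow>\<^sub>E {p. p permutes {1..n}}"
      using perm_hom_permutes by auto
    show "finite (letters r \<rightarrow>\<^sub>E {p. p permutes {1..n}})"
      by (intro finite_PiE finite_letters finite_permutations) simp
  qed
  show "inj_on ?\<Phi> (perm_homs r n)"
  proof (rule inj_onI)
    fix \<sigma> \<tau> assume st: "\<sigma> \<in> perm_homs r n" "\<tau> \<in> perm_homs r n" "?\<Phi> \<sigma> = ?\<Phi> \<tau>"
    show "\<sigma> = \<tau>"
    proof (rule perm_hom_eqI[OF st(1,2)])
      fix a assume "a \<in> letters r"
      then show "\<sigma> [a] = \<tau> [a]" using fun_cong[OF st(3), of a] by simp
    qed
  qed
qed

lemma perm_homs_nonempty: "perm_homs r n \<noteq> {}"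
proof -
  have "hom_of r (\<lambda>_. id) \<in> perm_homs r n" by (rule hom_of_in) (rule permutes_id)
  then show ?thesis by blast
qed

section \<open>Walks along words, simple cycles and switching\<close>

lemma append_in_words:
  assumes "u @ w \<in> words r"
  shows "u \<in> words r" "w \<in> words r"
  using assms by (auto simp: free_group_def reduced_def successively_append_iff)

lemma perm_hom_append:
  assumes "\<sigma> \<in> perm_homs r n" "u @ w \<in> words r"
  shows "\<sigma> (u @ w) = \<sigma> u \<circ> \<sigma> w"
  using assms(2)
proof (induction u)
  case Nil
  show ?case by (simp add: perm_hom_Nil[OF assms(1)])
next
  case (Cons a u)
  then have 1: "a # (u @ w) \<in> words r" by simp
  then have 2: "u @ w \<in> words r" by (simp add: Cons_in_words)
  have 3: "a # u \<in> words r" using append_in_words(1)[of "a # u" w] Cons.prems by simp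
  show ?case
    using perm_hom_Cons[OF assms(1) 1] perm_hom_Cons[OF assms(1) 3] Cons.IH[OF 2] by (simp add: comp_assoc)
qed

lemma perm_hom_inj: "\<sigma> \<in> perm_homs r n \<Longrightarrow> w \<in> words r \<Longrightarrow> \<sigma> w x = \<sigma> w y \<longleftrightarrow> x = y"
  using permutes_inj[OF perm_hom_permutes] by (metis inj_eq)

lemma drop_in_words: "w \<in> words r \<Longrightarrow> drop j w \<in> words r"
  using append_in_words(2)[of "take j w" "drop j w" r] by simp

text \<open>The walk from \<open>u\<close> along \<open>w\<close> reads \<open>w\<close> from its end; it closes up after visiting
  \<open>length w\<close> distinct vertices.\<close>

definition cyc :: "nat \<Rightarrow> nat \<Rightarrow> word \<Rightarrow> nat \<Rightarrow> (word \<Rightarrow> nat \<Rightarrow> nat) set" where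
  "cyc r n w u = {\<sigma> \<in> perm_homs r n. \<sigma> w u = u \<and> inj_on (\<lambda>j. \<sigma> (drop j w) u) {1..length w}}"

definition cycle_vertices :: "(word \<Rightarrow> nat \<Rightarrow> nat) \<Rightarrow> word \<Rightarrow> nat \<Rightarrow> nat set" where
  "cycle_vertices \<sigma> w u = (\<lambda>j. \<sigma> (drop j w) u) ` {1..length w}"

text \<open>Only generators can be prescribed. For an inverse letter the transposition therefore
  goes to the other side of the generator, so that in both cases it follows the action of
  \<open>a\<close>.\<close>

definition switch :: "nat \<Rightarrow> nat \<times> bool \<Rightarrow> nat \<Rightarrow> nat \<Rightarrow> (word \<Rightarrow> nat \<Rightarrow> nat) \<Rightarrow> word \<Rightarrow> nat \<Rightarrow> nat" where
  "switch r a q z \<sigma> = hom_of r (\<lambda>j. if j = fst a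
     then (if snd a then Transposition.transpose q z \<circ> \<sigma> [(j, True)] else \<sigma> [(j, True)] \<circ> Transposition.transpose q z)
     else \<sigma> [(j, True)])"

lemma switch:
  assumes \<sigma>: "\<sigma> \<in> perm_homs r n" and a: "a \<in> letters r" and qz: "q \<in> {1..n}" "z \<in> {1..n}"
  shows "switch r a q z \<sigma> \<in> perm_homs r n"
    and "switch r a q z \<sigma> [a] = Transposition.transpose q z \<circ> \<sigma> [a]"
    and "switch r a q z \<sigma> [inv_letter a] = \<sigma> [inv_letter a] \<circ> Transposition.transpose q z"
    and "b \<in> letters r \<Longrightarrow> b \<noteq> a \<Longrightarrow> b \<noteq> inv_letter a \<Longrightarrow> switch r a q z \<sigma> [b] = \<sigma> [b]"
proof -
  define \<pi> where "\<pi> = (\<lambda>j. if j = fst a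
     then (if snd a then Transposition.transpose q z \<circ> \<sigma> [(j, True)] else \<sigma> [(j, True)] \<circ> Transposition.transpose q z)
     else \<sigma> [(j, True)])"
  have sw: "switch r a q z \<sigma> = hom_of r \<pi>" by (simp add: switch_def \<pi>_def)
  have g: "\<sigma> [(j, True)] permutes {1..n}" if "j \<in> {1..r}" for j
    using perm_hom_permutes[OF \<sigma>, of "[(j, True)]"] that by (simp add: letters_def)
  have t: "Transposition.transpose q z permutes {1..n}" using qz by (rule permutes_swap_id)
  have \<pi>: "\<pi> j permutes {1..n}" if "j \<in> {1..r}" for j
    unfolding \<pi>_def using g[OF that] permutes_compose[OF g[OF that] t] permutes_compose[OF t g[OF that]]
    by (cases "j = fst a"; cases "snd a") simp_all
  show in_homs: "switch r a q z \<sigma> \<in> perm_homs r n" unfolding sw by (rule hom_of_in[OF \<pi>])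
  have hl: "hom_of r \<pi> [b] = letter_perm \<pi> b" if "b \<in> letters r" for b
    by (rule hom_of_letter[where n = n, OF _ that]) (rule \<pi>)
  have fa: "fst a \<in> {1..r}" using a by (auto simp: letters_def)
  have bg: "bij (\<sigma> [(fst a, True)])" using g[OF fa] by (rule permutes_bij)
  have bt: "bij (Transposition.transpose q z)" by simp
  show 2: "switch r a q z \<sigma> [a] = Transposition.transpose q z \<circ> \<sigma> [a]"
  proof (cases "snd a")
    case True
    have "\<sigma> [a] = \<sigma> [(fst a, True)]"
      using perm_hom_letter_perm[OF \<sigma> a] True by (simp add: letter_perm_def)
    then show ?thesis
      unfolding sw hl[OF a] using True by (simp add: letter_perm_def \<pi>_def)
  next
    case False
    have "\<sigma> [a] = Hilbert_Choice.inv (\<sigma> [(fst a, True)])"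
      using perm_hom_letter_perm[OF \<sigma> a] False by (simp add: letter_perm_def)
    then show ?thesis
      unfolding sw hl[OF a] using False bg bt
      by (simp add: letter_perm_def \<pi>_def o_inv_distrib)
  qed
  have bij_a: "bij (\<sigma> [a])" using perm_hom_permutes[OF \<sigma>, of "[a]"] a permutes_bij by auto
  show "switch r a q z \<sigma> [inv_letter a] = \<sigma> [inv_letter a] \<circ> Transposition.transpose q z"
    unfolding perm_hom_inv[OF in_homs a] perm_hom_inv[OF \<sigma> a] 2 using bij_a bt
    by (simp add: o_inv_distrib)
  show "switch r a q z \<sigma> [b] = \<sigma> [b]" if b: "b \<in> letters r" "b \<noteq> a" "b \<noteq> inv_letter a"
  proof -
    have "fst b \<noteq> fst a"
    proof
      assume "fst b = fst a"
      then have "b = a \<or> b = inv_letter a" by (cases "snd b = snd a") (auto simp: prod_eq_iff inv_letter_def)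
      then show False using b by blast
    qed
    then have "letter_perm \<pi> b = letter_perm (\<lambda>i. \<sigma> [(i, True)]) b"
      by (simp add: letter_perm_def \<pi>_def)
    then show ?thesis unfolding sw hl[OF b(1)] perm_hom_letter_perm[OF \<sigma> b(1)] .
  qed
qed

text \<open>With \<open>a = hd w\<close>, switching affects only steps by \<open>a\<close> that end
  in \<open>u\<close> or \<open>z\<close> and steps by its inverse that start there, and
  \<open>z\<close> is off the cycle. A second step by \<open>a\<close> ending in \<open>u\<close>
  would start where the closing step starts; a step by the inverse starting in \<open>u\<close>
  would make \<open>w\<close> the unreduced word \<open>[a, inv_letter a]\<close>.\<close>

lemma switch_path:
  assumes w: "w \<in> words r" "w \<noteq> []" and \<sigma>: "\<sigma> \<in> cyc r n w u" and u: "u \<in> {1..n}"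
    and z: "z \<in> {1..n}" "z \<notin> cycle_vertices \<sigma> w u"
  shows "j \<in> {1..length w} \<Longrightarrow> switch r (hd w) u z \<sigma> (drop j w) u = \<sigma> (drop j w) u"
    and "switch r (hd w) u z \<sigma> w u = z"
proof -
  let ?a = "hd w" and ?\<sigma>' = "switch r (hd w) u z \<sigma>"
  let ?v = "\<lambda>j. \<sigma> (drop j w) u"
  have h: "\<sigma> \<in> perm_homs r n" "\<sigma> w u = u" "inj_on ?v {1..length w}" using \<sigma> by (auto simp: cyc_def)
  have a: "?a \<in> letters r" by (rule hd_in_letters[OF w])
  note sw = switch[OF h(1) a u z(1)]
  have wC: "w = ?a # drop 1 w" using w(2) by (cases w) simp_all
  have aC: "?a # drop 1 w \<in> words r" using w(1) wC by simp
  have close: "\<sigma> [?a] (?v 1) = u"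
    using h(2) perm_hom_Cons[OF h(1) aC] wC by simp
  have len: "1 \<le> length w" using w(2) by (cases w) simp_all
  have u_path: "?v (length w) = u" using perm_hom_Nil[OF h(1)] by simp
  have not_z: "?v j \<noteq> z" if "j \<in> {1..length w}" for j using z(2) that by (auto simp: cycle_vertices_def)
  have path_eq: "?\<sigma>' (drop j w) u = ?v j" if "1 \<le> j" "j \<le> length w" for j
    using that(2,1)
  proof (induction j rule: inc_induct)
    case base
    show ?case using perm_hom_Nil[OF h(1)] perm_hom_Nil[OF sw(1)] by simp
  next
    case (step j)
    let ?c = "w ! j"
    have d: "drop j w = ?c # drop (Suc j) w" using step.hyps by (simp add: Cons_nth_drop_Suc)
    have dw: "?c # drop (Suc j) w \<in> words r" using drop_in_words[OF w(1), of j] d by simp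
    then have c: "?c \<in> letters r" by (simp add: Cons_in_words)
    have vj: "?v j = \<sigma> [?c] (?v (Suc j))" using perm_hom_Cons[OF h(1) dw] d by simp
    have "?\<sigma>' [?c] (?v (Suc j)) = \<sigma> [?c] (?v (Suc j))"
    proof (cases "?c = ?a \<or> ?c = inv_letter ?a")
      case False
      then show ?thesis using sw(4)[OF c] by simp
    next
      case True
      then show ?thesis
      proof
        assume ca: "?c = ?a"
        have "?v j \<noteq> u"
        proof
          assume "?v j = u"
          then have "\<sigma> [?a] (?v (Suc j)) = \<sigma> [?a] (?v 1)" using vj ca close by simp
          then have "?v (Suc j) = ?v 1" using perm_hom_inj[OF h(1), of "[?a]"] a by simp
          then have "Suc j = 1" using inj_onD[OF h(3), of "Suc j" 1] step.hyps len by simp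
          then show False using step.prems by simp
        qed
        moreover have "?v j \<noteq> z" using not_z step by simp
        ultimately have "Transposition.transpose u z (?v j) = ?v j" by (simp add: transpose_apply_other)
        then show ?thesis using sw(2) ca vj by simp
      next
        assume ca: "?c = inv_letter ?a"
        have "?v (Suc j) \<noteq> u"
        proof
          assume "?v (Suc j) = u"
          then have "?v (Suc j) = ?v (length w)" using u_path by simp
          then have j: "Suc j = length w" using inj_onD[OF h(3), of "Suc j" "length w"] step.hyps len by simp
          have "\<sigma> [?a] (?v j) = \<sigma> [?a] (\<sigma> [inv_letter ?a] u)" using vj ca \<open>?v (Suc j) = u\<close> by simp
          also have "\<dots> = u" using perm_hom_inv_letter[OF h(1), of "inv_letter ?a"] a by simp
          finally have "\<sigma> [?a] (?v j) = \<sigma> [?a] (?v 1)" using close by simp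
          then have "?v j = ?v 1" using perm_hom_inj[OF h(1), of "[?a]"] a by simp
          then have "j = 1" using inj_onD[OF h(3), of j 1] step len by simp
          then have "w = [?a, inv_letter ?a]"
            using wC d j ca by simp
          then have "[?a, inv_letter ?a] \<in> words r" using w(1) by simp
          then show False by (simp add: Cons_in_words)
        qed
        moreover have "?v (Suc j) \<noteq> z" using not_z step.hyps by simp
        ultimately have "Transposition.transpose u z (?v (Suc j)) = ?v (Suc j)" by (simp add: transpose_apply_other)
        then show ?thesis using sw(3) ca by simp
      qed
    qed
    moreover have "?\<sigma>' (drop j w) u = ?\<sigma>' [?c] (?\<sigma>' (drop (Suc j) w) u)"
      using perm_hom_Cons[OF sw(1) dw] d by simp
    ultimately show ?case using step.IH vj by simp
  qed
  then show "j \<in> {1..length w} \<Longrightarrow> ?\<sigma>' (drop j w) u = ?v j" by simp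
  have "?\<sigma>' w u = ?\<sigma>' [?a] (?\<sigma>' (drop 1 w) u)"
    using perm_hom_Cons[OF sw(1) aC] wC by simp
  also have "\<dots> = Transposition.transpose u z (\<sigma> [?a] (?v 1))" using path_eq[of 1] len sw(2) by simp
  also have "\<dots> = z" unfolding close by simp
  finally show "?\<sigma>' w u = z" .
qed

text \<open>Switching: rerouting the closing edge of the cycle from \<open>u\<close> to a vertex \<open>z\<close> off the cycle is
  injective in the pair \<open>(\<sigma>, z)\<close>, because \<open>z\<close> is then the endpoint of the walk.\<close>

lemma card_cyc:
  assumes w: "w \<in> words r" "w \<noteq> []" and u: "u \<in> {1..n}"
  shows "card (cyc r n w u) * (n - length w) \<le> card (perm_homs r n)"
proof -
  define D where "D = Sigma (cyc r n w u) (\<lambda>\<sigma>. {1..n} - cycle_vertices \<sigma> w u)"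
  let ?\<Psi> = "\<lambda>(\<sigma>, z). switch r (hd w) u z \<sigma>"
  have a: "hd w \<in> letters r" by (rule hd_in_letters[OF w])
  have homs: "\<sigma> \<in> perm_homs r n" if "\<sigma> \<in> cyc r n w u" for \<sigma> using that by (simp add: cyc_def)
  have fin: "finite (cyc r n w u)" by (rule finite_subset[OF _ finite_perm_homs]) (auto simp: cyc_def)
  have "card (cyc r n w u) * (n - length w) = (\<Sum>\<sigma>\<in>cyc r n w u. n - length w)" by simp
  also have "\<dots> \<le> (\<Sum>\<sigma>\<in>cyc r n w u. card ({1..n} - cycle_vertices \<sigma> w u))"
  proof (rule sum_mono)
    fix \<sigma>
    have "card (cycle_vertices \<sigma> w u) \<le> length w"
      unfolding cycle_vertices_def using card_image_le[of "{1..length w}"] by simp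
    then have "n - length w \<le> card {1..n} - card (cycle_vertices \<sigma> w u)" by simp
    also have "\<dots> \<le> card ({1..n} - cycle_vertices \<sigma> w u)"
      by (rule diff_card_le_card_Diff) (simp add: cycle_vertices_def)
    finally show "n - length w \<le> card ({1..n} - cycle_vertices \<sigma> w u)" .
  qed
  also have "\<dots> = card D" unfolding D_def using fin by (subst card_SigmaI) simp_all
  also have "\<dots> \<le> card (perm_homs r n)"
  proof (rule card_inj_on_le[OF _ _ finite_perm_homs])
    show "?\<Psi> ` D \<subseteq> perm_homs r n"
    proof (rule image_subsetI)
      fix x assume "x \<in> D"
      then obtain \<sigma> z where x: "x = (\<sigma>, z)" "\<sigma> \<in> cyc r n w u" "z \<in> {1..n}" unfolding D_def by blast
      show "?\<Psi> x \<in> perm_homs r n" unfolding x(1) case_prod_conv by (rule switch(1)[OF homs[OF x(2)] a u x(3)])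
    qed
    show "inj_on ?\<Psi> D"
    proof (rule inj_onI, clarify)
      fix \<sigma> z \<sigma>' z'
      assume D: "(\<sigma>, z) \<in> D" "(\<sigma>', z') \<in> D" and eq: "switch r (hd w) u z \<sigma> = switch r (hd w) u z' \<sigma>'"
      have s: "\<sigma> \<in> cyc r n w u" "z \<in> {1..n}" "z \<notin> cycle_vertices \<sigma> w u" using D(1) by (auto simp: D_def)
      have s': "\<sigma>' \<in> cyc r n w u" "z' \<in> {1..n}" "z' \<notin> cycle_vertices \<sigma>' w u" using D(2) by (auto simp: D_def)
      have zz: "z = z'" using switch_path(2)[OF w s(1) u s(2,3)] switch_path(2)[OF w s'(1) u s'(2,3)] eq by simp
      note sw = switch[OF homs[OF s(1)] a u s(2)] and sw' = switch[OF homs[OF s'(1)] a u s(2)]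
      have eq': "switch r (hd w) u z \<sigma>' = switch r (hd w) u z \<sigma>" using eq unfolding zz by (rule sym)
      have tt: "Transposition.transpose u z \<circ> (Transposition.transpose u z \<circ> f) = f" for f :: "nat \<Rightarrow> nat"
        by (simp add: fun_eq_iff)
      have tt': "(f \<circ> Transposition.transpose u z) \<circ> Transposition.transpose u z = f" for f :: "nat \<Rightarrow> nat"
        by (simp add: fun_eq_iff)
      have "\<sigma> [b] = \<sigma>' [b]" if b: "b \<in> letters r" for b
      proof -
        consider "b = hd w" | "b = inv_letter (hd w)" | "b \<noteq> hd w" "b \<noteq> inv_letter (hd w)" by blast
        then show ?thesis
        proof cases
          case 1
          have "Transposition.transpose u z \<circ> \<sigma> [hd w] = Transposition.transpose u z \<circ> \<sigma>' [hd w]"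
            unfolding sw(2)[symmetric] sw'(2)[symmetric] eq' ..
          then show ?thesis unfolding 1 by (metis tt)
        next
          case 2
          have "\<sigma> [inv_letter (hd w)] \<circ> Transposition.transpose u z = \<sigma>' [inv_letter (hd w)] \<circ> Transposition.transpose u z"
            unfolding sw(3)[symmetric] sw'(3)[symmetric] eq' ..
          then show ?thesis unfolding 2 by (metis tt')
        next
          case 3
          show ?thesis unfolding sw(4)[OF b 3, symmetric] sw'(4)[OF b 3, symmetric] eq' ..
        qed
      qed
      then have "\<sigma> = \<sigma>'" by (rule perm_hom_eqI[OF homs[OF s(1)] homs[OF s'(1)]])
      then show "\<sigma> = \<sigma>' \<and> z = z'" using zz by blast
    qed
  qed
  finally show ?thesis .
qed

definition segment :: "nat \<Rightarrow> nat \<Rightarrow> word \<Rightarrow> word" where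
  "segment i j w = take (j - i) (drop i w)"

lemma drop_segment: "i \<le> j \<Longrightarrow> drop i w = segment i j w @ drop j w"
  unfolding segment_def using append_take_drop_id[of "j - i" "drop i w"] by (simp add: add.commute)

text \<open>Among all repetitions \<open>?v i = ?v (i + d)\<close> with \<open>d > 0\<close> on the
  closed walk, one with the smallest \<open>d\<close> bounds a simple cycle: a repetition inside it
  would be shorter.\<close>

lemma fixed_point_on_cycle:
  assumes \<sigma>: "\<sigma> \<in> perm_homs r n" and w: "w \<in> words r" "w \<noteq> []" and fixp: "\<sigma> w v = v"
  shows "\<exists>i j. i < j \<and> j \<le> length w \<and> \<sigma> \<in> cyc r n (segment i j w) (\<sigma> (drop j w) v)"
proof -
  let ?v = "\<lambda>j. \<sigma> (drop j w) v"
  define P where "P d \<longleftrightarrow> (\<exists>i. 0 < d \<and> i + d \<le> length w \<and> ?v i = ?v (i + d))" for d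
  have "P (length w)"
    unfolding P_def using w(2) fixp perm_hom_Nil[OF \<sigma>] by (intro exI[of _ 0]) simp
  then have Pd: "P (LEAST d. P d)" by (rule LeastI)
  define d where "d = (LEAST d. P d)"
  have min: "\<not> P d'" if "d' < d" for d' using not_less_Least[of d' P] that by (simp add: d_def)
  obtain i where i: "0 < d" "i + d \<le> length w" "?v i = ?v (i + d)"
    using Pd unfolding d_def[symmetric] unfolding P_def by blast
  let ?y = "segment i (i + d) w" and ?u = "?v (i + d)"
  have leny: "length ?y = d" using i(2) by (simp add: segment_def)
  have split: "drop i w = ?y @ drop (i + d) w" by (rule drop_segment) simp
  have walk: "\<sigma> (drop m ?y) ?u = ?v (i + m)" if m: "m \<le> d" for m
  proof -
    have "drop (i + m) w = drop m ?y @ drop (i + d) w"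
      using arg_cong[OF split, of "drop m"] m leny by (simp add: add.commute)
    moreover have "drop m ?y @ drop (i + d) w \<in> words r"
      using drop_in_words[OF w(1), of "i + m"] calculation by simp
    ultimately show ?thesis using perm_hom_append[OF \<sigma>] by simp
  qed
  have closed: "\<sigma> ?y ?u = ?u" using walk[of 0] i(3) by simp
  have "inj_on (\<lambda>m. \<sigma> (drop m ?y) ?u) {1..length ?y}"
  proof (rule linorder_inj_onI)
    fix m m' assume m: "m < m'" "m \<in> {1..length ?y}" "m' \<in> {1..length ?y}"
    show "\<sigma> (drop m ?y) ?u \<noteq> \<sigma> (drop m' ?y) ?u"
    proof
      assume "\<sigma> (drop m ?y) ?u = \<sigma> (drop m' ?y) ?u"
      then have "?v (i + m) = ?v (i + m')" using walk m leny by simp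
      then have "P (m' - m)"
        unfolding P_def using m leny i(2) by (intro exI[of _ "i + m"]) auto
      moreover have "m' - m < d" using m leny by auto
      ultimately show False using min by blast
    qed
  qed auto
  then have "\<sigma> \<in> cyc r n ?y ?u" using \<sigma> closed by (simp add: cyc_def)
  then show ?thesis using i(1,2) by (intro exI[of _ i] exI[of _ "i + d"]) simp
qed

definition fixed :: "nat \<Rightarrow> (word \<Rightarrow> nat \<Rightarrow> nat) \<Rightarrow> word \<Rightarrow> nat set" where
  "fixed n \<sigma> w = {v \<in> {1..n}. \<sigma> w v = v}"

definition index_pairs :: "word \<Rightarrow> (nat \<times> nat) set" where
  "index_pairs w = {(i, j). i < j \<and> j \<le> length w}"

lemma finite_index_pairs: "finite (index_pairs w)"
  by (rule finite_subset[of _ "{..length w} \<times> {..length w}"]) (auto simp: index_pairs_def)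

text \<open>Each fixed point is assigned the base point of a simple cycle on its walk. For given
  indices the base point is its image under the permutation \<open>\<sigma> (drop j w)\<close>, so
  different fixed points have different base points.\<close>

lemma card_fixed_le:
  assumes \<sigma>: "\<sigma> \<in> perm_homs r n" and w: "w \<in> words r" "w \<noteq> []"
  shows "card (fixed n \<sigma> w) \<le> (\<Sum>(i, j)\<in>index_pairs w. card {u \<in> {1..n}. \<sigma> \<in> cyc r n (segment i j w) u})"
proof -
  let ?U = "\<lambda>p. {u \<in> {1..n}. \<sigma> \<in> cyc r n (segment (fst p) (snd p) w) u}"
  let ?V = "\<lambda>p. {v \<in> {1..n}. \<sigma> \<in> cyc r n (segment (fst p) (snd p) w) (\<sigma> (drop (snd p) w) v)}"
  have sub: "fixed n \<sigma> w \<subseteq> (\<Union>p\<in>index_pairs w. ?V p)"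
  proof
    fix v assume "v \<in> fixed n \<sigma> w"
    then have v: "v \<in> {1..n}" "\<sigma> w v = v" by (auto simp: fixed_def)
    obtain i j where "i < j" "j \<le> length w" "\<sigma> \<in> cyc r n (segment i j w) (\<sigma> (drop j w) v)"
      using fixed_point_on_cycle[OF \<sigma> w v(2)] by blast
    then show "v \<in> (\<Union>p\<in>index_pairs w. ?V p)"
      using v(1) by (intro UN_I[of "(i, j)"]) (simp_all add: index_pairs_def)
  qed
  have "card (fixed n \<sigma> w) \<le> card (\<Union>p\<in>index_pairs w. ?V p)"
    by (rule card_mono[OF _ sub]) (simp add: finite_index_pairs)
  also have "\<dots> \<le> (\<Sum>p\<in>index_pairs w. card (?V p))" by (rule card_UN_le[OF finite_index_pairs])
  also have "\<dots> \<le> (\<Sum>p\<in>index_pairs w. card (?U p))"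
  proof (rule sum_mono)
    fix p :: "nat \<times> nat"
    have dw: "drop (snd p) w \<in> words r" by (rule drop_in_words[OF w(1)])
    show "card (?V p) \<le> card (?U p)"
    proof (rule card_inj_on_le)
      show "inj_on (\<sigma> (drop (snd p) w)) (?V p)"
        using perm_hom_inj[OF \<sigma> dw] by (simp add: inj_on_def)
      show "\<sigma> (drop (snd p) w) ` ?V p \<subseteq> ?U p"
        using perm_hom_in[OF \<sigma> dw] by blast
    qed simp
  qed
  finally show ?thesis by (simp add: case_prod_unfold)
qed

lemma segment_in_words:
  assumes "w \<in> words r" "i < j" "j \<le> length w"
  shows "segment i j w \<in> words r" "segment i j w \<noteq> []" "length (segment i j w) \<le> length w"
proof -
  have "segment i j w @ drop j w \<in> words r"
    using drop_in_words[OF assms(1), of i] drop_segment[of i j w] assms(2) by simp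
  then show "segment i j w \<in> words r" by (rule append_in_words)
  have "length (segment i j w) = j - i" using assms by (simp add: segment_def)
  then show "segment i j w \<noteq> []" "length (segment i j w) \<le> length w" using assms by auto
qed

text \<open>Exchanging the sums leaves, for each segment and base point, a count bounded by
  \<open>card_cyc\<close>. On average a non-trivial reduced word thus has a bounded number of fixed
  points as \<open>n\<close> grows.\<close>

lemma sum_card_fixed:
  assumes w: "w \<in> words r" "w \<noteq> []" and n: "length w < n"
  shows "(\<Sum>\<sigma>\<in>perm_homs r n. real (card (fixed n \<sigma> w))) * (real n - real (length w))
    \<le> real (card (index_pairs w)) * real n * real (card (perm_homs r n))"
proof -
  have "(\<Sum>\<sigma>\<in>perm_homs r n. card (fixed n \<sigma> w)) * (n - length w) \<le>
      (\<Sum>\<sigma>\<in>perm_homs r n. \<Sum>(i, j)\<in>index_pairs w. card {u \<in> {1..n}. \<sigma> \<in> cyc r n (segment i j w) u}) * (n - length w)"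
    by (intro mult_right_mono sum_mono card_fixed_le w) auto
  also have "(\<Sum>\<sigma>\<in>perm_homs r n. \<Sum>(i, j)\<in>index_pairs w. card {u \<in> {1..n}. \<sigma> \<in> cyc r n (segment i j w) u}) =
      (\<Sum>(i, j)\<in>index_pairs w. \<Sum>\<sigma>\<in>perm_homs r n. card {u \<in> {1..n}. \<sigma> \<in> cyc r n (segment i j w) u})"
    unfolding case_prod_unfold by (rule sum.swap)
  also have "\<dots> = (\<Sum>(i, j)\<in>index_pairs w. \<Sum>u\<in>{1..n}. card (cyc r n (segment i j w) u))"
  proof (intro sum.cong refl, clarify)
    fix i j
    have "(\<Sum>\<sigma>\<in>perm_homs r n. card {u \<in> {1..n}. \<sigma> \<in> cyc r n (segment i j w) u}) =
        (\<Sum>u\<in>{1..n}. card {\<sigma> \<in> perm_homs r n. \<sigma> \<in> cyc r n (segment i j w) u})"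
      by (rule sum_multicount_gen[OF finite_perm_homs]) simp_all
    also have "\<dots> = (\<Sum>u\<in>{1..n}. card (cyc r n (segment i j w) u))"
      by (intro sum.cong refl arg_cong[where f = card]) (auto simp: cyc_def)
    finally show "(\<Sum>\<sigma>\<in>perm_homs r n. card {u \<in> {1..n}. \<sigma> \<in> cyc r n (segment i j w) u}) =
      (\<Sum>u\<in>{1..n}. card (cyc r n (segment i j w) u))" .
  qed
  also have "\<dots> * (n - length w) = (\<Sum>(i, j)\<in>index_pairs w. \<Sum>u\<in>{1..n}. card (cyc r n (segment i j w) u) * (n - length w))"
    by (simp add: sum_distrib_right case_prod_unfold)
  also have "\<dots> \<le> (\<Sum>(i, j)\<in>index_pairs w. \<Sum>u\<in>{1..n}. card (perm_homs r n))"
  proof (rule sum_mono, clarify)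
    fix i j assume "(i, j) \<in> index_pairs w"
    then have ij: "i < j" "j \<le> length w" by (auto simp: index_pairs_def)
    note seg = segment_in_words[OF w(1) ij]
    show "(\<Sum>u\<in>{1..n}. card (cyc r n (segment i j w) u) * (n - length w)) \<le> (\<Sum>u\<in>{1..n}. card (perm_homs r n))"
    proof (rule sum_mono)
      fix u assume u: "u \<in> {1..n}"
      have "card (cyc r n (segment i j w) u) * (n - length w)
          \<le> card (cyc r n (segment i j w) u) * (n - length (segment i j w))"
        using seg(3) by (intro mult_left_mono) auto
      also have "\<dots> \<le> card (perm_homs r n)" by (rule card_cyc[OF seg(1,2) u])
      finally show "card (cyc r n (segment i j w) u) * (n - length w) \<le> card (perm_homs r n)" .
    qed
  qed
  also have "\<dots> = card (index_pairs w) * n * card (perm_homs r n)" by simp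
  finally have "real ((\<Sum>\<sigma>\<in>perm_homs r n. card (fixed n \<sigma> w)) * (n - length w))
      \<le> real (card (index_pairs w) * n * card (perm_homs r n))" by (rule of_nat_mono)
  then show ?thesis using n by (simp add: of_nat_diff)
qed

section \<open>From coinciding words to fixed points: vertices whose ball is not a tree\<close>

definition inv_word :: "word \<Rightarrow> word" where
  "inv_word w = rev (map inv_letter w)"

lemma inv_word_cancel:
  assumes \<sigma>: "\<sigma> \<in> perm_homs r n"
  shows "inv_word w @ u \<in> words r \<Longrightarrow> w \<in> words r \<Longrightarrow> \<sigma> (inv_word w @ u) (x) = y \<longleftrightarrow> \<sigma> u x = \<sigma> w y"
proof (induction w arbitrary: u)
  case Nil
  show ?case using perm_hom_Nil[OF \<sigma>] by (simp add: inv_word_def)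
next
  case (Cons a w)
  have a: "a \<in> letters r" "w \<in> words r" using Cons.prems(2) by (auto simp: Cons_in_words)
  have eq: "inv_word (a # w) @ u = inv_word w @ (inv_letter a # u)" by (simp add: inv_word_def)
  have in_w: "inv_word w @ (inv_letter a # u) \<in> words r" using Cons.prems(1) eq by simp
  have au: "inv_letter a # u \<in> words r" by (rule append_in_words(2)[OF in_w])
  have "\<sigma> (inv_word (a # w) @ u) x = y \<longleftrightarrow> \<sigma> (inv_letter a # u) x = \<sigma> w y"
    unfolding eq by (rule Cons.IH[OF in_w a(2)])
  also have "\<dots> \<longleftrightarrow> \<sigma> [inv_letter a] (\<sigma> u x) = \<sigma> w y"
    using perm_hom_Cons[OF \<sigma> au] by simp
  also have "\<dots> \<longleftrightarrow> \<sigma> [a] (\<sigma> [inv_letter a] (\<sigma> u x)) = \<sigma> [a] (\<sigma> w y)"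
    using perm_hom_inj[OF \<sigma>, of "[a]"] a(1) by simp
  also have "\<dots> \<longleftrightarrow> \<sigma> u x = \<sigma> (a # w) y"
    using perm_hom_inv_letter[OF \<sigma>, of "inv_letter a"] a(1) perm_hom_Cons[OF \<sigma> Cons.prems(2)] by simp
  finally show ?case .
qed

lemma inv_word_append_in_words:
  assumes "w \<in> words r" "u \<in> words r" "w = [] \<or> u = [] \<or> hd w \<noteq> hd u"
  shows "inv_word w @ u \<in> words r"
proof -
  have set: "set (inv_word w) \<subseteq> {1..r} \<times> UNIV"
    using assms(1) unfolding inv_word_def free_group_def by (auto simp: inv_letter_def)
  have red: "reduced (inv_word w)"
    using assms(1) unfolding reduced_def inv_word_def free_group_def
    by (auto simp: successively_rev successively_map reduced_def elim!: successively_mono)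
  have "last (inv_word w) = inv_letter (hd w)" if "w \<noteq> []"
    using that by (simp add: inv_word_def last_rev hd_map)
  then have "reduced (inv_word w @ u)"
    using assms red unfolding reduced_def successively_append_iff free_group_def
    by (auto simp: inv_word_def reduced_def)
  then show ?thesis using set assms(2) by (auto simp: free_group_def)
qed

text \<open>Once the common initial letters are removed, \<open>inv_word w @ w'\<close> is reduced
  and fixes \<open>v\<close>.\<close>

lemma coincidence_fixed_point:
  assumes \<sigma>: "\<sigma> \<in> perm_homs r n"
  shows "w \<in> words r \<Longrightarrow> w' \<in> words r \<Longrightarrow> w \<noteq> w' \<Longrightarrow> \<sigma> w v = \<sigma> w' v \<Longrightarrow>
    \<exists>\<gamma>\<in>words r. \<gamma> \<noteq> [] \<and> length \<gamma> \<le> length w + length w' \<and> \<sigma> \<gamma> v = v"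
proof (induction w arbitrary: w')
  case Nil
  then show ?case using perm_hom_Nil[OF \<sigma>] by (intro bexI[of _ w']) auto
next
  case (Cons a w)
  show ?case
  proof (cases "w' \<noteq> [] \<and> hd w' = a")
    case True
    then obtain u where w': "w' = a # u" by (metis list.collapse)
    have in_w: "a \<in> letters r" "w \<in> words r" "u \<in> words r"
      using Cons.prems(1,2) w' by (auto simp: Cons_in_words)
    have "\<sigma> [a] (\<sigma> w v) = \<sigma> [a] (\<sigma> u v)"
      using Cons.prems(4) perm_hom_Cons[OF \<sigma> Cons.prems(1)] perm_hom_Cons[OF \<sigma>, of a u] Cons.prems(2) w' by simp
    then have "\<sigma> w v = \<sigma> u v" using perm_hom_inj[OF \<sigma>, of "[a]"] in_w(1) by simp
    from Cons.IH[OF in_w(2,3) _ this] Cons.prems(3) w' show ?thesis by fastforce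
  next
    case False
    have iw: "inv_word (a # w) @ w' \<in> words r"
      by (rule inv_word_append_in_words[OF Cons.prems(1,2)]) (use False in auto)
    have "\<sigma> (inv_word (a # w) @ w') v = v"
      unfolding inv_word_cancel[OF \<sigma> iw Cons.prems(1)] using Cons.prems(4) by simp
    then show ?thesis using iw by (intro bexI[of _ "inv_word (a # w) @ w'"]) (auto simp: inv_word_def)
  qed
qed

lemma bad_subset_fixed:
  assumes \<sigma>: "\<sigma> \<in> perm_homs r n"
  shows "{1..n} - good r n \<sigma> R \<subseteq> (\<Union>\<gamma>\<in>word_ball r (2 * R) - {[]}. fixed n \<sigma> \<gamma>)"
proof
  fix v assume v: "v \<in> {1..n} - good r n \<sigma> R"
  then have "\<not> inj_on (\<lambda>w. \<sigma> w v) (word_ball r R)" by (simp add: good_def)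
  then obtain w w' where w: "w \<in> word_ball r R" "w' \<in> word_ball r R" "w \<noteq> w'" "\<sigma> w v = \<sigma> w' v"
    unfolding inj_on_def by blast
  have ww: "w \<in> words r" "w' \<in> words r" "length w \<le> R" "length w' \<le> R"
    using w(1,2) by (simp_all add: word_ball_def)
  from coincidence_fixed_point[OF \<sigma> ww(1,2) w(3,4)] obtain \<gamma>
    where g: "\<gamma> \<in> words r" "\<gamma> \<noteq> []" "length \<gamma> \<le> length w + length w'" "\<sigma> \<gamma> v = v" by blast
  have "\<gamma> \<in> word_ball r (2 * R) - {[]}" using g ww by (simp add: word_ball_def)
  moreover have "v \<in> fixed n \<sigma> \<gamma>" using g v by (simp add: fixed_def)
  ultimately show "v \<in> (\<Union>\<gamma>\<in>word_ball r (2 * R) - {[]}. fixed n \<sigma> \<gamma>)" by blast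
qed

text \<open>Union bound over the finitely many non-empty words of length at most
  \<open>2 * R\<close>; the constant is independent of \<open>n\<close>.\<close>

lemma sum_card_bad:
  "\<exists>C\<ge>0. \<forall>n>2 * R. (\<Sum>\<sigma>\<in>perm_homs r n. real n - real (card (good r n \<sigma> R))) * (real n - real (2 * R))
    \<le> C * real n * real (card (perm_homs r n))"
proof (intro exI[of _ "\<Sum>\<gamma>\<in>word_ball r (2 * R) - {[]}. real (card (index_pairs \<gamma>))"] conjI allI impI)
  let ?G = "word_ball r (2 * R) - {[]}"
  show "0 \<le> (\<Sum>\<gamma>\<in>?G. real (card (index_pairs \<gamma>)))" by (simp add: sum_nonneg)
  fix n assume n: "2 * R < n"
  have "real n - real (card (good r n \<sigma> R)) \<le> (\<Sum>\<gamma>\<in>?G. real (card (fixed n \<sigma> \<gamma>)))"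
    if \<sigma>: "\<sigma> \<in> perm_homs r n" for \<sigma>
  proof -
    have sub: "good r n \<sigma> R \<subseteq> {1..n}" by (auto simp: good_def)
    have "card ({1..n} - good r n \<sigma> R) \<le> card (\<Union>\<gamma>\<in>?G. fixed n \<sigma> \<gamma>)"
      by (rule card_mono[OF _ bad_subset_fixed[OF \<sigma>]]) (simp add: fixed_def)
    also have "\<dots> \<le> (\<Sum>\<gamma>\<in>?G. card (fixed n \<sigma> \<gamma>))" by (rule card_UN_le) simp
    finally have "real (card ({1..n} - good r n \<sigma> R)) \<le> real (\<Sum>\<gamma>\<in>?G. card (fixed n \<sigma> \<gamma>))"
      by (rule of_nat_mono)
    then show ?thesis
      using card_good_le[of r n \<sigma> R] card_Diff_subset[OF finite_good sub] by (simp add: of_nat_diff)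
  qed
  then have "(\<Sum>\<sigma>\<in>perm_homs r n. real n - real (card (good r n \<sigma> R))) * (real n - real (2 * R))
      \<le> (\<Sum>\<sigma>\<in>perm_homs r n. \<Sum>\<gamma>\<in>?G. real (card (fixed n \<sigma> \<gamma>))) * (real n - real (2 * R))"
    using n by (intro mult_right_mono sum_mono) auto
  also have "\<dots> = (\<Sum>\<gamma>\<in>?G. (\<Sum>\<sigma>\<in>perm_homs r n. real (card (fixed n \<sigma> \<gamma>))) * (real n - real (2 * R)))"
    by (subst sum.swap) (simp add: sum_distrib_right)
  also have "\<dots> \<le> (\<Sum>\<gamma>\<in>?G. real (card (index_pairs \<gamma>)) * real n * real (card (perm_homs r n)))"
  proof (rule sum_mono)
    fix \<gamma> assume g: "\<gamma> \<in> ?G"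
    then have g': "\<gamma> \<in> words r" "\<gamma> \<noteq> []" "length \<gamma> \<le> 2 * R" by (auto simp: word_ball_def)
    have "(\<Sum>\<sigma>\<in>perm_homs r n. real (card (fixed n \<sigma> \<gamma>))) * (real n - real (2 * R))
        \<le> (\<Sum>\<sigma>\<in>perm_homs r n. real (card (fixed n \<sigma> \<gamma>))) * (real n - real (length \<gamma>))"
      using g'(3) by (intro mult_left_mono sum_nonneg) auto
    also have "\<dots> \<le> real (card (index_pairs \<gamma>)) * real n * real (card (perm_homs r n))"
      using g' n by (intro sum_card_fixed) auto
    finally show "(\<Sum>\<sigma>\<in>perm_homs r n. real (card (fixed n \<sigma> \<gamma>))) * (real n - real (2 * R))
      \<le> real (card (index_pairs \<gamma>)) * real n * real (card (perm_homs r n))" .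
  qed
  also have "\<dots> = (\<Sum>\<gamma>\<in>?G. real (card (index_pairs \<gamma>))) * real n * real (card (perm_homs r n))"
    by (simp add: sum_distrib_right)
  finally show "(\<Sum>\<sigma>\<in>perm_homs r n. real n - real (card (good r n \<sigma> R))) * (real n - real (2 * R))
      \<le> (\<Sum>\<gamma>\<in>?G. real (card (index_pairs \<gamma>))) * real n * real (card (perm_homs r n))" .
qed

definition mostly_good :: "nat \<Rightarrow> nat \<Rightarrow> nat \<Rightarrow> real \<Rightarrow> (word \<Rightarrow> nat \<Rightarrow> nat) set" where
  "mostly_good r n R \<kappa> = {\<tau> \<in> perm_homs r n. (1 - \<kappa>) * real n \<le> real (card (good r n \<tau> R))}"

text \<open>Markov's inequality: the mean number of bad vertices stays bounded as \<open>n\<close>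
  grows, while the threshold \<open>\<kappa> * n\<close> does not.\<close>

lemma mostly_good_tendsto:
  assumes \<kappa>: "\<kappa> > 0"
  shows "(\<lambda>n. measure_pmf.prob (pmf_of_set (perm_homs r n)) (mostly_good r n R \<kappa>)) \<longlonglongrightarrow> 1"
proof -
  obtain C where C: "C \<ge> 0" "\<And>n. 2 * R < n \<Longrightarrow>
    (\<Sum>\<sigma>\<in>perm_homs r n. real n - real (card (good r n \<sigma> R))) * (real n - real (2 * R))
      \<le> C * real n * real (card (perm_homs r n))"
    using sum_card_bad[of R r] by blast
  let ?p = "\<lambda>n. measure_pmf.prob (pmf_of_set (perm_homs r n)) (mostly_good r n R \<kappa>)"
  have lower: "1 - C / (\<kappa> * (real n - real (2 * R))) \<le> ?p n" if n: "2 * R < n" for n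
  proof -
    let ?P = "perm_homs r n" and ?M = "mostly_good r n R \<kappa>"
    have P: "0 < real (card ?P)" using finite_perm_homs perm_homs_nonempty by (simp add: card_gt_0_iff)
    have sub: "?M \<subseteq> ?P" by (auto simp: mostly_good_def)
    have p: "?p n = real (card ?M) / real (card ?P)"
      using measure_pmf_of_set[OF perm_homs_nonempty finite_perm_homs, of r n ?M] sub
      by (simp add: Int_absorb1)
    have nonneg: "0 \<le> real n - real (card (good r n \<sigma> R))" for \<sigma> using card_good_le[of r n \<sigma> R] by simp
    have "real (card (?P - ?M)) * (\<kappa> * real n) = (\<Sum>\<sigma>\<in>?P - ?M. \<kappa> * real n)" by simp
    also have "\<dots> \<le> (\<Sum>\<sigma>\<in>?P - ?M. real n - real (card (good r n \<sigma> R)))"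
      by (rule sum_mono) (auto simp: mostly_good_def algebra_simps)
    also have "\<dots> \<le> (\<Sum>\<sigma>\<in>?P. real n - real (card (good r n \<sigma> R)))"
      using nonneg by (intro sum_mono2 finite_perm_homs) auto
    finally have "real (card (?P - ?M)) * (\<kappa> * real n) * (real n - real (2 * R))
        \<le> (\<Sum>\<sigma>\<in>?P. real n - real (card (good r n \<sigma> R))) * (real n - real (2 * R))"
      using n by (intro mult_right_mono) auto
    also note C(2)[OF n]
    finally have "real n * (real (card (?P - ?M)) * (\<kappa> * (real n - real (2 * R)))) \<le> real n * (C * real (card ?P))"
      by (simp only: mult_ac)
    then have "real (card (?P - ?M)) * (\<kappa> * (real n - real (2 * R))) \<le> C * real (card ?P)"
      using n by simp
    moreover have pos: "0 < \<kappa> * (real n - real (2 * R))" using \<kappa> n by simp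
    ultimately have "real (card (?P - ?M)) / real (card ?P) \<le> C / (\<kappa> * (real n - real (2 * R)))"
      using P by (simp add: field_simps)
    moreover have "real (card (?P - ?M)) = real (card ?P) - real (card ?M)"
      using card_Diff_subset[OF finite_subset[OF sub finite_perm_homs] sub] card_mono[OF finite_perm_homs sub]
      by (simp add: of_nat_diff)
    ultimately show ?thesis using P by (simp add: p diff_divide_distrib)
  qed
  show ?thesis
  proof (rule tendsto_sandwich)
    show "eventually (\<lambda>n. 1 - C / (\<kappa> * (real n - real (2 * R))) \<le> ?p n) sequentially"
      by (rule eventually_mono[OF eventually_gt_at_top[of "2 * R"]]) (rule lower)
    show "eventually (\<lambda>n. ?p n \<le> 1) sequentially" by simp
    have eq: "C / (\<kappa> * (real (n + Suc (2 * R)) - real (2 * R))) = C / \<kappa> * inverse (real (Suc n))" for n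
      by (simp add: divide_inverse)
    have "(\<lambda>n. C / (\<kappa> * (real n - real (2 * R)))) \<longlonglongrightarrow> 0"
      by (rule LIMSEQ_offset[where k = "Suc (2 * R)"], unfold eq)
        (rule tendsto_mult_right_zero[OF LIMSEQ_inverse_real_of_nat])
    from tendsto_diff[OF tendsto_const[of 1] this]
    show "(\<lambda>n. 1 - C / (\<kappa> * (real n - real (2 * R)))) \<longlonglongrightarrow> 1" by simp
  qed simp
qed

section \<open>Local limits over sofic approximations\<close>

definition neg_conf :: "nat \<Rightarrow> nat \<Rightarrow> (word \<Rightarrow> real) \<Rightarrow> word \<Rightarrow> real" where
  "neg_conf r k z = (\<lambda>w\<in>word_ball r k. - z w)"

text \<open>Symmetrising the indicator of a cylinder makes \<open>most_vertices_near_plus\<close>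
  applicable.\<close>

definition even_ind :: "nat \<Rightarrow> nat \<Rightarrow> (word \<Rightarrow> real) \<Rightarrow> (word \<Rightarrow> real) \<Rightarrow> real" where
  "even_ind r k z y = 1 / 2 * ind r k z y + 1 / 2 * ind r k (neg_conf r k z) y"

lemma ind_uminus: "(\<And>w. w \<in> word_ball r k \<Longrightarrow> y' w = - y w) \<Longrightarrow> ind r k z y' = ind r k (neg_conf r k z) y"
  unfolding ind_def neg_conf_def by (simp add: minus_equation_iff[of "y _"] eq_commute[of "z _"] cong: ball_cong)

lemma ind_neg_conf_uminus:
  "(\<And>w. w \<in> word_ball r k \<Longrightarrow> y' w = - y w) \<Longrightarrow> ind r k (neg_conf r k z) y' = ind r k z y"
  unfolding ind_def neg_conf_def by (simp cong: ball_cong)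

lemma local_on_even_ind: "local_on (word_ball r k) (even_ind r k z)"
  unfolding local_on_def even_ind_def
proof (intro allI impI)
  fix y y' :: "word \<Rightarrow> real" assume "\<forall>w\<in>word_ball r k. y w = y' w"
  then have "ind r k u y = ind r k u y'" for u by (simp add: ind_def)
  then show "1 / 2 * ind r k z y + 1 / 2 * ind r k (neg_conf r k z) y =
    1 / 2 * ind r k z y' + 1 / 2 * ind r k (neg_conf r k z) y'" by simp
qed

lemma even_obs_even_ind: "even_obs (word_ball r k) (even_ind r k z)"
  unfolding even_obs_def
proof
  fix y :: "word \<Rightarrow> real"
  let ?y = "\<lambda>w\<in>word_ball r k. - y w"
  have 1: "ind r k z ?y = ind r k (neg_conf r k z) y" by (rule ind_uminus) simp
  have 2: "ind r k (neg_conf r k z) ?y = ind r k z y" by (rule ind_neg_conf_uminus) simp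
  show "even_ind r k z ?y = even_ind r k z y"
    unfolding even_ind_def 1 2 by (rule add.commute)
qed

lemma graph_exp_flip:
  assumes \<tau>: "\<tau> \<in> perm_homs r n"
  shows "graph_exp r n \<tau> \<beta> 0 F = graph_exp r n \<tau> \<beta> 0 (\<lambda>x. F (\<lambda>i\<in>{1..n}. - x i))"
proof -
  have "graph_energy r n \<tau> (\<lambda>i\<in>{1..n}. - x i) = graph_energy r n \<tau> x" for x
    unfolding graph_energy_def
  proof (intro sum.cong refl)
    fix u a assume "u \<in> {1..n}" "a \<in> letters r"
    then have "u \<in> {1..n}" "\<tau> [a] u \<in> {1..n}" using perm_hom_in[OF \<tau>, of "[a]" u] by simp_all
    then show "(\<lambda>i\<in>{1..n}. - x i) u * (\<lambda>i\<in>{1..n}. - x i) (\<tau> [a] u) = x u * x (\<tau> [a] u)"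
      by (simp only: restrict_apply' mult_minus_left mult_minus_right minus_minus)
  qed
  then have w: "graph_weight r n \<tau> \<beta> 0 (\<lambda>i\<in>{1..n}. - x i) = graph_weight r n \<tau> \<beta> 0 x" for x
    by (simp only: graph_weight_def mult_zero_left)
  show ?thesis
    unfolding graph_exp_def
    using ssum_flip[of "{1..n}" "\<lambda>x. F x * graph_weight r n \<tau> \<beta> 0 x"] by (simp only: w)
qed

text \<open>Without a field the finite model is invariant under the global flip, so symmetrising
  does not change the mean. Together with \<open>ball_exp_even_ind\<close> this is the source of the
  equal weights of the two states.\<close>

lemma graph_exp_even_ind:
  assumes \<tau>: "\<tau> \<in> perm_homs r n" and v: "v \<in> {1..n}"
  shows "graph_exp r n \<tau> \<beta> 0 (\<lambda>x. even_ind r k z (\<lambda>w. x (\<tau> w v))) =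
    graph_exp r n \<tau> \<beta> 0 (\<lambda>x. ind r k z (\<lambda>w. x (\<tau> w v)))"
proof -
  have "ind r k z (\<lambda>w. (\<lambda>i\<in>{1..n}. - x i) (\<tau> w v)) = ind r k (neg_conf r k z) (\<lambda>w. x (\<tau> w v))" for x
  proof (rule ind_uminus)
    fix w assume "w \<in> word_ball r k"
    then have "\<tau> w v \<in> {1..n}" by (intro perm_hom_in[OF \<tau> _ v] word_ball_in)
    then show "(\<lambda>i\<in>{1..n}. - x i) (\<tau> w v) = - x (\<tau> w v)" by (simp only: restrict_apply')
  qed
  then have "graph_exp r n \<tau> \<beta> 0 (\<lambda>x. ind r k (neg_conf r k z) (\<lambda>w. x (\<tau> w v))) =
      graph_exp r n \<tau> \<beta> 0 (\<lambda>x. ind r k z (\<lambda>w. x (\<tau> w v)))"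
    using graph_exp_flip[OF \<tau>, of \<beta> "\<lambda>x. ind r k z (\<lambda>w. x (\<tau> w v))"] by simp
  then show ?thesis
    unfolding even_ind_def graph_exp_add graph_exp_cmult by simp
qed

lemma ball_exp_even_ind:
  "(ball_exp r \<beta> k (\<lambda>_. H) (ind r k z) + ball_exp r \<beta> k (\<lambda>_. - H) (ind r k z)) / 2 =
    ball_exp r \<beta> k (\<lambda>_. H) (even_ind r k z)"
proof -
  have "ball_exp r \<beta> k (\<lambda>_. - H) (ind r k z) = ball_exp r \<beta> k (\<lambda>_. H) (\<lambda>y. ind r k z (\<lambda>w\<in>word_ball r k. - y w))"
    by (rule ball_exp_flip)
  also have "\<dots> = ball_exp r \<beta> k (\<lambda>_. H) (ind r k (neg_conf r k z))"
    by (rule ball_exp_cong[OF refl]) (rule ind_uminus, simp)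
  finally have 1: "ball_exp r \<beta> k (\<lambda>_. - H) (ind r k z) = ball_exp r \<beta> k (\<lambda>_. H) (ind r k (neg_conf r k z))" .
  have "ball_exp r \<beta> k (\<lambda>_. H) (even_ind r k z) =
      ball_exp r \<beta> k (\<lambda>_. H) (\<lambda>y. 1 / 2 * ind r k z y + 1 / 2 * ind r k (neg_conf r k z) y)"
    by (rule ball_exp_cong[OF refl]) (rule even_ind_def)
  then show ?thesis unfolding 1 ball_exp_add ball_exp_cmult by simp
qed

lemma gibbs_weight_graph:
  assumes \<tau>: "\<tau> \<in> perm_homs r n"
  shows "exp (- (\<Sum>v\<in>{1..n}. ising_energy r J (pullback r \<tau> v x))) = graph_weight r n \<tau> J 0 x"
proof -
  have "ising_energy r J (pullback r \<tau> v x) = - (J / 2) * (\<Sum>a\<in>letters r. x v * x (\<tau> [a] v))" for v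
  proof -
    have "(\<Sum>\<gamma> | adj r \<gamma> []. pullback r \<tau> v x [] * pullback r \<tau> v x \<gamma>) =
        (\<Sum>a\<in>letters r. pullback r \<tau> v x [] * pullback r \<tau> v x [a])"
      unfolding adj_Nil by (subst sum.reindex) (simp_all add: inj_on_def)
    also have "\<dots> = (\<Sum>a\<in>letters r. x v * x (\<tau> [a] v))"
      by (intro sum.cong refl) (simp add: pullback_def perm_hom_Nil[OF \<tau>])
    finally show ?thesis by (simp add: ising_energy_def)
  qed
  then show ?thesis
    by (simp add: graph_weight_def graph_energy_def sum_negf sum_distrib_left)
qed

definition view_law :: "nat \<Rightarrow> real \<Rightarrow> nat \<Rightarrow> (word \<Rightarrow> nat \<Rightarrow> nat) \<Rightarrow> nat \<Rightarrow> (word \<Rightarrow> real) measure" where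
  "view_law r J n \<tau> v = distr (finitary_gibbs r J n \<tau>) (config_space r) (pullback r \<tau> v)"

lemma view_law:
  assumes \<tau>: "\<tau> \<in> perm_homs r n" and v: "v \<in> {1..n}"
  shows "view_law r J n \<tau> v \<in> config_probs r"
    and "z \<in> word_ball r k \<rightarrow>\<^sub>E spins \<Longrightarrow>
      measure (view_law r J n \<tau> v) (cyl r k z) = graph_exp r n \<tau> J 0 (\<lambda>x. ind r k z (\<lambda>w. x (\<tau> w v)))"
proof -
  let ?C = "{1..n} \<rightarrow>\<^sub>E spins"
  have fg: "finitary_gibbs r J n \<tau> = normalized_measure ?C (graph_weight r n \<tau> J 0)"
    unfolding finitary_gibbs_def gibbs_weight_graph[OF \<tau>] ..
  have pb: "pullback r \<tau> v \<in> ?C \<rightarrow> space (config_space r)"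
    unfolding space_config
  proof
    fix x assume x: "x \<in> ?C"
    show "pullback r \<tau> v x \<in> words r \<rightarrow>\<^sub>E spins"
      unfolding pullback_def restrict_PiE_iff using PiE_mem[OF x] perm_hom_in[OF \<tau> _ v] by blast
  qed
  have "prob_space (view_law r J n \<tau> v)"
    unfolding view_law_def fg
    by (intro prob_space.prob_space_distr normalized_prob_space measurable_normalized[THEN iffD2] pb) simp_all
  then show "view_law r J n \<tau> v \<in> config_probs r" by (simp add: config_probs_def view_law_def)
  assume z: "z \<in> word_ball r k \<rightarrow>\<^sub>E spins"
  have "measure (view_law r J n \<tau> v) (cyl r k z) =
      (\<Sum>x\<in>?C. (if pullback r \<tau> v x \<in> cyl r k z then 1 else 0) * graph_weight r n \<tau> J 0 x) /
        sum (graph_weight r n \<tau> J 0) ?C"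
    unfolding view_law_def fg by (intro measure_distr_normalized pb cyl_measurable[OF z]) simp_all
  also have "(\<Sum>x\<in>?C. (if pullback r \<tau> v x \<in> cyl r k z then 1 else 0) * graph_weight r n \<tau> J 0 x) =
      (\<Sum>x\<in>?C. ind r k z (\<lambda>w. x (\<tau> w v)) * graph_weight r n \<tau> J 0 x)"
  proof (intro sum.cong refl)
    fix x assume x: "x \<in> ?C"
    have "pullback r \<tau> v x \<in> words r \<rightarrow>\<^sub>E spins" using pb x by (simp add: space_config Pi_iff)
    moreover have "pullback r \<tau> v x w = x (\<tau> w v)" if "w \<in> word_ball r k" for w
      using word_ball_in[OF that] by (simp add: pullback_def)
    ultimately have "pullback r \<tau> v x \<in> cyl r k z \<longleftrightarrow> (\<forall>w\<in>word_ball r k. x (\<tau> w v) = z w)"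
      by (simp add: cyl_def)
    then show "(if pullback r \<tau> v x \<in> cyl r k z then 1 else 0) * graph_weight r n \<tau> J 0 x =
      ind r k z (\<lambda>w. x (\<tau> w v)) * graph_weight r n \<tau> J 0 x" by (simp add: ind_def)
  qed
  finally show "measure (view_law r J n \<tau> v) (cyl r k z) = graph_exp r n \<tau> J 0 (\<lambda>x. ind r k z (\<lambda>w. x (\<tau> w v)))"
    by (simp add: graph_exp_def ssum_def)
qed

abbreviation (input) mean_state :: "nat \<Rightarrow> real \<Rightarrow> (word \<Rightarrow> real) measure" where
  "mean_state r J \<equiv> average_measure (plus_state r J) (minus_state r J)"

lemma mean_state:
  assumes J: "J > 0"
  shows "mean_state r J \<in> config_probs r"
    and "k \<ge> 1 \<Longrightarrow> z \<in> word_ball r k \<rightarrow>\<^sub>E spins \<Longrightarrow>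
      measure (mean_state r J) (cyl r k z) = ball_exp r J k (\<lambda>_. plus_field r J) (even_ind r k z)"
proof -
  have s: "1 \<in> spins" "-1 \<in> spins" by (simp_all add: spins_def)
  note avg = average_measure[OF boundary_state(1)[OF J s(1), of r] boundary_state(1)[OF J s(2), of r]]
  show "mean_state r J \<in> config_probs r" by (rule avg(1))
  assume k: "k \<ge> 1" and z: "z \<in> word_ball r k \<rightarrow>\<^sub>E spins"
  have "measure (mean_state r J) (cyl r k z) =
      (ball_exp r J k (\<lambda>_. 1 * plus_field r J) (ind r k z) + ball_exp r J k (\<lambda>_. -1 * plus_field r J) (ind r k z)) / 2"
    unfolding avg(2)[OF cyl_measurable[OF z]] boundary_state(2)[OF J s(1) k z] boundary_state(2)[OF J s(2) k z] ..
  also have "\<dots> = ball_exp r J k (\<lambda>_. plus_field r J) (even_ind r k z)"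
    using ball_exp_even_ind[of r J k "plus_field r J" z] by simp
  finally show "measure (mean_state r J) (cyl r k z) = ball_exp r J k (\<lambda>_. plus_field r J) (even_ind r k z)" .
qed

text \<open>The deterministic property through which the random model enters: soficity and the local
  limit both follow from it.\<close>

definition good_sequence :: "nat \<Rightarrow> (nat \<Rightarrow> word \<Rightarrow> nat \<Rightarrow> nat) \<Rightarrow> bool" where
  "good_sequence r \<tau> \<longleftrightarrow> (\<forall>n. \<tau> n \<in> perm_homs r n) \<and>
    (\<forall>R \<kappa>. \<kappa> > 0 \<longrightarrow> (\<forall>\<^sub>F n in sequentially. (1 - \<kappa>) * real n \<le> real (card (good r n (\<tau> n) R))))"

lemma good_sequence_sofic:
  assumes "good_sequence r \<tau>"
  shows "sofic_approximation r \<tau>"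
  unfolding sofic_approximation_def
proof (intro conjI allI impI)
  show "\<tau> n \<in> perm_homs r n" for n using assms by (simp add: good_sequence_def)
  fix F :: "word set" and \<delta> :: real
  assume F: "finite F \<and> F \<subseteq> words r \<and> \<delta> > 0"
  define R where "R = level F"
  have FR: "F \<subseteq> word_ball r R" unfolding R_def using F by (intro level_ball) auto
  have "\<forall>\<^sub>F n in sequentially. (1 - \<delta> / 2) * real n \<le> real (card (good r n (\<tau> n) R))"
    using assms F by (simp add: good_sequence_def)
  then show "\<forall>\<^sub>F n in sequentially. real (card {v \<in> {1..n}. \<forall>\<gamma>\<^sub>1\<in>F. \<forall>\<gamma>\<^sub>2\<in>F. \<gamma>\<^sub>1 \<noteq> \<gamma>\<^sub>2 \<longrightarrow> \<tau> n \<gamma>\<^sub>1 v \<noteq> \<tau> n \<gamma>\<^sub>2 v})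
      / real n > 1 - \<delta>"
    using eventually_gt_at_top[of 0]
  proof eventually_elim
    case (elim n)
    have "good r n (\<tau> n) R \<subseteq> {v \<in> {1..n}. \<forall>\<gamma>\<^sub>1\<in>F. \<forall>\<gamma>\<^sub>2\<in>F. \<gamma>\<^sub>1 \<noteq> \<gamma>\<^sub>2 \<longrightarrow> \<tau> n \<gamma>\<^sub>1 v \<noteq> \<tau> n \<gamma>\<^sub>2 v}"
      using FR unfolding good_def inj_on_def by blast
    then have "real (card (good r n (\<tau> n) R)) \<le>
        real (card {v \<in> {1..n}. \<forall>\<gamma>\<^sub>1\<in>F. \<forall>\<gamma>\<^sub>2\<in>F. \<gamma>\<^sub>1 \<noteq> \<gamma>\<^sub>2 \<longrightarrow> \<tau> n \<gamma>\<^sub>1 v \<noteq> \<tau> n \<gamma>\<^sub>2 v})"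
      by (intro of_nat_mono card_mono) simp_all
    then have "(1 - \<delta> / 2) * real n \<le>
        real (card {v \<in> {1..n}. \<forall>\<gamma>\<^sub>1\<in>F. \<forall>\<gamma>\<^sub>2\<in>F. \<gamma>\<^sub>1 \<noteq> \<gamma>\<^sub>2 \<longrightarrow> \<tau> n \<gamma>\<^sub>1 v \<noteq> \<tau> n \<gamma>\<^sub>2 v})"
      using elim(1) by linarith
    then have "1 - \<delta> / 2 \<le>
        real (card {v \<in> {1..n}. \<forall>\<gamma>\<^sub>1\<in>F. \<forall>\<gamma>\<^sub>2\<in>F. \<gamma>\<^sub>1 \<noteq> \<gamma>\<^sub>2 \<longrightarrow> \<tau> n \<gamma>\<^sub>1 v \<noteq> \<tau> n \<gamma>\<^sub>2 v}) / real n"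
      using elim(2) by (subst pos_le_divide_eq) simp_all
    then show ?case using F by linarith
  qed
qed

lemma real_card_compl: "real (card ({1..n} - {v \<in> {1..n}. P v})) = real n - real (card {v \<in> {1..n}. P v})"
proof -
  have sub: "{v \<in> {1..n}. P v} \<subseteq> {1..n}" by blast
  have "card {v \<in> {1..n}. P v} \<le> n" using card_mono[OF finite_atLeastAtMost sub] by simp
  then show ?thesis
    by (subst card_Diff_subset[OF finite_subset[OF sub finite_atLeastAtMost] sub]) (simp add: of_nat_diff)
qed

lemma good_sequence_cylinder:
  assumes J: "J > 0" and \<tau>: "good_sequence r \<tau>" and k: "k \<ge> 1" and z: "z \<in> word_ball r k \<rightarrow>\<^sub>E spins"
    and e: "e > 0" and \<delta>: "\<delta> > 0"
  shows "\<forall>\<^sub>F n in sequentially. real (card {v \<in> {1..n}.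
    \<not> \<bar>measure (view_law r J n (\<tau> n) v) (cyl r k z) - measure (mean_state r J) (cyl r k z)\<bar> \<le> e}) \<le> \<delta> * real n"
proof -
  \<comment> \<open>\<open>most_vertices_near_plus\<close> has one number for both the error and the
    fraction of exceptions.\<close>
  define d where "d = min \<delta> e"
  have d: "d > 0" "d \<le> \<delta>" "d \<le> e" using e \<delta> by (auto simp: d_def)
  obtain R \<kappa> where R: "\<kappa> > 0" "\<forall>n \<tau>. \<tau> \<in> perm_homs r n \<longrightarrow> real (card (good r n \<tau> R)) \<ge> (1 - \<kappa>) * real n \<longrightarrow>
    real (card {v \<in> {1..n}. \<bar>graph_exp r n \<tau> J 0 (\<lambda>x. even_ind r k z (\<lambda>w. x (\<tau> w v))) -
      ball_exp r J k (\<lambda>_. plus_field r J) (even_ind r k z)\<bar> \<le> d}) \<ge> (1 - d) * real n"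
    using most_vertices_near_plus[OF J k local_on_even_ind even_obs_even_ind d(1), of r z] by (elim exE conjE)
  have "\<forall>\<^sub>F n in sequentially. (1 - \<kappa>) * real n \<le> real (card (good r n (\<tau> n) R))"
    using \<tau> R(1) by (simp add: good_sequence_def)
  then show ?thesis
  proof eventually_elim
    case (elim n)
    have tn: "\<tau> n \<in> perm_homs r n" using \<tau> by (simp add: good_sequence_def)
    let ?A = "{v \<in> {1..n}. \<bar>graph_exp r n (\<tau> n) J 0 (\<lambda>x. even_ind r k z (\<lambda>w. x (\<tau> n w v))) -
      ball_exp r J k (\<lambda>_. plus_field r J) (even_ind r k z)\<bar> \<le> d}"
    let ?B = "{v \<in> {1..n}. \<not> \<bar>measure (view_law r J n (\<tau> n) v) (cyl r k z) - measure (mean_state r J) (cyl r k z)\<bar> \<le> e}"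
    have eq: "measure (view_law r J n (\<tau> n) v) (cyl r k z) =
        graph_exp r n (\<tau> n) J 0 (\<lambda>x. even_ind r k z (\<lambda>w. x (\<tau> n w v)))" if "v \<in> {1..n}" for v
      unfolding view_law(2)[OF tn that z] graph_exp_even_ind[OF tn that] ..
    have "?B \<subseteq> {1..n} - ?A"
    proof
      fix v assume v: "v \<in> ?B"
      then have vn: "v \<in> {1..n}" by blast
      have "e < \<bar>graph_exp r n (\<tau> n) J 0 (\<lambda>x. even_ind r k z (\<lambda>w. x (\<tau> n w v))) -
          ball_exp r J k (\<lambda>_. plus_field r J) (even_ind r k z)\<bar>"
        using conjunct2[OF v[unfolded mem_Collect_eq]] unfolding eq[OF vn] mean_state(2)[OF J k z] not_le .
      then show "v \<in> {1..n} - ?A" using vn d(3) by simp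
    qed
    then have "real (card ?B) \<le> real (card ({1..n} - ?A))" by (intro of_nat_mono card_mono) simp_all
    also have "real (card ({1..n} - ?A)) = real n - real (card ?A)" by (rule real_card_compl)
    finally have "real (card ?B) \<le> real n - real (card ?A)" by simp
    moreover have "(1 - d) * real n \<le> real (card ?A)" using R(2) tn elim by simp
    moreover have "d * real n \<le> \<delta> * real n" using d(2) by (intro mult_right_mono) simp_all
    ultimately show ?case by (simp add: algebra_simps)
  qed
qed

lemma good_sequence_local_limit:
  assumes J: "J > 0" and \<tau>: "good_sequence r \<tau>"
  shows "has_local_limit r \<tau> (\<lambda>n. finitary_gibbs r J n (\<tau> n)) (mean_state r J)"
  unfolding has_local_limit_def view_law_def[symmetric]
proof (intro conjI allI impI mean_state(1)[OF J])
  fix \<O> assume O: "openin (weak_topology r) \<O> \<and> mean_state r J \<in> \<O>"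
  obtain N e where N: "finite N" "0 \<notin> N" "e > 0" "\<forall>\<rho>\<in>config_probs r.
      (\<forall>k\<in>N. \<forall>z\<in>word_ball r k \<rightarrow>\<^sub>E spins. \<bar>measure \<rho> (cyl r k z) - measure (mean_state r J) (cyl r k z)\<bar> \<le> e) \<longrightarrow> \<rho> \<in> \<O>"
    using weak_neighbourhood[OF conjunct1[OF O] conjunct2[OF O] mean_state(1)[OF J]] by (elim exE conjE)
  define I where "I = Sigma N (\<lambda>k. word_ball r k \<rightarrow>\<^sub>E spins)"
  have I: "finite I" unfolding I_def using N(1) by simp
  let ?p = "\<lambda>n. real (card {v \<in> {1..n}. view_law r J n (\<tau> n) v \<in> \<O>}) / real n"
  show "?p \<longlonglongrightarrow> 1"
  proof (rule tendstoI)
    fix d :: real assume d: "d > 0"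
    \<comment> \<open>Small enough that the exceptions of all \<open>card I\<close> cylinders
      together stay below \<open>d * n\<close>.\<close>
    define \<delta> where "\<delta> = d / (2 * (real (card I) + 1))"
    have "0 \<le> d * real (card I)" using d by simp
    then have "0 < d * real (card I) + d * 2" using d by linarith
    then have \<delta>: "\<delta> > 0" "real (card I) * \<delta> < d" using d by (simp_all add: \<delta>_def field_simps)
    let ?B = "\<lambda>n p. {v \<in> {1..n}. \<not> \<bar>measure (view_law r J n (\<tau> n) v) (cyl r (fst p) (snd p)) -
      measure (mean_state r J) (cyl r (fst p) (snd p))\<bar> \<le> e}"
    have "\<forall>\<^sub>F n in sequentially. \<forall>p\<in>I. real (card (?B n p)) \<le> \<delta> * real n"
    proof (intro eventually_ball_finite[OF I] ballI)
      fix p assume "p \<in> I"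
      then have "fst p \<in> N" and z: "snd p \<in> word_ball r (fst p) \<rightarrow>\<^sub>E spins" by (auto simp: I_def)
      then have "fst p \<ge> 1" using N(2) by (cases "fst p") simp_all
      from good_sequence_cylinder[OF J \<tau> this z N(3) \<delta>(1)]
      show "\<forall>\<^sub>F n in sequentially. real (card (?B n p)) \<le> \<delta> * real n" .
    qed
    then show "\<forall>\<^sub>F n in sequentially. dist (?p n) 1 < d"
      using eventually_gt_at_top[of 0]
    proof eventually_elim
      case (elim n)
      have tn: "\<tau> n \<in> perm_homs r n" using \<tau> by (simp add: good_sequence_def)
      let ?A = "{v \<in> {1..n}. view_law r J n (\<tau> n) v \<in> \<O>}"
      have sub: "{1..n} - ?A \<subseteq> (\<Union>p\<in>I. ?B n p)"
      proof
        fix v assume v: "v \<in> {1..n} - ?A"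
        then have vn: "v \<in> {1..n}" "view_law r J n (\<tau> n) v \<notin> \<O>" by blast+
        have "\<not> (\<forall>k\<in>N. \<forall>z\<in>word_ball r k \<rightarrow>\<^sub>E spins.
          \<bar>measure (view_law r J n (\<tau> n) v) (cyl r k z) - measure (mean_state r J) (cyl r k z)\<bar> \<le> e)"
          using bspec[OF N(4) view_law(1)[OF tn vn(1), of J]] vn(2) by blast
        then obtain k z where kz: "k \<in> N" "z \<in> word_ball r k \<rightarrow>\<^sub>E spins"
          "\<not> \<bar>measure (view_law r J n (\<tau> n) v) (cyl r k z) - measure (mean_state r J) (cyl r k z)\<bar> \<le> e" by blast
        have "(k, z) \<in> I" using kz(1,2) by (simp add: I_def)
        moreover have "v \<in> ?B n (k, z)" using kz(3) vn(1) by simp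
        ultimately show "v \<in> (\<Union>p\<in>I. ?B n p)" by blast
      qed
      have "card ({1..n} - ?A) \<le> card (\<Union>p\<in>I. ?B n p)" by (rule card_mono[OF _ sub]) (simp add: I)
      also have "\<dots> \<le> (\<Sum>p\<in>I. card (?B n p))" by (rule card_UN_le[OF I])
      finally have "real (card ({1..n} - ?A)) \<le> real (\<Sum>p\<in>I. card (?B n p))" by (rule of_nat_mono)
      then have "real n - real (card ?A) \<le> (\<Sum>p\<in>I. real (card (?B n p)))"
        unfolding real_card_compl of_nat_sum .
      also have "\<dots> \<le> (\<Sum>p\<in>I. \<delta> * real n)" using elim(1) by (intro sum_mono) blast
      also have "\<dots> = real (card I) * \<delta> * real n" by simp
      also have "\<dots> < d * real n" using \<delta>(2) elim(2) by (intro mult_strict_right_mono) simp_all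
      finally have lt: "real n - real (card ?A) < d * real n" .
      have "0 \<le> real n - real (card ?A)" unfolding real_card_compl[symmetric] by simp
      then have le: "card ?A \<le> n" by simp
      have "1 - ?p n = (real n - real (card ?A)) / real n" using elim(2) by (simp add: diff_divide_distrib)
      then have "1 - ?p n < d" using lt elim(2) by (simp add: pos_divide_less_eq)
      moreover have "?p n \<le> 1" using le elim(2) by simp
      ultimately show ?case by (simp add: dist_real_def)
    qed
  qed
qed

section \<open>The typical local limit\<close>

text \<open>\<open>\<rho> n\<close> is the largest radius whose threshold \<open>n\<close> has
  passed; each radius becomes available eventually, so \<open>\<rho>\<close> tends to
  infinity.\<close>

lemma diagonal_limit:
  fixes p :: "nat \<Rightarrow> nat \<Rightarrow> real"
  assumes lim: "\<And>R. (\<lambda>n. p R n) \<longlonglongrightarrow> 1" and le: "\<And>R n. p R n \<le> 1"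
  shows "\<exists>\<rho>. filterlim \<rho> at_top sequentially \<and> (\<lambda>n. p (\<rho> n) n) \<longlonglongrightarrow> 1"
proof -
  have "\<forall>R. \<exists>N. \<forall>n\<ge>N. 1 - inverse (real (Suc R)) < p R n"
  proof
    fix R
    have "1 - inverse (real (Suc R)) < 1" by simp
    from order_tendstoD(1)[OF lim this] show "\<exists>N. \<forall>n\<ge>N. 1 - inverse (real (Suc R)) < p R n"
      by (simp add: eventually_sequentially)
  qed
  then obtain N where N: "\<And>R n. N R \<le> n \<Longrightarrow> 1 - inverse (real (Suc R)) < p R n" by metis
  \<comment> \<open>\<open>R \<le> n\<close> keeps the set finite; the 0 inserted below is a default
    for the case that no radius is available yet.\<close>
  define D where "D n = {R. R \<le> n \<and> N R \<le> n}" for n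
  define \<rho> where "\<rho> n = Max (insert 0 (D n))" for n
  have fin: "finite (D n)" for n by (rule finite_subset[of _ "{..n}"]) (auto simp: D_def)
  have ge: "R \<le> \<rho> n" if "max R (N R) \<le> n" for R n
  proof -
    have "R \<in> D n" using that by (simp add: D_def)
    then show ?thesis unfolding \<rho>_def using fin by (intro Max_ge) auto
  qed
  have top: "filterlim \<rho> at_top sequentially"
    unfolding filterlim_at_top eventually_sequentially using ge by blast
  have low: "1 - inverse (real (Suc (\<rho> n))) \<le> p (\<rho> n) n" if "N 0 \<le> n" for n
  proof -
    have "0 \<in> D n" using that by (simp add: D_def)
    then have "\<rho> n \<in> D n" unfolding \<rho>_def using fin[of n] Max_in[of "insert 0 (D n)"] by (metis insert_absorb finite_insert insert_not_empty)
    then show ?thesis using N[of "\<rho> n" n] by (simp add: D_def)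
  qed
  have "(\<lambda>n. p (\<rho> n) n) \<longlonglongrightarrow> 1"
  proof (rule tendsto_sandwich)
    show "\<forall>\<^sub>F n in sequentially. 1 - inverse (real (Suc (\<rho> n))) \<le> p (\<rho> n) n"
      using low by (auto simp: eventually_sequentially)
    show "\<forall>\<^sub>F n in sequentially. p (\<rho> n) n \<le> 1" using le by simp
    have "(\<lambda>n. inverse (real (Suc (\<rho> n)))) \<longlonglongrightarrow> 0"
      by (rule filterlim_compose[OF LIMSEQ_inverse_real_of_nat top])
    from tendsto_diff[OF tendsto_const[of 1] this]
    show "(\<lambda>n. 1 - inverse (real (Suc (\<rho> n)))) \<longlonglongrightarrow> 1" by simp
  qed simp
  then show ?thesis using top by blast
qed

text \<open>A larger radius and a smaller fraction of bad vertices are stronger requirements, so the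
  diagonal choice eventually implies each fixed one.\<close>

lemma mostly_good_sequence:
  assumes \<rho>: "filterlim \<rho> at_top sequentially" and homs: "\<And>n. \<tau> n \<in> perm_homs r n"
    and ev: "\<forall>\<^sub>F n in sequentially. \<tau> n \<in> mostly_good r n (\<rho> n) (inverse (real (Suc (\<rho> n))))"
  shows "good_sequence r \<tau>"
  unfolding good_sequence_def
proof (intro conjI allI impI homs)
  fix R and \<kappa> :: real assume \<kappa>: "\<kappa> > 0"
  have "(\<lambda>n. inverse (real (Suc (\<rho> n)))) \<longlonglongrightarrow> 0"
    by (rule filterlim_compose[OF LIMSEQ_inverse_real_of_nat \<rho>])
  from order_tendstoD(2)[OF this \<kappa>] have "\<forall>\<^sub>F n in sequentially. inverse (real (Suc (\<rho> n))) < \<kappa>" .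
  moreover have "\<forall>\<^sub>F n in sequentially. R \<le> \<rho> n" using \<rho> by (simp add: filterlim_at_top)
  ultimately show "\<forall>\<^sub>F n in sequentially. (1 - \<kappa>) * real n \<le> real (card (good r n (\<tau> n) R))"
    using ev
  proof eventually_elim
    case (elim n)
    have "(1 - \<kappa>) * real n \<le> (1 - inverse (real (Suc (\<rho> n)))) * real n"
      using elim(1) by (intro mult_right_mono) simp_all
    also have "\<dots> \<le> real (card (good r n (\<tau> n) (\<rho> n)))" using elim(3) by (simp add: mostly_good_def)
    also have "\<dots> \<le> real (card (good r n (\<tau> n) R))"
      by (intro of_nat_mono card_mono finite_good good_mono elim(2))
    finally show ?case .
  qed
qed

theorem proposition3p2:
  fixes r :: nat and J :: real
  assumes "J > 0"
  shows "\<exists>S :: nat \<Rightarrow> (word \<Rightarrow> nat \<Rightarrow> nat) set.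
     (\<forall>n. S n \<subseteq> perm_homs r n \<and> S n \<noteq> {}) \<and>
     (\<lambda>n. measure_pmf.prob (pmf_of_set (perm_homs r n)) (S n)) \<longlonglongrightarrow> 1 \<and>
     (\<forall>\<tau>. (\<forall>n. \<tau> n \<in> S n) \<longrightarrow>
        sofic_approximation r \<tau> \<and>
        has_local_limit r \<tau> (\<lambda>n. finitary_gibbs r J n (\<tau> n))
          (average_measure (plus_state r J) (minus_state r J)))"
proof -
  let ?M = "\<lambda>R n. mostly_good r n R (inverse (real (Suc R)))"
  let ?P = "\<lambda>n. measure_pmf.prob (pmf_of_set (perm_homs r n))"
  have "(\<lambda>n. ?P n (?M R n)) \<longlonglongrightarrow> 1" for R by (rule mostly_good_tendsto) simp
  then obtain \<rho> where \<rho>: "filterlim \<rho> at_top sequentially" "(\<lambda>n. ?P n (?M (\<rho> n) n)) \<longlonglongrightarrow> 1"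
    using diagonal_limit[of "\<lambda>R n. ?P n (?M R n)"] by auto
  \<comment> \<open>\<open>S n\<close> has to be non-empty; since the probabilities tend to 1, the
    fallback occurs for finitely many \<open>n\<close> only.\<close>
  define S where "S n = (if ?M (\<rho> n) n = {} then perm_homs r n else ?M (\<rho> n) n)" for n
  have S: "S n \<subseteq> perm_homs r n \<and> S n \<noteq> {}" for n
    using perm_homs_nonempty by (auto simp: S_def mostly_good_def)
  have "\<forall>\<^sub>F n in sequentially. 0 < ?P n (?M (\<rho> n) n)" by (rule order_tendstoD(1)[OF \<rho>(2)]) simp
  then have eq: "\<forall>\<^sub>F n in sequentially. S n = ?M (\<rho> n) n"
    by (rule eventually_mono) (auto simp: S_def)
  have "(\<lambda>n. ?P n (S n)) \<longlonglongrightarrow> 1"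
    by (rule Lim_transform_eventually[OF \<rho>(2)]) (rule eventually_mono[OF eq], simp)
  moreover have "sofic_approximation r \<tau> \<and> has_local_limit r \<tau> (\<lambda>n. finitary_gibbs r J n (\<tau> n)) (mean_state r J)"
    if \<tau>: "\<forall>n. \<tau> n \<in> S n" for \<tau>
  proof -
    have "good_sequence r \<tau>"
    proof (rule mostly_good_sequence[OF \<rho>(1)])
      show "\<tau> n \<in> perm_homs r n" for n using \<tau> S by blast
      show "\<forall>\<^sub>F n in sequentially. \<tau> n \<in> ?M (\<rho> n) n"
        by (rule eventually_mono[OF eq]) (use \<tau> in blast)
    qed
    then show ?thesis using good_sequence_sofic good_sequence_local_limit[OF assms] by blast
  qed
  ultimately show ?thesis using S by blast
qed

end
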